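(* Let $M_+$, $M_-$ be the focal submanifolds, with the induced metric, of a closed connected isoparametric hypersurface in $S^{n+1}(1)$ with $g=6$ distinct principal curvatures, all of multiplicity $m\in\{1,2\}$. (i) When $m=1$, the Ricci curvature of each focal submanifold is not non-negative. (ii) When $m=2$, the Ricci curvature of each focal submanifold is non-negative.
   Context: An isoparametric hypersurface $M^n$ in $S^{n+1}(1)$ is a hypersurface with constant principal curvatures; $g$ is the number of distinct ones, and for $g=6$ all multiplicities equal a common $m\in\{1,2\}$. A closed connected one is a regular level set $f^{-1}(t)$, $-1<t<1$, where $f=F|_{S^{n+1}(1)}$ has image $[-1,1]$ and $F$ is a homogeneous polynomial of degree $g$ on $\mathbb{R}^{n+2}$ satisfying $|\nabla F|^2=g^2|x|^{2g-2}$ and $\Delta F=\frac{m_2-m_1}{2}g^2|x|^{g-2}$. The focal submanifolds are $M_+=f^{-1}(1)$ and $M_-=f^{-1}(-1)$. "Not non-negative" means that there is a tangent vector $X$ with $Ric(X)<0$; "non-negative" means $Ric(X)\ge0$ for all tangent vectors $X$. *)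

theory Defs
  imports "HOL-Analysis.Analysis"
begin

section \<open>Smooth maps and embedded submanifolds of Euclidean space\<close>

primrec Ck_on :: "nat \<Rightarrow> ('a::euclidean_space \<Rightarrow> 'b::real_normed_vector) \<Rightarrow> 'a set \<Rightarrow> bool" where
  "Ck_on 0 f S \<longleftrightarrow> continuous_on S f"
| "Ck_on (Suc k) f S \<longleftrightarrow>
     f differentiable_on S \<and> (\<forall>v. Ck_on k (\<lambda>x. frechet_derivative f (at x) v) S)"

definition smooth_on :: "'a::euclidean_space set \<Rightarrow> ('a \<Rightarrow> 'b::real_normed_vector) \<Rightarrow> bool" where
  "smooth_on S f \<longleftrightarrow> open S \<and> (\<forall>k. Ck_on k f S)"

text \<open>Inverses of charts: smooth immersions of an open subset of the model space that are
  homeomorphisms onto a relatively open subset of \<open>S\<close>.\<close>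

definition local_parametrization ::
    "('d::euclidean_space \<Rightarrow> 'a::euclidean_space) \<Rightarrow> 'd set \<Rightarrow> 'a set \<Rightarrow> bool" where
  "local_parametrization \<phi> U S \<longleftrightarrow>
     smooth_on U \<phi> \<and>
     (\<forall>u\<in>U. inj (frechet_derivative \<phi> (at u))) \<and>
     openin (top_of_set S) (\<phi> ` U) \<and>
     (\<exists>\<psi>. homeomorphism U (\<phi> ` U) \<phi> \<psi>)"

text \<open>The type argument is the model space, so the dimension of the submanifold is \<open>DIM('d)\<close>.\<close>

definition smooth_submanifold ::
    "'d::euclidean_space itself \<Rightarrow> 'a::euclidean_space set \<Rightarrow> bool" where
  "smooth_submanifold (T :: 'd itself) S \<longleftrightarrow>
     (\<forall>p\<in>S. \<exists>(\<phi> :: 'd \<Rightarrow> 'a) U. local_parametrization \<phi> U S \<and> p \<in> \<phi> ` U)"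

text \<open>Differentiability of the curves at \<open>0\<close> suffices: on a smooth embedded submanifold this gives the
  same vectors as smooth curves.\<close>

definition tangent_space :: "'a::euclidean_space set \<Rightarrow> 'a \<Rightarrow> 'a set" where
  "tangent_space S p =
     {v. \<exists>\<gamma> :: real \<Rightarrow> 'a. \<gamma> 0 = p \<and> (\<gamma> has_vector_derivative v) (at 0) \<and>
            eventually (\<lambda>t. \<gamma> t \<in> S) (nhds 0)}"

section \<open>Ricci curvature of a metric on an open subset of a Euclidean space\<close>

text \<open>A metric \<open>g\<close> assigns to each point \<open>u\<close> the bilinear form \<open>g u\<close> on the model space. Vectors
  \<open>x\<close>, \<open>y\<close>, \<open>z\<close> of the model space stand for constant, hence pairwise commuting, vector fields.\<close>

type_synonym 'd metric_tensor = "'d \<Rightarrow> 'd \<Rightarrow> 'd \<Rightarrow> real"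

definition metric_deriv ::
    "'d::euclidean_space metric_tensor \<Rightarrow> 'd \<Rightarrow> 'd \<Rightarrow> 'd \<Rightarrow> 'd \<Rightarrow> real" where
  "metric_deriv g u w x y = frechet_derivative (\<lambda>v. g v x y) (at u) w"

text \<open>The Levi-Civita derivative of the constant field \<open>y\<close> along \<open>x\<close>, given by the Koszul formula.\<close>

definition christoffel :: "'d::euclidean_space metric_tensor \<Rightarrow> 'd \<Rightarrow> 'd \<Rightarrow> 'd \<Rightarrow> 'd" where
  "christoffel g u x y =
     (THE w. \<forall>z. g u w z =
        (metric_deriv g u x y z + metric_deriv g u y x z - metric_deriv g u z x y) / 2)"

text \<open>Sign convention: \<open>R(x,y)z = \<nabla>\<^sub>x\<nabla>\<^sub>yz - \<nabla>\<^sub>y\<nabla>\<^sub>xz\<close> for commuting \<open>x\<close>, \<open>y\<close>.\<close>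

definition riemann :: "'d::euclidean_space metric_tensor \<Rightarrow> 'd \<Rightarrow> 'd \<Rightarrow> 'd \<Rightarrow> 'd \<Rightarrow> 'd" where
  "riemann g u x y z =
     frechet_derivative (\<lambda>v. christoffel g v y z) (at u) x
     - frechet_derivative (\<lambda>v. christoffel g v x z) (at u) y
     + christoffel g u x (christoffel g u y z)
     - christoffel g u y (christoffel g u x z)"

text \<open>\<open>Ric(y,z)\<close> is the trace of \<open>x \<mapsto> R(x,y)z\<close>. A trace does not depend on the inner product, so it
  may be computed in the standard basis of the model space.\<close>

definition ricci :: "'d::euclidean_space metric_tensor \<Rightarrow> 'd \<Rightarrow> 'd \<Rightarrow> 'd \<Rightarrow> real" where
  "ricci g u y z = (\<Sum>i\<in>Basis. riemann g u i y z \<bullet> i)"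

definition induced_metric ::
    "('d::euclidean_space \<Rightarrow> 'a::euclidean_space) \<Rightarrow> 'd metric_tensor" where
  "induced_metric \<phi> u x y = frechet_derivative \<phi> (at u) x \<bullet> frechet_derivative \<phi> (at u) y"

text \<open>Every tangent vector of \<open>S\<close> at \<open>\<phi> u\<close> is the image under the derivative of \<open>\<phi>\<close> at \<open>u\<close> of a unique
  vector \<open>x\<close> of the model space. The negation of this predicate provides a tangent vector in
  whose direction the Ricci curvature is negative.\<close>

definition ricci_nonnegative ::
    "'d::euclidean_space itself \<Rightarrow> 'a::euclidean_space set \<Rightarrow> bool" where
  "ricci_nonnegative (T :: 'd itself) S \<longleftrightarrow>
     (\<forall>(\<phi> :: 'd \<Rightarrow> 'a) U. local_parametrization \<phi> U S \<longrightarrow>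
        (\<forall>u\<in>U. \<forall>x. ricci (induced_metric \<phi>) u x x \<ge> 0))"

section \<open>Isoparametric hypersurfaces of the unit sphere\<close>

definition unit_normal_field :: "'a::euclidean_space set \<Rightarrow> ('a \<Rightarrow> 'a) \<Rightarrow> bool" where
  "unit_normal_field M \<xi> \<longleftrightarrow>
     (\<exists>W. M \<subseteq> W \<and> smooth_on W \<xi>) \<and>
     (\<forall>p\<in>M. norm (\<xi> p) = 1 \<and> \<xi> p \<bullet> p = 0 \<and> (\<forall>v\<in>tangent_space M p. \<xi> p \<bullet> v = 0))"

text \<open>For \<open>v\<close> tangent to \<open>M\<close> the ambient derivative of \<open>\<xi>\<close> is already tangent to \<open>M\<close>: it is orthogonal
  to \<open>\<xi> p\<close>, and to \<open>p\<close> by differentiating \<open>\<xi> x \<bullet> x = 0\<close> along \<open>M\<close>. So no projection is needed.\<close>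

definition shape_operator :: "('a::euclidean_space \<Rightarrow> 'a) \<Rightarrow> 'a \<Rightarrow> 'a \<Rightarrow> 'a" where
  "shape_operator \<xi> p v = - frechet_derivative \<xi> (at p) v"

definition principal_space ::
    "'a::euclidean_space set \<Rightarrow> ('a \<Rightarrow> 'a) \<Rightarrow> 'a \<Rightarrow> real \<Rightarrow> 'a set" where
  "principal_space M \<xi> p k = {v \<in> tangent_space M p. shape_operator \<xi> p v = k *\<^sub>R v}"

definition principal_curvatures ::
    "'a::euclidean_space set \<Rightarrow> ('a \<Rightarrow> 'a) \<Rightarrow> 'a \<Rightarrow> real set" where
  "principal_curvatures M \<xi> p = {k. \<exists>v\<in>principal_space M \<xi> p k. v \<noteq> 0}"

definition multiplicity_of ::
    "'a::euclidean_space set \<Rightarrow> ('a \<Rightarrow> 'a) \<Rightarrow> 'a \<Rightarrow> real \<Rightarrow> nat" where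
  "multiplicity_of M \<xi> p k = dim (principal_space M \<xi> p k)"

text \<open>The choice of a global unit normal field is no restriction: a compact embedded hypersurface
  of a sphere is two-sided.\<close>

definition closed_connected_isoparametric ::
    "'e::euclidean_space itself \<Rightarrow> 'a::euclidean_space set \<Rightarrow> ('a \<Rightarrow> 'a) \<Rightarrow> bool" where
  "closed_connected_isoparametric (T :: 'e itself) M \<xi> \<longleftrightarrow>
     DIM('a) = DIM('e) + 2 \<and> M \<subseteq> sphere 0 1 \<and> M \<noteq> {} \<and> compact M \<and> connected M \<and>
     smooth_submanifold TYPE('e) M \<and> unit_normal_field M \<xi> \<and>
     (\<forall>p\<in>M. \<forall>q\<in>M.
        principal_curvatures M \<xi> p = principal_curvatures M \<xi> q \<and>
        (\<forall>k. multiplicity_of M \<xi> p k = multiplicity_of M \<xi> q k))"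

section \<open>Cartan--Muenzner polynomials and focal submanifolds\<close>

definition gradient :: "('a::euclidean_space \<Rightarrow> real) \<Rightarrow> 'a \<Rightarrow> 'a" where
  "gradient F x = (\<Sum>b\<in>Basis. frechet_derivative F (at x) b *\<^sub>R b)"

definition laplacian :: "('a::euclidean_space \<Rightarrow> real) \<Rightarrow> 'a \<Rightarrow> real" where
  "laplacian F x =
     (\<Sum>b\<in>Basis. frechet_derivative (\<lambda>y. frechet_derivative F (at y) b) (at x) b)"

definition homogeneous_polynomial :: "nat \<Rightarrow> ('a::euclidean_space \<Rightarrow> real) \<Rightarrow> bool" where
  "homogeneous_polynomial g F \<longleftrightarrow>
     real_polynomial_function F \<and> (\<forall>c x. F (c *\<^sub>R x) = c ^ g * F x)"

definition cartan_muenzner_polynomial ::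
    "nat \<Rightarrow> nat \<Rightarrow> nat \<Rightarrow> ('a::euclidean_space \<Rightarrow> real) \<Rightarrow> bool" where
  "cartan_muenzner_polynomial g m1 m2 F \<longleftrightarrow>
     homogeneous_polynomial g F \<and>
     (\<forall>x. (norm (gradient F x))\<^sup>2 = (real g)\<^sup>2 * norm x ^ (2 * g - 2)) \<and>
     (\<forall>x. laplacian F x = (real m2 - real m1) / 2 * (real g)\<^sup>2 * norm x ^ (g - 2))"

definition sphere_level :: "('a::euclidean_space \<Rightarrow> real) \<Rightarrow> real \<Rightarrow> 'a set" where
  "sphere_level F t = {x \<in> sphere 0 1. F x = t}"

definition focal_plus :: "('a::euclidean_space \<Rightarrow> real) \<Rightarrow> 'a set" where
  "focal_plus F = sphere_level F 1"

definition focal_minus :: "('a::euclidean_space \<Rightarrow> real) \<Rightarrow> 'a set" where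
  "focal_minus F = sphere_level F (- 1)"

end

theory Submission
  imports Defs
begin

text \<open>Let \<open>F p = 1\<close> with \<open>p\<close> on the unit sphere. By the equation for \<open>\<bar>\<nabla>F\<bar>\<^sup>2\<close> the Hessian of \<open>F\<close> has
  the eigenvalues \<open>30\<close> on \<open>\<real> p\<close>, \<open>6\<close> on the tangent space and \<open>-30\<close> on the normal space of the focal set at \<open>p\<close>,
  and \<open>D\<^sup>3F(p) / 36\<close> restricts to the second fundamental form. Along the line \<open>p + s w\<close>, for a unit normal
  \<open>w\<close>, the Hessian satisfies a Riccati equation; solving it shows that the shape operator
  \<open>S\<^sub>w\<close> has eigenvalues in \<open>{0, \<plusminus>1/\<surd>3, \<plusminus>\<surd>3}\<close>, and harmonicity of \<open>F\<close> makes it trace-free. The Gauss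
  equation then gives \<open>Ric(X,X) = (5m - 1)\<bar>X\<bar>\<^sup>2 - \<Sum>\<bar>S\<^sub>c X\<bar>\<^sup>2\<close>, summed over an orthonormal basis \<open>c\<close> of the
  \<open>(m + 1)\<close>-dimensional normal space.

  For \<open>m = 2\<close> each of the three summands is at most \<open>3\<bar>X\<bar>\<^sup>2\<close>, so \<open>Ric \<ge> 0\<close>. For \<open>m = 1\<close> harmonicity forces some
  \<open>S\<^sub>w\<close> to have a unit eigenvector \<open>e\<close> for \<open>\<surd>3\<close>. As all operators \<open>cos \<theta> S\<^sub>w + sin \<theta> S\<^sub>w'\<close> satisfy the same
  quintic equation, second order perturbation theory yields \<open>\<bar>S\<^sub>w' e\<bar> \<ge> 1\<close>, with equality only if
  \<open>S\<^sub>w' e\<close> is an eigenvector of \<open>S\<^sub>w\<close> for \<open>1/\<surd>3\<close>. Hence \<open>Ric(e,e) \<le> 0\<close>; if \<open>Ric \<ge> 0\<close>, then equality holds and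
  the same perturbation argument at \<open>S\<^sub>w' e\<close> gives a contradiction.\<close>

section \<open>Linear algebra in Euclidean spaces\<close>

text \<open>The obstacle is that the focal set is not known to be a submanifold at the start, so no
  normal exponential map is available. \<open>T\<close> and \<open>N\<close> are therefore
  eigenspaces of the Hessian at \<open>p\<close>, and what the classical argument reads off from a
  tube around the focal set is derived from differential equations along the lines
  \<open>p + s *\<^sub>R w\<close>. These are singular at \<open>s = 0\<close>; uniqueness still
  holds among polynomial curves with vanishing value and first derivative at \<open>0\<close>,
  because 30 is the top eigenvalue of the Hessian at \<open>p\<close>. The solutions are guessed
  from the plane spanned by \<open>p\<close> and \<open>w\<close>, where \<open>F\<close> is the
  real part of \<open>z^6\<close>; the eigenvalues
  \<open>0, \<plusminus>1/\<surd>3, \<plusminus>\<surd>3\<close> are the finite cotangents of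
  multiples of \<open>\<pi>/6\<close>. Charts are constructed afterwards; without them the failure
  of non-negativity could not be witnessed. Only \<open>focal_plus\<close> is treated: equal
  multiplicities make \<open>F\<close> harmonic, so \<open>- F\<close> satisfies the same equations
  and exchanges the two focal sets. The hypersurface itself contributes the dimension
  \<open>n = 6 * m\<close>, as the sum of its multiplicities.\<close>

lemma linear_Basis_expansion:
  fixes L :: "'a::euclidean_space \<Rightarrow> 'b::real_vector"
  shows "linear L \<Longrightarrow> L z = (\<Sum>i\<in>Basis. (z \<bullet> i) *\<^sub>R L i)"
  by (subst euclidean_representation[of z, symmetric]) (simp add: linear_sum linear_cmul del: euclidean_representation)

section \<open>Orthonormal bases of subspaces\<close>

definition ONB :: "'a::euclidean_space set \<Rightarrow> 'a set \<Rightarrow> bool" where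
  "ONB W B \<longleftrightarrow> pairwise orthogonal B \<and> (\<forall>b\<in>B. norm b = 1) \<and> span B = W"

lemma ONB_independent:
  "ONB W B \<Longrightarrow> independent B"
  unfolding ONB_def by (metis norm_zero pairwise_orthogonal_independent zero_neq_one)

lemma ONB_finite: "ONB W B \<Longrightarrow> finite B"
  using ONB_independent independent_imp_finite by blast

lemma ONB_card: "ONB W B \<Longrightarrow> card B = dim W"
  by (metis dim_span_eq_card_independent ONB_def ONB_independent)

lemma ONB_mem: "ONB W B \<Longrightarrow> b \<in> B \<Longrightarrow> b \<in> W"
  unfolding ONB_def using span_base by blast

lemma ONB_inner:
  assumes "ONB W B" "b \<in> B" "c \<in> B"
  shows "b \<bullet> c = (if b = c then 1 else 0)"
  using assms unfolding ONB_def pairwise_def orthogonal_def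
  by (auto simp: norm_eq_1)

lemma ONB_exists:
  fixes W :: "'a::euclidean_space set"
  assumes "subspace W"
  obtains B where "ONB W B"
  using orthonormal_basis_subspace[OF assms] unfolding ONB_def by metis

lemma ONB_expansion:
  assumes B: "ONB W B" and v: "v \<in> W"
  shows "v = (\<Sum>b\<in>B. (v \<bullet> b) *\<^sub>R b)"
proof -
  have fin: "finite B" using ONB_finite[OF B] .
  have "v \<in> span B" using B v unfolding ONB_def by simp
  then obtain u where u: "v = (\<Sum>b\<in>B. u b *\<^sub>R b)"
    using span_finite[OF fin] by auto
  have "v \<bullet> c = u c" if "c \<in> B" for c
  proof -
    have "v \<bullet> c = (\<Sum>b\<in>B. u b * (b \<bullet> c))" unfolding u by (simp add: inner_sum_left)
    also have "\<dots> = (\<Sum>b\<in>B. if b = c then u b else 0)"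
      by (rule sum.cong) (auto simp: ONB_inner[OF B _ that])
    also have "\<dots> = u c" using fin that by simp
    finally show ?thesis .
  qed
  then show ?thesis by (subst u) (rule sum.cong, auto)
qed

lemma ONB_inner_expansion:
  assumes B: "ONB W B" and v: "v \<in> W"
  shows "v \<bullet> z = (\<Sum>b\<in>B. (v \<bullet> b) * (b \<bullet> z))"
proof -
  have "v \<bullet> z = (\<Sum>b\<in>B. (v \<bullet> b) *\<^sub>R b) \<bullet> z"
    using ONB_expansion[OF B v] by simp
  then show ?thesis by (simp add: inner_sum_left)
qed

lemma ONB_Parseval:
  assumes B: "ONB W B" and v: "v \<in> W"
  shows "v \<bullet> v = (\<Sum>b\<in>B. (v \<bullet> b)\<^sup>2)"
  using ONB_inner_expansion[OF B v, of v] by (simp add: power2_eq_square inner_commute)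

lemma ONB_Un:
  assumes B: "ONB V B" and C: "ONB W C"
    and orth: "\<And>v w. v \<in> V \<Longrightarrow> w \<in> W \<Longrightarrow> v \<bullet> w = 0"
  shows "ONB {v + w | v w. v \<in> V \<and> w \<in> W} (B \<union> C)" "B \<inter> C = {}"
proof -
  have bc: "b \<bullet> c = 0" if "b \<in> B" "c \<in> C" for b c
    using that orth ONB_mem[OF B] ONB_mem[OF C] by blast
  show "B \<inter> C = {}"
    using bc ONB_inner[OF B] by force
  have "span (B \<union> C) = {v + w | v w. v \<in> V \<and> w \<in> W}"
    using B C unfolding span_Un ONB_def by auto
  moreover have "pairwise orthogonal (B \<union> C)"
    using B C bc inner_commute unfolding ONB_def pairwise_def orthogonal_def
    by (metis Un_iff)
  ultimately show "ONB {v + w | v w. v \<in> V \<and> w \<in> W} (B \<union> C)"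
    using B C unfolding ONB_def by auto
qed

lemma ONB_singleton:
  "norm p = 1 \<Longrightarrow> ONB (span {p}) {p}"
  unfolding ONB_def by simp

lemma ONB_Basis: "ONB UNIV Basis"
  unfolding ONB_def pairwise_def orthogonal_def by (auto simp: inner_Basis)

lemma trace_ONB:
  fixes A :: "'a::euclidean_space \<Rightarrow> 'a"
  assumes A: "linear A" and B: "ONB UNIV B"
  shows "(\<Sum>b\<in>Basis. A b \<bullet> b) = (\<Sum>b\<in>B. A b \<bullet> b)"
proof -
  have "(\<Sum>b\<in>Basis. A b \<bullet> b) = (\<Sum>b\<in>Basis. \<Sum>c\<in>B. (A b \<bullet> c) * (c \<bullet> b))"
    by (rule sum.cong[OF refl]) (rule ONB_inner_expansion[OF B], simp)
  also have "\<dots> = (\<Sum>c\<in>B. \<Sum>b\<in>Basis. (A b \<bullet> c) * (c \<bullet> b))"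
    by (rule sum.swap)
  also have "\<dots> = (\<Sum>c\<in>B. A (\<Sum>b\<in>Basis. (c \<bullet> b) *\<^sub>R b) \<bullet> c)"
    by (simp add: linear_sum[OF A] linear_cmul[OF A] inner_sum_left mult.commute)
  finally show ?thesis by (simp add: euclidean_representation)
qed

text \<open>First-variation test: the quadratic \<open>t * c - t\<^sup>2 * d\<close> is maximal at
  \<open>t = 0\<close>, so its linear term vanishes. It yields the critical-point equation of a
  Rayleigh quotient and, in the pencil argument, of a quadratic form attaining its extreme
  value.\<close>

lemma linear_le_square_imp_zero:
  fixes c d :: real
  assumes "\<And>t. t * c \<le> t\<^sup>2 * d"
  shows "c = 0"
proof (rule ccontr)
  assume "c \<noteq> 0"
  define D where "D = \<bar>d\<bar> + 1"
  have D: "D > 0" "d \<le> D" unfolding D_def by auto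
  \<comment> \<open>With this \<open>t\<close> the quadratic term is at most half of the linear
    one.\<close>
  define t where "t = c / (2 * D)"
  have "t * c \<le> t\<^sup>2 * d" by (rule assms)
  also have "\<dots> \<le> t\<^sup>2 * D" by (rule mult_left_mono) (use D in auto)
  also have "\<dots> = t * c / 2" unfolding t_def using D by (simp add: power2_eq_square field_simps)
  finally have "t * c \<le> 0" by (simp add: mult.commute)
  moreover have "t * c = c\<^sup>2 / (2 * D)" unfolding t_def by (simp add: power2_eq_square)
  then have "t * c > 0" using D \<open>c \<noteq> 0\<close> by simp
  ultimately show False by simp
qed

section \<open>Spectral theorem on an invariant subspace\<close>

lemma symmetric_has_eigenvector:
  fixes A :: "'a::euclidean_space \<Rightarrow> 'a"
  assumes A: "linear A" and W: "subspace W" "W \<noteq> {0}" and inv: "\<And>v. v \<in> W \<Longrightarrow> A v \<in> W"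
    and sym: "\<And>u v. u \<in> W \<Longrightarrow> v \<in> W \<Longrightarrow> A u \<bullet> v = A v \<bullet> u"
  obtains v k where "v \<in> W" "norm v = 1" "A v = k *\<^sub>R v"
proof -
  have "compact (W \<inter> sphere 0 1)"
    using closed_subspace[OF W(1)] compact_sphere closed_Int_compact by blast
  moreover obtain w where "w \<in> W" "w \<noteq> 0" using W subspace_0 by blast
  then have "w /\<^sub>R norm w \<in> W \<inter> sphere 0 1" using W(1) by (simp add: subspace_scale)
  then have "W \<inter> sphere 0 1 \<noteq> {}" by blast
  moreover have "continuous_on (W \<inter> sphere 0 1) (\<lambda>v. A v \<bullet> v)"
    by (intro continuous_intros linear_continuous_on linear_conv_bounded_linear[THEN iffD1, OF A])
  ultimately obtain v where v: "v \<in> W" "norm v = 1"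
    and max: "\<And>u. u \<in> W \<Longrightarrow> norm u = 1 \<Longrightarrow> A u \<bullet> u \<le> A v \<bullet> v"
    using continuous_attains_sup[of "W \<inter> sphere 0 1" "\<lambda>v. A v \<bullet> v"]
    by (metis Int_iff mem_sphere_0)
  define k where "k = A v \<bullet> v"
  have le: "A z \<bullet> z \<le> k * (z \<bullet> z)" if "z \<in> W" for z
  proof (cases "z = 0")
    case True then show ?thesis by (simp add: linear_0[OF A])
  next
    case False
    have "A (z /\<^sub>R norm z) \<bullet> (z /\<^sub>R norm z) \<le> k"
      unfolding k_def by (rule max) (use that False W(1) in \<open>auto simp: subspace_scale\<close>)
    then have "(A z \<bullet> z) / (norm z)\<^sup>2 \<le> k"
      by (simp add: linear_cmul[OF A] power2_eq_square divide_inverse mult_ac)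
    then show ?thesis using False by (simp add: field_simps power2_norm_eq_inner)
  qed
  have vv: "v \<bullet> v = 1" using v(2) by (simp add: norm_eq_1)
  \<comment> \<open>The unit vector \<open>v\<close> maximises the Rayleigh quotient on
    \<open>W\<close>; criticality says that \<open>A v\<close> has no component in \<open>W\<close>
    orthogonal to \<open>v\<close>.\<close>
  have orth: "A v \<bullet> u = 0" if "u \<in> W" "u \<bullet> v = 0" for u
  proof -
    have "t * (2 * (A v \<bullet> u)) \<le> t\<^sup>2 * (k * (u \<bullet> u) - A u \<bullet> u)" for t
    proof -
      have "v + t *\<^sub>R u \<in> W" using that v W(1) by (simp add: subspace_add subspace_scale)
      from le[OF this] show ?thesis
        using sym[OF that(1) v(1)] that(2) vv
        by (simp add: linear_add[OF A] linear_cmul[OF A] inner_add_left inner_add_right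
            inner_commute[of v u] k_def algebra_simps power2_eq_square)
    qed
    then show ?thesis using linear_le_square_imp_zero by fastforce
  qed
  let ?r = "A v - k *\<^sub>R v"
  have rW: "?r \<in> W" using inv[OF v(1)] v(1) W(1) by (simp add: subspace_diff subspace_scale)
  have rv: "?r \<bullet> v = 0" using vv by (simp add: k_def inner_diff_left)
  have "A v \<bullet> ?r = 0" by (rule orth[OF rW rv])
  then have "?r \<bullet> ?r = 0" using rv by (simp add: inner_diff_left inner_commute)
  then have "A v = k *\<^sub>R v" by simp
  then show ?thesis using v that by blast
qed

text \<open>Induction on the dimension: by symmetry, the orthogonal complement in \<open>W\<close>
  of an eigenvector is again invariant.\<close>

theorem symmetric_orthonormal_eigenbasis:
  fixes A :: "'a::euclidean_space \<Rightarrow> 'a"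
  assumes A: "linear A" and "subspace W" and "\<And>v. v \<in> W \<Longrightarrow> A v \<in> W"
    and sym: "\<And>u v. u \<in> W \<Longrightarrow> v \<in> W \<Longrightarrow> A u \<bullet> v = A v \<bullet> u"
  obtains B k where "ONB W B" "\<And>b. b \<in> B \<Longrightarrow> A b = k b *\<^sub>R b"
proof -
  have "\<exists>B. ONB W B \<and> (\<forall>b\<in>B. \<exists>k. A b = k *\<^sub>R b)"
    using assms(2-)
  proof (induction "dim W" arbitrary: W)
    case 0
    have "W \<subseteq> {0}" using 0(1) dim_eq_0[of W] by simp
    moreover have "0 \<in> W" using 0(2) subspace_0 by blast
    ultimately have "W = {0}" by blast
    then have "ONB W {}" unfolding ONB_def by simp
    then show ?case by blast
  next
    case (Suc n)
    note W = Suc.prems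
    have "W \<noteq> {0}" using Suc.hyps(2) by auto
    obtain v k where v: "v \<in> W" "norm v = 1" "A v = k *\<^sub>R v"
      by (rule symmetric_has_eigenvector[OF A W(1) \<open>W \<noteq> {0}\<close> W(2,3)])
    define V where "V = {u \<in> W. u \<bullet> v = 0}"
    have V: "subspace V"
      using W(1) unfolding V_def subspace_def by (auto simp: inner_add_left)
    have inv: "A u \<in> V" if "u \<in> V" for u
      using that W(2) W(3)[of u v] v unfolding V_def by (simp add: inner_commute)
    obtain C0 where C0: "ONB V C0" using ONB_exists[OF V] .
    have split: "W = {x + y |x y. x \<in> V \<and> y \<in> span {v}}"
    proof safe
      fix w assume "w \<in> W"
      have "w - (w \<bullet> v) *\<^sub>R v \<in> V"
        using v \<open>w \<in> W\<close> W(1) unfolding V_def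
        by (auto simp: inner_diff_left subspace_diff subspace_scale norm_eq_1)
      moreover have "(w \<bullet> v) *\<^sub>R v \<in> span {v}" by (simp add: span_mul span_base)
      moreover have "w = (w - (w \<bullet> v) *\<^sub>R v) + (w \<bullet> v) *\<^sub>R v" by simp
      ultimately show "\<exists>x y. w = x + y \<and> x \<in> V \<and> y \<in> span {v}" by blast
    next
      fix x y assume "x \<in> V" "y \<in> span {v}"
      then show "x + y \<in> W"
        using v W(1) unfolding V_def by (auto simp: span_singleton subspace_add subspace_scale)
    qed
    have orth: "x \<bullet> y = 0" if "x \<in> V" "y \<in> span {v}" for x y
      using that unfolding V_def by (auto simp: span_singleton)
    have un: "ONB W (C \<union> {v})" "C \<inter> {v} = {}" if "ONB V C" for C
      using ONB_Un[OF that ONB_singleton[OF v(2)] orth] split by auto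
    have "dim W = dim V + 1"
      using un[OF C0] ONB_card[OF C0] ONB_card[OF un(1)[OF C0]]
        ONB_finite[OF C0] by simp
    then have "n = dim V" using Suc.hyps(2) by simp
    from Suc.hyps(1)[OF this V inv] obtain C where
      C: "ONB V C" "\<forall>b\<in>C. \<exists>k. A b = k *\<^sub>R b"
      using W(3) unfolding V_def by blast
    then show ?case using un(1)[OF C(1)] v(3) by blast
  qed
  then show ?thesis using that by metis
qed

text \<open>Eigenvectors for different eigenvalues are orthogonal, so the members of an eigenbasis
  with eigenvalue \<open>c\<close> span the whole eigenspace \<open>E c\<close>; the eigenbasis is
  partitioned by eigenvalue. This is the count behind \<open>n = 6 * m\<close>.\<close>

lemma sum_dim_eigenspaces:
  fixes A :: "'a::euclidean_space \<Rightarrow> 'a"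
  assumes A: "linear A" and W: "subspace W" and inv: "\<And>v. v \<in> W \<Longrightarrow> A v \<in> W"
    and sym: "\<And>u v. u \<in> W \<Longrightarrow> v \<in> W \<Longrightarrow> A u \<bullet> v = A v \<bullet> u"
  defines "E \<equiv> \<lambda>k. {v \<in> W. A v = k *\<^sub>R v}"
  defines "K \<equiv> {k. \<exists>v\<in>E k. v \<noteq> 0}"
  shows "(\<Sum>k\<in>K. dim (E k)) = dim W"
proof -
  obtain B k where B: "ONB W B" and k: "\<And>b. b \<in> B \<Longrightarrow> A b = k b *\<^sub>R b"
    using symmetric_orthonormal_eigenbasis[OF A W inv sym] by metis
  have fin: "finite B" using ONB_finite[OF B] .
  have nz: "b \<noteq> 0" if "b \<in> B" for b using B that unfolding ONB_def by force
  have coeff: "v \<bullet> b = 0" if "v \<in> E c" "b \<in> B" "k b \<noteq> c" for v b c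
  proof -
    have "A v \<bullet> b = A b \<bullet> v"
      using sym that ONB_mem[OF B] unfolding E_def by blast
    then have "c * (v \<bullet> b) = k b * (v \<bullet> b)"
      using that k[OF that(2)] unfolding E_def by (simp add: inner_commute)
    then show ?thesis using that(3) by simp
  qed
  have E: "ONB (E c) {b\<in>B. k b = c}" for c
  proof -
    have "v \<in> span {b\<in>B. k b = c}" if "v \<in> E c" for v
    proof -
      have "v = (\<Sum>b\<in>B. (v \<bullet> b) *\<^sub>R b)"
        using ONB_expansion[OF B] that unfolding E_def by blast
      also have "\<dots> = (\<Sum>b\<in>{b\<in>B. k b = c}. (v \<bullet> b) *\<^sub>R b)"
        by (rule sum.mono_neutral_right) (use fin coeff[OF that] in auto)
      finally show ?thesis
        by (metis (no_types, lifting) span_base span_mul span_sum)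
    qed
    moreover have "subspace (E c)"
      using W unfolding E_def subspace_def
      by (auto simp: linear_0[OF A] linear_add[OF A] linear_cmul[OF A] algebra_simps)
    then have "span {b\<in>B. k b = c} \<subseteq> E c"
      by (rule span_minimal[rotated]) (use k ONB_mem[OF B] in \<open>auto simp: E_def\<close>)
    ultimately show ?thesis
      using B unfolding ONB_def pairwise_def by blast
  qed
  have K: "K = k ` B"
  proof (intro set_eqI iffI)
    fix c assume "c \<in> K"
    then obtain v where v: "v \<in> E c" "v \<noteq> 0" unfolding K_def by blast
    have "{b\<in>B. k b = c} \<noteq> {}"
      using v E[of c] unfolding ONB_def by fastforce
    then show "c \<in> k ` B" by blast
  next
    fix c assume "c \<in> k ` B"
    then show "c \<in> K"
      using nz k ONB_mem[OF B] unfolding K_def E_def by blast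
  qed
  have "(\<Sum>c\<in>K. dim (E c)) = (\<Sum>c\<in>k ` B. card {b\<in>B. k b = c})"
    unfolding K using ONB_card[OF E] by simp
  also have "\<dots> = card B"
    using sum.image_gen[OF fin, of "\<lambda>_. 1::nat" k] by simp
  finally show ?thesis using ONB_card[OF B] by simp
qed

section \<open>Isospectral pencils of symmetric operators\<close>

text \<open>Six evaluation points determine a quintic. Orders one and two carry the perturbation
  formulas.\<close>

lemma quintic_coefficients:
  fixes c0 c1 c2 c3 c4 c5 :: real
  assumes "\<And>t. c0 + c1 * t + c2 * t^2 + c3 * t^3 + c4 * t^4 + c5 * t^5 = 0"
  shows "c1 = 0" "c2 = 0"
proof -
  show "c1 = 0"
    using assms[of 0] assms[of 1] assms[of "-1"] assms[of 2] assms[of "-2"] assms[of 3] by simp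
  show "c2 = 0"
    using assms[of 0] assms[of 1] assms[of "-1"] assms[of 2] assms[of "-2"] assms[of 3] by simp
qed

text \<open>Modelled on \<open>A = S w\<close>, \<open>B = S w'\<close> for orthonormal normals:
  \<open>A + t B\<close> is \<open>sqrt (1 + t\<^sup>2)\<close> times the shape operator of a unit
  normal. The quintic is \<open>3 x^5 - 10 x^3 + 3 x\<close>, with roots
  \<open>0, \<plusminus>1/\<surd>3, \<plusminus>\<surd>3\<close>, homogenised by this
  factor.\<close>

locale isospectral_pencil =
  fixes T :: "'a::euclidean_space set" and A B :: "'a \<Rightarrow> 'a"
  assumes T: "subspace T" and A: "linear A" and B: "linear B"
    and A_T: "v \<in> T \<Longrightarrow> A v \<in> T" and B_T: "v \<in> T \<Longrightarrow> B v \<in> T"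
    and A_sym: "u \<in> T \<Longrightarrow> v \<in> T \<Longrightarrow> A u \<bullet> v = A v \<bullet> u"
    and B_sym: "u \<in> T \<Longrightarrow> v \<in> T \<Longrightarrow> B u \<bullet> v = B v \<bullet> u"
    and quintic: "v \<in> T \<Longrightarrow> L = (\<lambda>v. A v + t *\<^sub>R B v) \<Longrightarrow>
      3 *\<^sub>R L (L (L (L (L v)))) - (10 * (1 + t\<^sup>2)) *\<^sub>R L (L (L v)) + (3 * (1 + t\<^sup>2)\<^sup>2) *\<^sub>R L v = 0"
begin

text \<open>The coefficients of \<open>t\<close> and \<open>t\<^sup>2\<close> in the quintic equation, paired with an eigenvector of \<open>A\<close>.\<close>

lemma perturbation:
  assumes e: "e \<in> T" "A e = a *\<^sub>R e"
  shows "(15 * a^4 - 30 * a^2 + 3) * (B e \<bullet> e) = 0"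
    and "12 * a^3 * (B e \<bullet> B e) + 9 * a^2 * (B e \<bullet> A (B e)) + 6 * a * (A (B e) \<bullet> A (B e))
      + 3 * (A (A (B e)) \<bullet> A (B e)) - 20 * a * (B e \<bullet> B e) - 10 * (B e \<bullet> A (B e))
      + (6 * a - 10 * a^3) * (e \<bullet> e) = 0"
proof -
  note linA = linear_add[OF A] linear_cmul[OF A] and linB = linear_add[OF B] linear_cmul[OF B]
  define b where "b = B e"
  \<comment> \<open>\<open>x1\<close> and \<open>c\<close> will be the coefficients of
    \<open>t\<close> and \<open>t^2\<close> in \<open>L (L e)\<close>.\<close>
  define x1 where "x1 = a *\<^sub>R b + A b"
  define c where "c = B b"
  have bT: "b \<in> T" "A b \<in> T" "c \<in> T" "x1 \<in> T"
    using e A_T B_T T unfolding b_def c_def x1_def by (auto simp: subspace_add subspace_scale)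
  have Abe: "A b \<bullet> e = a * (b \<bullet> e)" using A_sym[OF bT(1) e(1)] e(2) by (simp add: inner_commute)
  have ce: "c \<bullet> e = b \<bullet> b" using B_sym[OF bT(1) e(1)] by (simp add: c_def b_def inner_commute)
  have coeffs: "0 = (3 * a^5 - 10 * a^3 + 3 * a) * (e \<bullet> e) + ((15 * a^4 - 30 * a^2 + 3) * (b \<bullet> e)) * t
     + (3 * (2 * a^3 * (c \<bullet> e) + A x1 \<bullet> x1 + 2 * a^2 * (b \<bullet> x1)) - 10 * (a * (c \<bullet> e) + x1 \<bullet> b)
         + (6 * a - 10 * a^3) * (e \<bullet> e)) * t^2
     + (3 * (2 * (A x1 \<bullet> c) + B x1 \<bullet> x1 + 2 * a^2 * (c \<bullet> b)) - 10 * (c \<bullet> b)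
         - 10 * (a^2 * (b \<bullet> e) + a * (x1 \<bullet> e)) + 6 * (b \<bullet> e)) * t^3
     + (3 * (A c \<bullet> c + 2 * (B x1 \<bullet> c)) - 10 * (a * (c \<bullet> e) + x1 \<bullet> b) + 3 * a * (e \<bullet> e)) * t^4
     + (3 * (B c \<bullet> c) - 10 * (c \<bullet> b) + 3 * (b \<bullet> e)) * t^5" for t
  proof -
    define L where "L = (\<lambda>v. A v + t *\<^sub>R B v)"
    have LT: "L v \<in> T" if "v \<in> T" for v
      using that A_T B_T T unfolding L_def by (simp add: subspace_add subspace_scale)
    have Lsym: "L u \<bullet> v = u \<bullet> L v" if "u \<in> T" "v \<in> T" for u v
      using A_sym[OF that] B_sym[OF that] unfolding L_def
      by (simp add: inner_add_left inner_add_right inner_commute)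
    define x where "x = L (L e)"
    have Le: "L e = a *\<^sub>R e + t *\<^sub>R b" unfolding L_def e(2) b_def ..
    have x: "x = a^2 *\<^sub>R e + t *\<^sub>R x1 + t^2 *\<^sub>R c"
      unfolding x_def Le unfolding L_def x1_def c_def
      by (simp add: linA linB e(2) b_def algebra_simps power2_eq_square)
    have xT: "x \<in> T" unfolding x_def using LT e by blast
    \<comment> \<open>Symmetry moves two factors \<open>L\<close> to the other side, so that only
      the quadratic polynomial \<open>x = L (L e)\<close> in \<open>t\<close> has to be
      expanded.\<close>
    have 5: "L (L (L (L (L e)))) \<bullet> e = L x \<bullet> x"
      unfolding x_def using Lsym LT e(1) by metis
    have 3: "L (L (L e)) \<bullet> e = x \<bullet> L e"
      unfolding x_def using Lsym LT e(1) by metis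
    have "0 = (3 *\<^sub>R L (L (L (L (L e)))) - (10 * (1 + t\<^sup>2)) *\<^sub>R L (L (L e)) + (3 * (1 + t\<^sup>2)\<^sup>2) *\<^sub>R L e) \<bullet> e"
      using quintic[OF e(1) L_def] by simp
    also have "\<dots> = 3 * (L x \<bullet> x) - 10 * (1 + t\<^sup>2) * (x \<bullet> L e) + 3 * (1 + t\<^sup>2)\<^sup>2 * (L e \<bullet> e)"
      by (simp only: inner_add_left inner_diff_left inner_scaleR_left 5 3)
    finally have *: "0 = 3 * (L x \<bullet> x) - 10 * (1 + t\<^sup>2) * (x \<bullet> L e) + 3 * (1 + t\<^sup>2)\<^sup>2 * (L e \<bullet> e)" .
    have x1e: "x1 \<bullet> e = 2 * a * (b \<bullet> e)" using Abe by (simp add: x1_def inner_add_left)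
    have sy: "e \<bullet> x1 = x1 \<bullet> e" "e \<bullet> c = c \<bullet> e" "e \<bullet> b = b \<bullet> e" "c \<bullet> b = b \<bullet> c" "x1 \<bullet> b = b \<bullet> x1"
      "A x1 \<bullet> e = a * (x1 \<bullet> e)" "A c \<bullet> e = a * (c \<bullet> e)" "A c \<bullet> x1 = A x1 \<bullet> c"
      "B x1 \<bullet> e = b \<bullet> x1" "B c \<bullet> e = b \<bullet> c" "B c \<bullet> x1 = B x1 \<bullet> c"
      using A_sym[OF bT(4) e(1)] A_sym[OF bT(3) e(1)] A_sym[OF bT(4,3)] B_sym[OF bT(4) e(1)]
        B_sym[OF bT(3) e(1)] B_sym[OF bT(3,4)]
      by (simp_all add: e(2) b_def inner_commute)
    have Lx: "L x = a^3 *\<^sub>R e + t *\<^sub>R (A x1 + a^2 *\<^sub>R b) + t^2 *\<^sub>R (A c + B x1) + t^3 *\<^sub>R B c"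
      unfolding x unfolding L_def
      by (simp add: linA linB e(2) b_def[symmetric] algebra_simps power2_eq_square power3_eq_cube)
    note inn = inner_add_left inner_add_right inner_scaleR_left inner_scaleR_right sy
    have LxX: "L x \<bullet> x = a^5 * (e \<bullet> e) + t * (2 * a^3 * (x1 \<bullet> e) + a^4 * (b \<bullet> e))
      + t^2 * (2 * a^3 * (c \<bullet> e) + A x1 \<bullet> x1 + 2 * a^2 * (b \<bullet> x1))
      + t^3 * (2 * (A x1 \<bullet> c) + B x1 \<bullet> x1 + 2 * a^2 * (b \<bullet> c))
      + t^4 * (A c \<bullet> c + 2 * (B x1 \<bullet> c)) + t^5 * (B c \<bullet> c)"
      unfolding Lx unfolding x inn by (simp add: algebra_simps eval_nat_numeral)
    have xL: "x \<bullet> L e = a^3 * (e \<bullet> e) + t * (a^2 * (b \<bullet> e) + a * (x1 \<bullet> e))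
      + t^2 * (a * (c \<bullet> e) + b \<bullet> x1) + t^3 * (b \<bullet> c)"
      unfolding Le unfolding x inn by (simp add: algebra_simps eval_nat_numeral)
    have Lee: "L e \<bullet> e = a * (e \<bullet> e) + t * (b \<bullet> e)"
      unfolding Le inn ..
    show ?thesis
      unfolding * LxX xL Lee sy x1e by (simp add: algebra_simps eval_nat_numeral)
  qed
  from quintic_coefficients[OF coeffs[symmetric]]
  have 1: "(15 * a^4 - 30 * a^2 + 3) * (b \<bullet> e) = 0"
    and 2: "3 * (2 * a^3 * (c \<bullet> e) + A x1 \<bullet> x1 + 2 * a^2 * (b \<bullet> x1)) - 10 * (a * (c \<bullet> e) + x1 \<bullet> b)
         + (6 * a - 10 * a^3) * (e \<bullet> e) = 0" by blast+
  \<comment> \<open>The factor is the derivative of \<open>3 a^5 - 10 a^3 + 3 a\<close>. At a simple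
    root it is nonzero, and then \<open>B e \<bullet> e\<close>, the first order change of the
    eigenvalue, vanishes.\<close>
  show "(15 * a^4 - 30 * a^2 + 3) * (B e \<bullet> e) = 0" using 1 by (simp add: b_def)
  have "A (A b) \<bullet> b = A b \<bullet> A b" using A_sym[OF bT(2,1)] by simp
  then show "12 * a^3 * (B e \<bullet> B e) + 9 * a^2 * (B e \<bullet> A (B e)) + 6 * a * (A (B e) \<bullet> A (B e))
      + 3 * (A (A (B e)) \<bullet> A (B e)) - 20 * a * (B e \<bullet> B e) - 10 * (B e \<bullet> A (B e))
      + (6 * a - 10 * a^3) * (e \<bullet> e) = 0"
    using 2 unfolding ce unfolding x1_def b_def[symmetric]
    by (simp add: linA inner_add_left inner_add_right inner_commute[of "A b" b] algebra_simps
        power2_eq_square power3_eq_cube)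
qed

text \<open>The bound 4 is \<open>5 * m - 1\<close> for \<open>m = 1\<close>, the coefficient of the
  positive term of the Ricci curvature.\<close>

lemma exists_large_square_sum:
  assumes a: "a\<^sup>2 = 3" "a > 0" and e: "e \<in> T" "e \<bullet> e = 1" "A e = a *\<^sub>R e"
  shows "\<exists>v\<in>T. A v \<bullet> A v + B v \<bullet> B v > 4 * (v \<bullet> v)"
proof (rule ccontr)
  assume "\<not> ?thesis"
  then have le: "A v \<bullet> A v + B v \<bullet> B v \<le> 4 * (v \<bullet> v)" if "v \<in> T" for v
    using that by force
  note linA = linear_add[OF A] linear_cmul[OF A] and linB = linear_add[OF B] linear_cmul[OF B]
  have a3: "a^3 = 3 * a" and a4: "a^4 = 9" and aa: "a * a = 3"
    using a(1) by (auto simp: power2_eq_square power3_eq_cube power4_eq_xxxx)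
  define b where "b = B e"
  have bT: "b \<in> T" unfolding b_def using B_T e by blast
  \<comment> \<open>For \<open>a\<^sup>2 = 3\<close> the factor in the first order formula is 48.
    Polarisation then makes \<open>b\<close> orthogonal to the whole eigenspace of
    \<open>a\<close>.\<close>
  have diag: "B u \<bullet> u = 0" if "u \<in> T" "A u = a *\<^sub>R u" for u
    using perturbation(1)[OF that] by (simp add: a4 a(1))
  have b_orth: "b \<bullet> u = 0" if u: "u \<in> T" "A u = a *\<^sub>R u" for u
  proof -
    have "B (e + u) \<bullet> (e + u) = 0"
      by (rule diag) (use e u T in \<open>auto simp: subspace_add linA algebra_simps\<close>)
    moreover have "B u \<bullet> e = B e \<bullet> u" using B_sym[OF u(1) e(1)] .
    ultimately show ?thesis
      using diag[OF e(1,3)] diag[OF u] by (simp add: linB inner_add_left inner_add_right b_def)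
  qed
  obtain C k where C: "ONB T C" and k: "\<And>c. c \<in> C \<Longrightarrow> A c = k c *\<^sub>R c"
    using symmetric_orthonormal_eigenbasis[OF A T A_T A_sym] by metis
  note CT = ONB_mem[OF C]
  have roots: "k c = 0 \<or> k c = a \<or> k c = - a \<or> k c = a / 3 \<or> k c = - a / 3" if c: "c \<in> C" for c
  proof -
    have "c \<noteq> 0" using C c unfolding ONB_def by force
    moreover have "3 *\<^sub>R A (A (A (A (A c)))) - 10 *\<^sub>R A (A (A c)) + 3 *\<^sub>R A c = 0"
      using quintic[OF CT[OF c], of A 0] by simp
    then have "(3 * k c^5 - 10 * k c^3 + 3 * k c) *\<^sub>R c = 0"
      by (simp add: k[OF c] linA algebra_simps eval_nat_numeral)
    ultimately have "3 * k c^5 - 10 * k c^3 + 3 * k c = 0" by simp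
    moreover have "(k c - a) * (k c + a) = (k c)^2 - 3" "(k c - a/3) * (k c + a/3) = (k c)^2 - 1/3"
      using aa by (simp_all add: algebra_simps power2_eq_square)
    then have "3 * k c^5 - 10 * k c^3 + 3 * k c =
       3 * k c * ((k c - a) * (k c + a)) * ((k c - a/3) * (k c + a/3))"
      by (simp add: algebra_simps eval_nat_numeral)
    ultimately show ?thesis by auto
  qed
  define \<beta> where "\<beta> c = b \<bullet> c" for c
  have Ac: "A v \<bullet> c = k c * (v \<bullet> c)" if "v \<in> T" "c \<in> C" for v c
    using A_sym[OF that(1) CT[OF that(2)]] k[OF that(2)] by (simp add: inner_commute)
  have e1: "b \<bullet> b = (\<Sum>c\<in>C. \<beta> c^2)"
    using ONB_Parseval[OF C bT] by (simp add: \<beta>_def)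
  have Cv: "v \<bullet> u = (\<Sum>c\<in>C. (v \<bullet> c) * (u \<bullet> c))" if "v \<in> T" for u v
    using ONB_inner_expansion[OF C that, of u] by (simp add: inner_commute)
  have e2: "b \<bullet> A b = (\<Sum>c\<in>C. k c * \<beta> c^2)"
    by (subst Cv[OF bT], rule sum.cong) (auto simp: Ac[OF bT] \<beta>_def power2_eq_square)
  have e3: "A b \<bullet> A b = (\<Sum>c\<in>C. (k c)^2 * \<beta> c^2)"
    by (subst Cv[OF A_T[OF bT]], rule sum.cong) (auto simp: Ac[OF bT] \<beta>_def power2_eq_square)
  have e4: "A (A b) \<bullet> A b = (\<Sum>c\<in>C. (k c)^3 * \<beta> c^2)"
    by (subst Cv[OF A_T[OF A_T[OF bT]]], rule sum.cong) (auto simp: Ac[OF bT] Ac[OF A_T[OF bT]] \<beta>_def power2_eq_square power3_eq_cube)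
  \<comment> \<open>The second order formula with \<open>a\<^sup>2 = 3\<close>; in eigencoordinates
    of \<open>A\<close> it becomes a weighted sum of the squares \<open>\<beta> c^2\<close> with
    prescribed value.\<close>
  have "16 * a * (b \<bullet> b) + 17 * (b \<bullet> A b) + 6 * a * (A b \<bullet> A b) + 3 * (A (A b) \<bullet> A b) = 24 * a"
    using perturbation(2)[OF e(1,3)] by (simp add: e(2) a(1) a3 b_def algebra_simps)
  then have sum1: "(\<Sum>c\<in>C. (16 * a + 17 * k c + 6 * a * (k c)^2 + 3 * (k c)^3) * \<beta> c^2) = 24 * a"
    unfolding e1 e2 e3 e4 sum_distrib_left sum.distrib[symmetric] by (simp add: algebra_simps)
  \<comment> \<open>The term \<open>A e \<bullet> A e\<close> already uses 3 of the allowed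
    4.\<close>
  have "b \<bullet> b \<le> 1" using le[OF e(1)] by (simp add: e(2,3) b_def aa)
  then have sum2: "(\<Sum>c\<in>C. 24 * a * \<beta> c^2) \<le> 24 * a"
    using a(2) by (simp add: e1 sum_distrib_left[symmetric])
  \<comment> \<open>The coefficient is \<open>(a/3 - k) * (3 * k\<^sup>2 + 7 * a * k + 24)\<close>, so it is positive below the eigenvalue \<open>a/3\<close>.\<close>
  define r where "r c = (24 * a - (16 * a + 17 * k c + 6 * a * (k c)^2 + 3 * (k c)^3)) * \<beta> c^2" for c
  have r: "r c \<ge> 0 \<and> (r c = 0 \<longrightarrow> k c * \<beta> c = a / 3 * \<beta> c)" if c: "c \<in> C" for c
  proof -
    have "\<beta> c = 0" if "k c = a"
      using b_orth[OF CT[OF c]] k[OF c] that by (simp add: \<beta>_def)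
    moreover have "k c = a / 3 \<or> k c = a \<or>
      24 * a - (16 * a + 17 * k c + 6 * a * (k c)^2 + 3 * (k c)^3) > 0"
      using roots[OF c]
    proof (elim disjE)
      assume k: "k c = 0"
      show ?thesis unfolding k using a(2) by simp
    next
      assume k: "k c = - a"
      show ?thesis unfolding k using a by (simp add: a3)
    next
      assume k: "k c = - a / 3"
      show ?thesis unfolding k using a by (simp add: power_divide a3)
    qed auto
    moreover have "24 * a - (16 * a + 17 * (a/3) + 6 * a * (a/3)^2 + 3 * (a/3)^3) = 0"
      by (simp add: power_divide a3 a(1))
    ultimately show ?thesis by (auto simp: r_def)
  qed
  have sum_r: "sum r C = (\<Sum>c\<in>C. 24 * a * \<beta> c^2) - (\<Sum>c\<in>C. (16 * a + 17 * k c + 6 * a * (k c)^2 + 3 * (k c)^3) * \<beta> c^2)"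
    unfolding r_def sum_subtractf[symmetric] by (simp add: algebra_simps)
  then have "sum r C \<le> 0" using sum1 sum2 by simp
  then have "sum r C = 0" using r sum_nonneg[of C r] by fastforce
  then have r0: "r c = 0" if "c \<in> C" for c
    using sum_nonneg_eq_0_iff[OF ONB_finite[OF C], of r] r that by blast
  have "24 * a * (b \<bullet> b) = 24 * a"
    using sum_r \<open>sum r C = 0\<close> sum1 by (simp add: e1 sum_distrib_left)
  then have bb: "b \<bullet> b = 1" using a(2) by simp
  have Ab: "A b = (a / 3) *\<^sub>R b"
  proof -
    have "A b = (\<Sum>c\<in>C. (A b \<bullet> c) *\<^sub>R c)" by (rule ONB_expansion[OF C A_T[OF bT]])
    also have "\<dots> = (\<Sum>c\<in>C. (a / 3 * (b \<bullet> c)) *\<^sub>R c)"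
      by (rule sum.cong) (use r r0 Ac[OF bT] in \<open>auto simp: \<beta>_def\<close>)
    also have "\<dots> = (a / 3) *\<^sub>R (\<Sum>c\<in>C. (b \<bullet> c) *\<^sub>R c)" by (simp add: scaleR_sum_right)
    finally show ?thesis using ONB_expansion[OF C bT] by simp
  qed
  \<comment> \<open>The form
    \<open>4 * (v \<bullet> v) - A v \<bullet> A v - B v \<bullet> B v\<close> is non-negative on
    \<open>T\<close> and vanishes at \<open>e\<close>, so its first variation there vanishes. Since
    \<open>A (A e) = 3 e\<close>, this will give \<open>B (B e) = e\<close>.\<close>
  have orth: "4 * (e \<bullet> z) - A e \<bullet> A z - B e \<bullet> B z = 0" if z: "z \<in> T" for z
  proof -
    have "t * (2 * (A e \<bullet> A z + B e \<bullet> B z - 4 * (e \<bullet> z)))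
      \<le> t\<^sup>2 * (4 * (z \<bullet> z) - A z \<bullet> A z - B z \<bullet> B z)" for t
    proof -
      have eq: "A e \<bullet> A e + B e \<bullet> B e = 4 * (e \<bullet> e)" using bb by (simp add: e aa b_def[symmetric])
      have "e + t *\<^sub>R z \<in> T" using z e T by (simp add: subspace_add subspace_scale)
      from le[OF this] show ?thesis
        using eq by (simp add: linA linB inner_add_left inner_add_right inner_commute[of z e]
            inner_commute[of "A z" "A e"] inner_commute[of "B z" "B e"] algebra_simps power2_eq_square)
    qed
    then show ?thesis using linear_le_square_imp_zero by fastforce
  qed
  have BbT: "e - B b \<in> T" using e bT B_T T by (simp add: subspace_diff)
  have "(e - B b) \<bullet> z = 0" if z: "z \<in> T" for z
  proof -
    have "A e \<bullet> A z = 3 * (e \<bullet> z)"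
      using A_sym[OF z e(1)] by (simp add: e(3) inner_commute[of e "A z"] inner_commute[of z e] aa flip: mult.assoc)
    moreover have "B e \<bullet> B z = B b \<bullet> z" using B_sym[OF z bT] by (simp add: b_def inner_commute)
    ultimately show ?thesis using orth[OF z] by (simp add: inner_diff_left)
  qed
  then have "e - B b = 0" using BbT by (metis inner_eq_zero_iff)
  then have Bb: "B b = e" by simp
  \<comment> \<open>At the unit eigenvector \<open>b\<close> with eigenvalue \<open>a / 3\<close>
    and \<open>B b = e\<close>, the left side of the second order formula evaluates to
    \<open>32 * a / 9\<close>.\<close>
  show False
    using perturbation(2)[OF bT Ab] a(2)
    by (simp add: Bb e bb linA inner_commute power_divide a(1) a3 aa field_simps)
qed

end

section \<open>Calculus\<close>

text \<open>The mean value theorem is applied along \<open>x\<close> to the difference in direction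
  \<open>s y\<close>, then along \<open>y\<close> to the derivative so obtained.\<close>

lemma second_difference_mean_value:
  fixes f :: "'a::real_normed_vector \<Rightarrow> real"
  assumes f: "\<And>z. z \<in> ball u d \<Longrightarrow> (f has_derivative f' z) (at z)"
    and f2: "\<And>z. z \<in> ball u d \<Longrightarrow> ((\<lambda>z. f' z x) has_derivative f2 z) (at z)"
    and s: "0 < s" "s * (norm x + norm y) < d"
  shows "\<exists>z\<in>ball u d. f (u + s *\<^sub>R x + s *\<^sub>R y) - f (u + s *\<^sub>R x) - f (u + s *\<^sub>R y) + f u = s\<^sup>2 * f2 z y"
proof -
  have ball: "u + r *\<^sub>R x + q *\<^sub>R y \<in> ball u d" if "0 \<le> r" "r \<le> s" "0 \<le> q" "q \<le> s" for r q
  proof -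
    have "norm (r *\<^sub>R x + q *\<^sub>R y) \<le> r * norm x + q * norm y"
      using that norm_triangle_ineq[of "r *\<^sub>R x" "q *\<^sub>R y"] by simp
    also have "\<dots> \<le> s * (norm x + norm y)"
      using that by (simp add: distrib_left add_mono mult_right_mono)
    also have "\<dots> < d" by (rule s)
    finally have "norm (r *\<^sub>R x + q *\<^sub>R y) < d" .
    moreover have "u + r *\<^sub>R x + q *\<^sub>R y - u = r *\<^sub>R x + q *\<^sub>R y" by simp
    ultimately show ?thesis unfolding mem_ball by (metis dist_commute dist_norm)
  qed
  let ?g = "\<lambda>r. f (u + r *\<^sub>R x + s *\<^sub>R y) - f (u + r *\<^sub>R x + 0 *\<^sub>R y)"
  let ?g' = "\<lambda>r. f' (u + r *\<^sub>R x + s *\<^sub>R y) x - f' (u + r *\<^sub>R x + 0 *\<^sub>R y) x"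
  have d1: "((\<lambda>r. f (u + r *\<^sub>R x + q *\<^sub>R y)) has_real_derivative f' (u + r *\<^sub>R x + q *\<^sub>R y) x) (at r)"
    if "0 \<le> r" "r \<le> s" "0 \<le> q" "q \<le> s" for r q
  proof -
    note D = f[OF ball[OF that]]
    have "((\<lambda>r. u + r *\<^sub>R x + q *\<^sub>R y) has_derivative (\<lambda>h. h *\<^sub>R x)) (at r)"
      by (auto intro!: derivative_eq_intros)
    from has_derivative_compose[OF this D] show ?thesis
      using linear_cmul[OF has_derivative_linear[OF D]]
      by (simp add: has_field_derivative_def mult_commute_abs)
  qed
  have g: "(?g has_real_derivative ?g' r) (at r)" if "0 \<le> r" "r \<le> s" for r
    by (intro DERIV_diff d1) (use that s in auto)
  from MVT2[OF s(1) g] obtain r where r: "0 < r" "r < s" "?g s - ?g 0 = (s - 0) * ?g' r" by blast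
  have d2: "((\<lambda>q. f' (u + r *\<^sub>R x + q *\<^sub>R y) x) has_real_derivative f2 (u + r *\<^sub>R x + q *\<^sub>R y) y) (at q)"
    if "0 \<le> q" "q \<le> s" for q
  proof -
    have D: "((\<lambda>z. f' z x) has_derivative f2 (u + r *\<^sub>R x + q *\<^sub>R y)) (at (u + r *\<^sub>R x + q *\<^sub>R y))"
      by (rule f2, rule ball) (use that r in auto)
    have "((\<lambda>q. u + r *\<^sub>R x + q *\<^sub>R y) has_derivative (\<lambda>h. h *\<^sub>R y)) (at q)"
      by (auto intro!: derivative_eq_intros)
    from has_derivative_compose[OF this D] show ?thesis
      using linear_cmul[OF has_derivative_linear[OF D]]
      by (simp add: has_field_derivative_def mult_commute_abs)
  qed
  from MVT2[OF s(1) d2] obtain q where q: "0 < q" "q < s"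
    "f' (u + r *\<^sub>R x + s *\<^sub>R y) x - f' (u + r *\<^sub>R x + 0 *\<^sub>R y) x = (s - 0) * f2 (u + r *\<^sub>R x + q *\<^sub>R y) y"
    by blast
  have "u + r *\<^sub>R x + q *\<^sub>R y \<in> ball u d" by (rule ball) (use r q in auto)
  moreover have "f (u + s *\<^sub>R x + s *\<^sub>R y) - f (u + s *\<^sub>R x) - f (u + s *\<^sub>R y) + f u
     = s\<^sup>2 * f2 (u + r *\<^sub>R x + q *\<^sub>R y) y"
    using r(3) unfolding q(3) by (simp add: power2_eq_square)
  ultimately show ?thesis by blast
qed

text \<open>The second difference is symmetric in \<open>x\<close> and \<open>y\<close>, and both
  mixed derivatives approximate its quotient by \<open>s\<^sup>2\<close>.\<close>

lemma second_derivative_commute_real: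
  fixes f :: "'a::real_normed_vector \<Rightarrow> real"
  assumes U: "open U" "u \<in> U"
    and f: "\<And>z. z \<in> U \<Longrightarrow> (f has_derivative f' z) (at z)"
    and fx: "\<And>z. z \<in> U \<Longrightarrow> ((\<lambda>z. f' z x) has_derivative fx z) (at z)"
    and fy: "\<And>z. z \<in> U \<Longrightarrow> ((\<lambda>z. f' z y) has_derivative fy z) (at z)"
    and cont: "isCont (\<lambda>z. fx z y) u" "isCont (\<lambda>z. fy z x) u"
  shows "fx u y = fy u x"
proof (rule ccontr)
  assume "fx u y \<noteq> fy u x"
  define e where "e = \<bar>fx u y - fy u x\<bar> / 2"
  have e: "e > 0" using \<open>fx u y \<noteq> fy u x\<close> unfolding e_def by simp
  obtain d0 where d0: "d0 > 0" "ball u d0 \<subseteq> U" using U open_contains_ball by blast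
  obtain d1 where d1: "d1 > 0" "\<And>z. dist z u < d1 \<Longrightarrow> dist (fx z y) (fx u y) < e"
    using cont(1) e unfolding continuous_at_eps_delta by blast
  obtain d2 where d2: "d2 > 0" "\<And>z. dist z u < d2 \<Longrightarrow> dist (fy z x) (fy u x) < e"
    using cont(2) e unfolding continuous_at_eps_delta by blast
  define d where "d = min d0 (min d1 d2)"
  have d: "d > 0" "ball u d \<subseteq> U" using d0 d1(1) d2(1) unfolding d_def by auto
  define s where "s = d / (2 * (norm x + norm y + 1))"
  have pos: "norm x + norm y + 1 > 0" by (simp add: add_nonneg_pos)
  have s: "s > 0" "s * (norm x + norm y) < d"
  proof -
    show "s > 0" unfolding s_def using d pos by simp
    have "s * (norm x + norm y) < s * (2 * (norm x + norm y + 1))"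
      by (rule mult_strict_left_mono) (use \<open>s > 0\<close> in \<open>auto simp: add_nonneg_pos\<close>)
    also have "\<dots> = d" unfolding s_def using pos by simp
    finally show "s * (norm x + norm y) < d" .
  qed
  obtain z where z: "z \<in> ball u d"
    "f (u + s *\<^sub>R x + s *\<^sub>R y) - f (u + s *\<^sub>R x) - f (u + s *\<^sub>R y) + f u = s\<^sup>2 * fx z y"
    using second_difference_mean_value[of u d f f' x fx s y] f fx d(2) s by blast
  obtain z' where z': "z' \<in> ball u d"
    "f (u + s *\<^sub>R y + s *\<^sub>R x) - f (u + s *\<^sub>R y) - f (u + s *\<^sub>R x) + f u = s\<^sup>2 * fy z' x"
    using second_difference_mean_value[of u d f f' y fy s x] f fy d(2) s
    by (metis add.commute subsetD)
  have "s\<^sup>2 * fx z y = s\<^sup>2 * fy z' x" using z(2) z'(2) by (simp add: algebra_simps)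
  then have "fx z y = fy z' x" using s(1) by simp
  moreover have "dist (fx z y) (fx u y) < e" "dist (fy z' x) (fy u x) < e"
    using z(1) z'(1) d1(2)[of z] d2(2)[of z'] unfolding d_def by (auto simp: dist_commute[of u])
  ultimately show False unfolding e_def dist_real_def by (simp add: abs_if split: if_splits)
qed

lemma second_derivative_commute:
  fixes f :: "'a::real_normed_vector \<Rightarrow> 'b::euclidean_space"
  assumes U: "open U" "u \<in> U"
    and f: "\<And>z. z \<in> U \<Longrightarrow> (f has_derivative f' z) (at z)"
    and fx: "\<And>z. z \<in> U \<Longrightarrow> ((\<lambda>z. f' z x) has_derivative fx z) (at z)"
    and fy: "\<And>z. z \<in> U \<Longrightarrow> ((\<lambda>z. f' z y) has_derivative fy z) (at z)"
    and cont: "isCont (\<lambda>z. fx z y) u" "isCont (\<lambda>z. fy z x) u"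
  shows "fx u y = fy u x"
proof (rule euclidean_eqI)
  fix b :: 'b assume "b \<in> Basis"
  show "fx u y \<bullet> b = fy u x \<bullet> b"
    by (rule second_derivative_commute_real[OF U, of "\<lambda>z. f z \<bullet> b" "\<lambda>z h. f' z h \<bullet> b"])
      (use f fx fy cont in \<open>auto intro!: has_derivative_inner_left continuous_intros\<close>)
qed

section \<open>Polynomials satisfying the Cartan--Muenzner equations\<close>

lemma frechet_derivative_eqI:
  "(f has_derivative f') (at x) \<Longrightarrow> frechet_derivative f (at x) v = f' v"
  by (simp add: frechet_derivative_at[symmetric])

lemma real_polynomial_function_frechet_derivative:
  fixes f :: "'a::euclidean_space \<Rightarrow> real"
  assumes "real_polynomial_function f"
  shows "real_polynomial_function (\<lambda>x. frechet_derivative f (at x) v)"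
  using assms
proof (induction f)
  case (linear f)
  then have "frechet_derivative f (at x) v = f v" for x
    by (intro frechet_derivative_eqI bounded_linear_imp_has_derivative)
  then show ?case by (simp add: real_polynomial_function.intros)
next
  case (const c)
  then show ?case by (simp add: frechet_derivative_const real_polynomial_function.intros)
next
  case (add f g)
  have "frechet_derivative (\<lambda>x. f x + g x) (at x) v
    = frechet_derivative f (at x) v + frechet_derivative g (at x) v" for x
    using add.hyps
    by (intro frechet_derivative_eqI has_derivative_add)
      (auto simp: frechet_derivative_works[symmetric] differentiable_at_real_polynomial_function)
  then show ?case using add.IH by (simp add: real_polynomial_function.intros)
next
  case (mult f g)
  have "frechet_derivative (\<lambda>x. f x * g x) (at x) v
    = f x * frechet_derivative g (at x) v + frechet_derivative f (at x) v * g x" for x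
    using mult.hyps
    by (intro frechet_derivative_eqI has_derivative_mult)
      (auto simp: frechet_derivative_works[symmetric] differentiable_at_real_polynomial_function)
  then show ?case using mult by (simp add: real_polynomial_function.intros)
qed

lemma polynomial_function_has_frechet_derivative:
  fixes f :: "'a::euclidean_space \<Rightarrow> 'b::euclidean_space"
  assumes "polynomial_function f"
  shows "(f has_derivative frechet_derivative f (at x)) (at x)"
  using differentiable_at_polynomial_function[OF assms] frechet_derivative_works by blast

lemma polynomial_function_frechet_derivative:
  fixes f :: "'a::euclidean_space \<Rightarrow> 'b::euclidean_space"
  assumes "polynomial_function f"
  shows "polynomial_function (\<lambda>x. frechet_derivative f (at x) v)"
  unfolding polynomial_function_iff_Basis_inner
proof
  fix b :: 'b assume b: "b \<in> Basis"
  have "frechet_derivative f (at x) v \<bullet> b = frechet_derivative (\<lambda>x. f x \<bullet> b) (at x) v" for x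
    by (rule frechet_derivative_eqI[symmetric])
      (rule has_derivative_inner_left[OF polynomial_function_has_frechet_derivative[OF assms]])
  moreover have "real_polynomial_function (\<lambda>x. f x \<bullet> b)"
    using assms b polynomial_function_iff_Basis_inner by blast
  ultimately show "real_polynomial_function (\<lambda>x. frechet_derivative f (at x) v \<bullet> b)"
    by (simp add: real_polynomial_function_frechet_derivative)
qed

lemma has_derivative_unique_apply:
  "(f has_derivative f') (at x) \<Longrightarrow> (f has_derivative f'') (at x) \<Longrightarrow> f' v = f'' v"
  using has_derivative_unique by metis

text \<open>Degree 6 with equal multiplicities: the Laplace equation becomes harmonicity, and the
  assumptions are invariant under \<open>F \<mapsto> - F\<close>.\<close>

locale muenzner_sextic =
  fixes F :: "'a::euclidean_space \<Rightarrow> real"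
  assumes F_poly: "real_polynomial_function F"
    and F_scale: "F (c *\<^sub>R x) = c ^ 6 * F x"
    and gradient_norm: "(norm (gradient F x))\<^sup>2 = 36 * norm x ^ 10"
    and F_harmonic: "laplacian F x = 0"
begin

text \<open>Gradient, Hessian as an endomorphism, and derivative of the Hessian.
  \<open>K x u v \<bullet> w\<close> is the third derivative of \<open>F\<close>, hence symmetric in
  all three vectors.\<close>

definition G where "G = gradient F"
definition H where "H x = frechet_derivative G (at x)"
definition K where "K x u v = frechet_derivative (\<lambda>x. H x v) (at x) u"

lemma F_deriv: "(F has_derivative (\<lambda>v. G x \<bullet> v)) (at x)"
proof -
  have F: "(F has_derivative frechet_derivative F (at x)) (at x)"
    using F_poly differentiable_at_real_polynomial_function frechet_derivative_works by blast
  have "frechet_derivative F (at x) v = G x \<bullet> v" for v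
  proof -
    have "frechet_derivative F (at x) v = frechet_derivative F (at x) (\<Sum>b\<in>Basis. (v \<bullet> b) *\<^sub>R b)"
      by (simp add: euclidean_representation)
    also have "\<dots> = (\<Sum>b\<in>Basis. (v \<bullet> b) * frechet_derivative F (at x) b)"
      using has_derivative_linear[OF F] by (simp add: linear_sum linear_cmul)
    also have "\<dots> = G x \<bullet> v"
      by (simp add: G_def gradient_def inner_sum_left mult.commute inner_commute[of v])
    finally show ?thesis .
  qed
  then show ?thesis using F by presburger
qed

lemma G_poly: "polynomial_function G"
  unfolding G_def gradient_def
  by (intro polynomial_function_sum polynomial_function_mult polynomial_function_const)
    (auto simp: real_polynomial_function_eq[symmetric] intro: real_polynomial_function_frechet_derivative F_poly)

lemma G_deriv: "(G has_derivative H x) (at x)"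
  unfolding H_def by (rule polynomial_function_has_frechet_derivative[OF G_poly])

lemma H_linear: "linear (H x)" by (rule has_derivative_linear[OF G_deriv])

lemma H_poly: "polynomial_function (\<lambda>x. H x v)"
  unfolding H_def by (rule polynomial_function_frechet_derivative[OF G_poly])

lemma H_deriv: "((\<lambda>x. H x v) has_derivative (\<lambda>u. K x u v)) (at x)"
  unfolding K_def by (rule polynomial_function_has_frechet_derivative[OF H_poly])

lemma K_poly: "polynomial_function (\<lambda>x. K x u v)"
  unfolding K_def by (rule polynomial_function_frechet_derivative[OF H_poly])

lemmas H_simps = linear_0[OF H_linear] linear_add[OF H_linear] linear_diff[OF H_linear]
  linear_cmul[OF H_linear] linear_neg[OF H_linear]

lemma K_linear: "linear (\<lambda>u. K x u v)" by (rule has_derivative_linear[OF H_deriv])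

lemma K_sym: "K x u v = K x v u"
  by (rule second_derivative_commute[OF open_UNIV UNIV_I, where f = G and f' = H and u = x and x = v
      and y = u and fx = "\<lambda>x w. K x w v" and fy = "\<lambda>x w. K x w u"])
    (auto intro: G_deriv H_deriv continuous_polymonial_function K_poly)

lemma H_sym: "H x u \<bullet> v = H x v \<bullet> u"
  by (rule second_derivative_commute_real[OF open_UNIV UNIV_I, where f = F and f' = "\<lambda>x v. G x \<bullet> v"
      and u = x and x = v and y = u and fx = "\<lambda>x w. H x w \<bullet> v" and fy = "\<lambda>x w. H x w \<bullet> u"])
    (auto intro!: F_deriv has_derivative_inner_left G_deriv continuous_intros
      continuous_polymonial_function H_poly)

lemma K_sym_inner: "K x u v \<bullet> w = K x u w \<bullet> v"
proof -
  have "((\<lambda>x. H x v \<bullet> w) has_derivative (\<lambda>u. K x u v \<bullet> w)) (at x)"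
    by (rule has_derivative_inner_left[OF H_deriv])
  moreover have "((\<lambda>x. H x v \<bullet> w) has_derivative (\<lambda>u. K x u w \<bullet> v)) (at x)"
    unfolding H_sym[of _ v w] by (rule has_derivative_inner_left[OF H_deriv])
  ultimately show ?thesis by (rule has_derivative_unique_apply)
qed

lemma K_linear_right: "linear (K x u)"
proof -
  have "K x u = (\<lambda>v. K x v u)" by (rule ext) (rule K_sym)
  then show ?thesis using K_linear[of x u] by simp
qed

lemmas K_simps = linear_add[OF K_linear] linear_diff[OF K_linear] linear_cmul[OF K_linear] linear_0[OF K_linear]
  linear_add[OF K_linear_right] linear_diff[OF K_linear_right] linear_cmul[OF K_linear_right] linear_0[OF K_linear_right]

lemmas H_expand = linear_Basis_expansion[OF H_linear]
lemmas K_expand = linear_Basis_expansion[OF K_linear_right]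

text \<open>Product rule for a moving base point and a moving argument. Expanding the argument in
  the standard basis leaves only Hessian columns with fixed argument, whose derivatives are
  known.\<close>

lemma H_deriv_compose:
  assumes c: "(c has_derivative c') (at t)" and z: "(z has_derivative z') (at t)"
  shows "((\<lambda>s. H (c s) (z s)) has_derivative (\<lambda>h. K (c t) (c' h) (z t) + H (c t) (z' h))) (at t)"
proof -
  have "((\<lambda>s. \<Sum>b\<in>Basis. (z s \<bullet> b) *\<^sub>R H (c s) b) has_derivative
     (\<lambda>h. \<Sum>b\<in>Basis. (z t \<bullet> b) *\<^sub>R K (c t) (c' h) b + (z' h \<bullet> b) *\<^sub>R H (c t) b)) (at t)"
    by (intro has_derivative_sum has_derivative_scaleR has_derivative_inner_left z
        has_derivative_compose[OF c H_deriv])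
  then show ?thesis
    unfolding sum.distrib H_expand[of _ "z _"] H_expand[of _ "z' _"] K_expand[of _ _ "z t"] .
qed

lemma H_poly_compose:
  assumes "polynomial_function c" "polynomial_function z"
  shows "polynomial_function (\<lambda>s. H (c s) (z s))"
proof -
  have "polynomial_function (\<lambda>s. z s \<bullet> b)" for b
    by (intro polynomial_function_inner assms polynomial_function_const)
  moreover have "polynomial_function (\<lambda>s. H (c s) b)" for b
    using polynomial_function_compose[OF assms(1) H_poly] by (simp add: o_def)
  ultimately show ?thesis
    unfolding H_expand[of _ "z _"] by (intro polynomial_function_sum polynomial_function_mult) auto
qed

section \<open>Euler relations and derivatives of the gradient equation\<close>

lemma Euler_F: "G x \<bullet> x = 6 * F x"
proof -
  have "((\<lambda>c. F (c *\<^sub>R x)) has_derivative (\<lambda>h. G (1 *\<^sub>R x) \<bullet> (h *\<^sub>R x))) (at 1)"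
    by (rule has_derivative_compose[OF _ F_deriv, of "\<lambda>c. c *\<^sub>R x"]) (auto intro!: derivative_eq_intros)
  moreover have "((\<lambda>c. c ^ 6 * F x) has_derivative (\<lambda>h. 6 * h * F x)) (at 1)"
    by (auto intro!: derivative_eq_intros)
  ultimately have "G (1 *\<^sub>R x) \<bullet> (1 *\<^sub>R x) = 6 * 1 * F x"
    unfolding F_scale by (rule has_derivative_unique_apply)
  then show ?thesis by simp
qed

lemma Euler_G: "H x x = 5 *\<^sub>R G x"
proof -
  have "H x x \<bullet> v = 5 *\<^sub>R G x \<bullet> v" for v
  proof -
    have "((\<lambda>x. G x \<bullet> x) has_derivative (\<lambda>v. G x \<bullet> v + H x v \<bullet> x)) (at x)"
      by (auto intro!: derivative_eq_intros G_deriv)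
    moreover have "((\<lambda>x. G x \<bullet> x) has_derivative (\<lambda>v. 6 * (G x \<bullet> v))) (at x)"
      unfolding Euler_F by (auto intro!: derivative_eq_intros F_deriv)
    ultimately have "G x \<bullet> v + H x v \<bullet> x = 6 * (G x \<bullet> v)" by (rule has_derivative_unique_apply)
    then show ?thesis using H_sym[of x v x] by simp
  qed
  then show ?thesis by (metis vector_eq_rdot)
qed

lemma Euler_H: "K x x v = 4 *\<^sub>R H x v"
proof -
  have "((\<lambda>x. H x x) has_derivative (\<lambda>v. K x v x + H x v)) (at x)"
    by (rule H_deriv_compose) (auto intro!: derivative_eq_intros)
  moreover have "((\<lambda>x. H x x) has_derivative (\<lambda>v. 5 *\<^sub>R H x v)) (at x)"
    unfolding Euler_G by (auto intro!: derivative_eq_intros G_deriv)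
  ultimately have "K x v x + H x v = 5 *\<^sub>R H x v" by (rule has_derivative_unique_apply)
  moreover have "5 *\<^sub>R H x v = 4 *\<^sub>R H x v + H x v" using scaleR_left_distrib[of 4 1 "H x v"] by simp
  ultimately show ?thesis by (simp add: K_sym[of x x])
qed

lemma inner_self_power_deriv:
  "((\<lambda>x::'a. (x \<bullet> x) ^ Suc n) has_derivative (\<lambda>v. real (Suc n) * (2 * (x \<bullet> v)) * (x \<bullet> x) ^ n)) (at x)"
proof -
  have "((\<lambda>x::'a. x \<bullet> x) has_derivative (\<lambda>v. 2 * (x \<bullet> v))) (at x)"
    using has_derivative_inner[OF has_derivative_ident has_derivative_ident, of x UNIV]
    by (simp add: inner_commute)
  from has_derivative_power[OF this, of "Suc n"] show ?thesis by (simp add: mult.assoc)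
qed

lemma G_norm: "G x \<bullet> G x = 36 * (x \<bullet> x) ^ 5"
proof -
  have "norm x ^ 10 = (x \<bullet> x) ^ 5" by (simp add: power2_norm_eq_inner[symmetric] flip: power_mult)
  then show ?thesis using gradient_norm[of x] by (simp add: G_def power2_norm_eq_inner)
qed

lemma H_G: "H x (G x) = (180 * (x \<bullet> x) ^ 4) *\<^sub>R x"
proof -
  have "H x (G x) \<bullet> v = (180 * (x \<bullet> x) ^ 4) *\<^sub>R x \<bullet> v" for v
  proof -
    have "((\<lambda>x. G x \<bullet> G x) has_derivative (\<lambda>v. 2 * (H x v \<bullet> G x))) (at x)"
      by (rule derivative_eq_intros G_deriv refl)+ (simp add: inner_commute)
    moreover have "((\<lambda>x. G x \<bullet> G x) has_derivative (\<lambda>v. 360 * (x \<bullet> x) ^ 4 * (x \<bullet> v))) (at x)"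
      unfolding G_norm
      using has_derivative_mult_right[OF inner_self_power_deriv[of 4 x], of 36] by (simp add: mult_ac)
    ultimately have "2 * (H x v \<bullet> G x) = 360 * (x \<bullet> x) ^ 4 * (x \<bullet> v)" by (rule has_derivative_unique_apply)
    then show ?thesis using H_sym[of x v "G x"] by simp
  qed
  then show ?thesis by (metis vector_eq_rdot)
qed

text \<open>Derivative of \<open>H_G\<close>. By the symmetry of \<open>K\<close>, the first term is
  the derivative of the Hessian along the gradient, hence a Riccati equation.\<close>

lemma Riccati:
  "K x v (G x) + H x (H x v) = (180 * (x \<bullet> x) ^ 4) *\<^sub>R v + (1440 * (x \<bullet> x) ^ 3 * (x \<bullet> v)) *\<^sub>R x"
proof -
  have "((\<lambda>x. H x (G x)) has_derivative (\<lambda>v. K x v (G x) + H x (H x v))) (at x)"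
    by (rule H_deriv_compose) (auto intro!: derivative_eq_intros G_deriv)
  moreover have "((\<lambda>x. H x (G x)) has_derivative
      (\<lambda>v. (180 * (x \<bullet> x) ^ 4) *\<^sub>R v + (1440 * (x \<bullet> x) ^ 3 * (x \<bullet> v)) *\<^sub>R x)) (at x)"
    unfolding H_G
    using has_derivative_scaleR[OF has_derivative_mult_right[OF inner_self_power_deriv[of 3 x], of 180]
        has_derivative_ident] by (simp add: mult_ac)
  ultimately show ?thesis by (rule has_derivative_unique_apply)
qed

lemma H_trace: "ONB UNIV B \<Longrightarrow> (\<Sum>b\<in>B. H x b \<bullet> b) = 0"
proof -
  assume B: "ONB UNIV B"
  have F': "frechet_derivative F (at y) = (\<lambda>v. G y \<bullet> v)" for y
    using frechet_derivative_at[OF F_deriv] by simp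
  have "frechet_derivative (\<lambda>y. G y \<bullet> b) (at x) b = H x b \<bullet> b" for b
    by (rule frechet_derivative_eqI) (rule has_derivative_inner_left[OF G_deriv])
  then have "(\<Sum>b\<in>Basis. H x b \<bullet> b) = 0"
    using F_harmonic[of x] unfolding laplacian_def F' by simp
  then show ?thesis using trace_ONB[OF H_linear B] by simp
qed

lemma K_trace: "ONB UNIV B \<Longrightarrow> (\<Sum>b\<in>B. K x u b \<bullet> b) = 0"
proof -
  assume B: "ONB UNIV B"
  have "((\<lambda>x. \<Sum>b\<in>B. H x b \<bullet> b) has_derivative (\<lambda>u. \<Sum>b\<in>B. K x u b \<bullet> b)) (at x)"
    by (intro has_derivative_sum has_derivative_inner_left H_deriv)
  then have "((\<lambda>x. 0) has_derivative (\<lambda>u. \<Sum>b\<in>B. K x u b \<bullet> b)) (at x)"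
    using H_trace[OF B] by simp
  from has_derivative_unique_apply[OF this has_derivative_const] show ?thesis by simp
qed

end

section \<open>Normal geodesics of the focal set\<close>

lemma inner_eqI: "(\<And>c. u \<bullet> c = v \<bullet> c) \<Longrightarrow> u = (v::'a::real_inner)"
  by (metis vector_eq_rdot)

section \<open>Order of vanishing of polynomial curves\<close>

lemma polynomial_function_real_sum:
  fixes E :: "real \<Rightarrow> 'a::euclidean_space"
  assumes "polynomial_function E"
  obtains a n where "\<And>s. E s = (\<Sum>i\<le>n. s ^ i *\<^sub>R a i)" "\<And>i. i > n \<Longrightarrow> a i = 0"
proof -
  have "\<forall>b\<in>Basis. \<exists>a n. (\<lambda>s. E s \<bullet> b) = (\<lambda>s. \<Sum>i\<le>n. a i * s ^ i)"
    using assms by (auto simp: polynomial_function_iff_Basis_inner intro!: real_polynomial_function_imp_sum)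
  then obtain \<alpha> m where am: "\<And>b. b \<in> Basis \<Longrightarrow> (\<lambda>s. E s \<bullet> b) = (\<lambda>s. \<Sum>i\<le>m b. \<alpha> b i * s ^ i)"
    by metis
  define n where "n = Max (m ` (Basis :: 'a set))"
  define a where "a i = (\<Sum>b\<in>Basis. (if i \<le> m b then \<alpha> b i else 0) *\<^sub>R b)" for i
  have mn: "m b \<le> n" if "b \<in> Basis" for b :: 'a
    unfolding n_def using that by simp
  have "E s = (\<Sum>i\<le>n. s ^ i *\<^sub>R a i)" for s
  proof (rule euclidean_eqI)
    fix b :: 'a assume b: "b \<in> Basis"
    have "a i \<bullet> b = (if i \<le> m b then \<alpha> b i else 0)" for i
      unfolding a_def by (rule inner_sum_left_Basis[OF b])
    then have "(\<Sum>i\<le>n. s ^ i *\<^sub>R a i) \<bullet> b = (\<Sum>i\<le>n. s ^ i * (if i \<le> m b then \<alpha> b i else 0))"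
      by (simp only: inner_sum_left inner_scaleR_left)
    also have "\<dots> = (\<Sum>i\<le>m b. s ^ i * \<alpha> b i)"
      by (rule sum.mono_neutral_cong_right) (use mn[OF b] in auto)
    also have "\<dots> = E s \<bullet> b" using fun_cong[OF am[OF b], of s] by (simp add: mult.commute)
    finally show "E s \<bullet> b = (\<Sum>i\<le>n. s ^ i *\<^sub>R a i) \<bullet> b" ..
  qed
  moreover have "a i = 0" if "i > n" for i
    unfolding a_def using mn that by (intro sum.neutral) fastforce
  ultimately show ?thesis using that by blast
qed

lemma polynomial_function_real_leading_term:
  fixes E :: "real \<Rightarrow> 'a::euclidean_space"
  assumes "polynomial_function E" "E s0 \<noteq> 0"
  obtains k R where "polynomial_function R" "\<And>s. E s = s ^ k *\<^sub>R R s" "R 0 \<noteq> 0"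
proof -
  obtain a n where E: "\<And>s. E s = (\<Sum>i\<le>n. s ^ i *\<^sub>R a i)" and a0: "\<And>i. i > n \<Longrightarrow> a i = 0"
    using polynomial_function_real_sum[OF assms(1)] by metis
  have "\<exists>i. a i \<noteq> 0"
  proof (rule ccontr)
    assume "\<nexists>i. a i \<noteq> 0"
    then have "E s0 = 0" unfolding E by simp
    then show False using assms(2) by simp
  qed
  define k where "k = (LEAST i. a i \<noteq> 0)"
  have k: "a k \<noteq> 0" unfolding k_def using \<open>\<exists>i. a i \<noteq> 0\<close> by (rule LeastI_ex)
  have less: "a i = 0" if "i < k" for i using not_less_Least that unfolding k_def by blast
  \<comment> \<open>As \<open>a\<close> vanishes beyond \<open>n\<close>, the shifted sum may keep
    the upper limit \<open>n\<close>.\<close>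
  define R where "R s = (\<Sum>i\<le>n. s ^ i *\<^sub>R a (i + k))" for s :: real
  have "E s = s ^ k *\<^sub>R R s" for s
  proof -
    have "s ^ k *\<^sub>R R s = (\<Sum>i\<in>{..n}. s ^ (i + k) *\<^sub>R a (i + k))"
      unfolding R_def by (simp add: scaleR_sum_right power_add mult.commute)
    also have "\<dots> = (\<Sum>j\<in>(\<lambda>i. i + k) ` {..n}. s ^ j *\<^sub>R a j)"
      by (subst sum.reindex) auto
    also have "\<dots> = (\<Sum>j\<in>{..n + k}. s ^ j *\<^sub>R a j)"
    proof (rule sum.mono_neutral_left)
      show "\<forall>i\<in>{..n + k} - (\<lambda>i. i + k) ` {..n}. s ^ i *\<^sub>R a i = 0"
      proof
        fix i assume i: "i \<in> {..n + k} - (\<lambda>i. i + k) ` {..n}"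
        have "i < k"
        proof (rule ccontr)
          assume "\<not> i < k"
          then have "i = (i - k) + k" "i - k \<le> n" using i by auto
          then show False using i by blast
        qed
        then show "s ^ i *\<^sub>R a i = 0" using less by simp
      qed
    qed auto
    also have "\<dots> = E s"
      unfolding E by (rule sum.mono_neutral_right) (use a0 in auto)
    finally show ?thesis ..
  qed
  moreover have "real_polynomial_function (\<lambda>s::real. s ^ i)" for i
    by (rule real_polynomial_function_power) (simp add: real_polynomial_function.intros bounded_linear_ident)
  then have "polynomial_function R"
    unfolding R_def
    by (intro polynomial_function_sum polynomial_function_mult polynomial_function_const)
      (auto simp: real_polynomial_function_eq[symmetric])
  moreover have "R 0 = a k"
  proof -
    have "R 0 = (\<Sum>i\<le>n. if i = 0 then a k else 0)"
      unfolding R_def by (rule sum.cong) auto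
    then show ?thesis by simp
  qed
  ultimately show ?thesis using k that by metis
qed

lemma isCont_zero_off_zero:
  fixes f :: "real \<Rightarrow> 'a::real_normed_vector"
  assumes "isCont f 0" "\<And>s. s \<noteq> 0 \<Longrightarrow> f s = 0"
  shows "f 0 = 0"
proof -
  have "(f \<longlongrightarrow> 0) (at 0)"
    by (rule tendsto_eventually) (use assms(2) in \<open>auto simp: eventually_at intro: exI[of _ 1]\<close>)
  moreover have "(f \<longlongrightarrow> f 0) (at 0)" using assms(1) by (simp add: isCont_def)
  ultimately show ?thesis using LIM_unique by blast
qed

text \<open>Real and imaginary part of \<open>(1 + \<i> s)\<^sup>5\<close>. In the model \<open>Re z\<^sup>6\<close> the gradient at \<open>z = 1 + \<i> s\<close> is
  \<open>6 * re5 s * z + radial s * \<i>\<close>.\<close>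

definition re5 :: "real \<Rightarrow> real" where "re5 s = 1 - 10 * s^2 + 5 * s^4"
definition im5 :: "real \<Rightarrow> real" where "im5 s = 5 * s - 10 * s^3 + s^5"
definition radial :: "real \<Rightarrow> real" where "radial s = - 6 * (s * re5 s + im5 s)"

lemma re5_deriv: "(re5 has_real_derivative - 20 * s + 20 * s^3) (at s)"
  unfolding re5_def by (auto intro!: derivative_eq_intros)

lemma im5_deriv: "(im5 has_real_derivative 5 - 30 * s^2 + 5 * s^4) (at s)"
  unfolding im5_def by (auto intro!: derivative_eq_intros)

lemma real_polynomial_5: "real_polynomial_function re5" "real_polynomial_function im5"
  unfolding re5_def im5_def
  by (intro real_polynomial_function.intros real_polynomial_function_diff real_polynomial_function_power
      bounded_linear_ident)+

lemma polynomial_5: "polynomial_function re5" "polynomial_function im5"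
  using real_polynomial_5 real_polynomial_function_eq by blast+

text \<open>Components along \<open>1\<close> and \<open>\<i>\<close> of the relation
  \<open>H_G\<close> for the model \<open>Re z^6\<close>: with gradient
  \<open>6 * re5 s * z + radial s * \<i>\<close>, the left side is
  \<open>180 * \<bar>z\<bar>^8 * z\<close>.\<close>

lemma sextic_identities:
  "180 * (1 + s\<^sup>2)^4 = 180 * (re5 s)\<^sup>2 + 6 * radial s * (- 20 * s + 20 * s^3)"
  "180 * (1 + s\<^sup>2)^4 * s = - 180 * re5 s * im5 s - 6 * radial s * (5 - 30 * s^2 + 5 * s^4)"
  unfolding radial_def re5_def im5_def by (simp_all add: algebra_simps eval_nat_numeral)

locale muenzner_focal = muenzner_sextic F for F :: "'a::euclidean_space \<Rightarrow> real" +
  fixes p :: 'a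
  assumes p_unit: "p \<bullet> p = 1" and F_p: "F p = 1"
begin

text \<open>Eigenspaces of the Hessian stand in for the tangent and the normal space until charts
  exist; \<open>range_J\<close> later identifies \<open>T\<close> with the image of the derivative
  of a chart.\<close>

definition T where "T = {v. H p v = 6 *\<^sub>R v}"
definition N where "N = {v. H p v = - (30 *\<^sub>R v)}"

text \<open>Equality case of Cauchy-Schwarz: \<open>G p \<bullet> p = 6\<close> and
  \<open>G p \<bullet> G p = 36\<close>.\<close>

lemma G_p: "G p = 6 *\<^sub>R p"
proof -
  have "(G p - 6 *\<^sub>R p) \<bullet> (G p - 6 *\<^sub>R p) = 0"
    using G_norm[of p] Euler_F[of p] p_unit F_p by (simp add: inner_diff_left inner_diff_right inner_commute)
  then show ?thesis by simp
qed

lemma H_p: "H p p = 30 *\<^sub>R p" using Euler_G[of p] by (simp add: G_p)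

text \<open>The Riccati equation at \<open>p\<close>, where the gradient is \<open>6 p\<close>. On
  the complement of \<open>p\<close> it factors as \<open>(H p - 6) (H p + 30) = 0\<close>.\<close>

lemma H_H: "H p (H p v) = 180 *\<^sub>R v + (1440 * (p \<bullet> v)) *\<^sub>R p - 24 *\<^sub>R H p v"
  using Riccati[of p v] by (simp add: p_unit G_p K_simps K_sym[of p v p] Euler_H algebra_simps)

lemma subspace_T: "subspace T" and subspace_N: "subspace N"
  unfolding T_def N_def subspace_def by (auto simp: H_simps algebra_simps)

lemma H_T: "v \<in> T \<Longrightarrow> H p v = 6 *\<^sub>R v" unfolding T_def by simp
lemma H_N: "v \<in> N \<Longrightarrow> H p v = - (30 *\<^sub>R v)" unfolding N_def by simp

lemma T_p: "v \<in> T \<Longrightarrow> v \<bullet> p = 0"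
  using H_sym[of p v p] by (simp add: H_T H_p inner_commute)

lemma N_p: "v \<in> N \<Longrightarrow> v \<bullet> p = 0"
  using H_sym[of p v p] by (simp add: H_N H_p inner_commute)

lemma T_N: "v \<in> T \<Longrightarrow> w \<in> N \<Longrightarrow> v \<bullet> w = 0"
  using H_sym[of p v w] by (simp add: H_N H_T inner_commute)

text \<open>Spectral projections \<open>(H p + 30) / 36\<close> and \<open>(6 - H p) / 36\<close>
  after removing the component along \<open>p\<close>; 36 is the gap between the eigenvalues 6 and
  -30.\<close>

definition tan_part where "tan_part v = (1/36) *\<^sub>R (H p (v - (v \<bullet> p) *\<^sub>R p) + 30 *\<^sub>R (v - (v \<bullet> p) *\<^sub>R p))"
definition nor_part where "nor_part v = (1/36) *\<^sub>R (6 *\<^sub>R (v - (v \<bullet> p) *\<^sub>R p) - H p (v - (v \<bullet> p) *\<^sub>R p))"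

lemma split: "v = (v \<bullet> p) *\<^sub>R p + tan_part v + nor_part v"
  unfolding tan_part_def nor_part_def
  by (rule inner_eqI) (simp add: inner_add_left inner_diff_left field_simps)

lemma
  shows tan_part_T: "tan_part v \<in> T" and nor_part_N: "nor_part v \<in> N"
proof -
  define z where "z = v - (v \<bullet> p) *\<^sub>R p"
  have "p \<bullet> z = 0" unfolding z_def by (simp add: inner_diff_right p_unit inner_commute)
  then have *: "H p (H p z) = 180 *\<^sub>R z - 24 *\<^sub>R H p z" using H_H[of z] by simp
  have "H p (H p z + 30 *\<^sub>R z) = 6 *\<^sub>R (H p z + 30 *\<^sub>R z)"
    by (rule inner_eqI) (simp add: H_simps * inner_add_left inner_diff_left)
  then show "tan_part v \<in> T"
    unfolding tan_part_def z_def[symmetric] T_def by (simp add: H_simps)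
  have "H p (6 *\<^sub>R z - H p z) = - (30 *\<^sub>R (6 *\<^sub>R z - H p z))"
    by (rule inner_eqI) (simp add: H_simps * inner_add_left inner_diff_left)
  then show "nor_part v \<in> N"
    unfolding nor_part_def z_def[symmetric] N_def by (simp add: H_simps)
qed

text \<open>This bound on the spectrum excludes solutions of the singular equation that vanish to
  order two or more.\<close>

lemma H_p_le: "H p v \<bullet> v \<le> 30 * (v \<bullet> v)"
proof -
  define c y n where "c = v \<bullet> p" and "y = tan_part v" and "n = nor_part v"
  have v: "v = c *\<^sub>R p + y + n" unfolding c_def y_def n_def by (rule split)
  have y: "y \<in> T" and n: "n \<in> N" unfolding y_def n_def by (rule tan_part_T nor_part_N)+
  note orth = p_unit T_p[OF y] N_p[OF n] T_N[OF y n] T_p[OF y, unfolded inner_commute[of y p]]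
    N_p[OF n, unfolded inner_commute[of n p]] T_N[OF y n, unfolded inner_commute[of y n]]
  have "H p v = (30 * c) *\<^sub>R p + 6 *\<^sub>R y - 30 *\<^sub>R n"
    unfolding v by (simp add: H_simps H_p H_T[OF y] H_N[OF n])
  then have "H p v \<bullet> v = 30 * c\<^sup>2 + 6 * (y \<bullet> y) - 30 * (n \<bullet> n)"
    unfolding v by (simp add: inner_add_left inner_diff_left inner_add_right orth power2_eq_square)
  moreover have "v \<bullet> v = c\<^sup>2 + y \<bullet> y + n \<bullet> n"
    unfolding v by (simp add: inner_add_left inner_add_right orth power2_eq_square)
  moreover have "y \<bullet> y \<ge> 0" "n \<bullet> n \<ge> 0" by auto
  ultimately show ?thesis by simp
qed

lemma polynomial_line: "polynomial_function (\<lambda>s::real. p + s *\<^sub>R w)"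
  by (intro polynomial_function_add polynomial_function_const polynomial_function_mult polynomial_function_id)

text \<open>The equation is singular at \<open>0\<close>: comparing the lowest order terms \<open>s ^ k *\<^sub>R R 0\<close> shows that
  \<open>36 * k - 30\<close> is an eigenvalue of the Hessian at \<open>p\<close>, whence \<open>k \<le> 5/3\<close>.\<close>

lemma singular_ode_unique:
  fixes E :: "real \<Rightarrow> 'a"
  assumes E: "polynomial_function E" "\<And>s. (E has_vector_derivative E' s) (at s)"
    and eq: "\<And>s. radial s *\<^sub>R E' s = - (H (p + s *\<^sub>R w) (E s)) - (30 * re5 s) *\<^sub>R E s"
    and init: "E 0 = 0" "E' 0 = 0"
  shows "E s = 0"
proof (rule ccontr)
  assume "E s \<noteq> 0"
  then obtain k R where R: "polynomial_function R" "\<And>s. E s = s ^ k *\<^sub>R R s" "R 0 \<noteq> 0"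
    using polynomial_function_real_leading_term[OF E(1)] by metis
  obtain R' where R': "polynomial_function R'" "\<And>s. (R has_vector_derivative R' s) (at s)"
    using has_vector_derivative_polynomial_function[OF R(1)] by metis
  have E': "E' s = (real k * s ^ (k - 1)) *\<^sub>R R s + s ^ k *\<^sub>R R' s" for s
  proof -
    have "((\<lambda>s. s ^ k *\<^sub>R R s) has_vector_derivative (s ^ k *\<^sub>R R' s + (real k * s ^ (k - 1)) *\<^sub>R R s)) (at s)"
      by (rule has_vector_derivative_scaleR) (auto intro!: derivative_eq_intros R')
    moreover have "E = (\<lambda>s. s ^ k *\<^sub>R R s)" using R(2) by (rule ext)
    ultimately show ?thesis using vector_derivative_unique_at[OF E(2)[of s]] by (simp add: add.commute)
  qed
  have "k \<noteq> 0" using init(1) R(2)[of 0] R(3) by (cases k) auto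
  moreover have "k \<noteq> 1" using init(2) E'[of 0] R(3) by auto
  ultimately have k: "k \<ge> 2" by simp
  \<comment> \<open>\<open>radial\<close> has a simple zero at \<open>0\<close>; the quotient
    \<open>\<gamma>\<close> has the value -36 there.\<close>
  define \<gamma> where "\<gamma> s = - 36 + 120 * s^2 - 36 * s^4" for s :: real
  have \<gamma>: "radial s = s * \<gamma> s" for s
    unfolding radial_def re5_def im5_def \<gamma>_def by (simp add: algebra_simps eval_nat_numeral)
  \<comment> \<open>The equation divided by \<open>s ^ k\<close>: it vanishes for
    \<open>s \<noteq> 0\<close>, hence by continuity at \<open>0\<close>, where it reads
    \<open>- 36 k R 0 + H p (R 0) + 30 R 0 = 0\<close>.\<close>
  define \<Phi> where "\<Phi> s = \<gamma> s *\<^sub>R (real k *\<^sub>R R s + s *\<^sub>R R' s) + H (p + s *\<^sub>R w) (R s) + (30 * re5 s) *\<^sub>R R s" for s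
  have "s ^ k *\<^sub>R \<Phi> s = 0" for s
  proof -
    have "s * s ^ (k - 1) = s ^ k" using k by (simp add: power_eq_if)
    then have "s *\<^sub>R E' s = s ^ k *\<^sub>R (real k *\<^sub>R R s + s *\<^sub>R R' s)"
      unfolding E' by (simp add: scaleR_add_right mult.left_commute mult_ac)
    then have "radial s *\<^sub>R E' s = \<gamma> s *\<^sub>R s ^ k *\<^sub>R (real k *\<^sub>R R s + s *\<^sub>R R' s)"
      unfolding \<gamma> by (metis mult.commute scaleR_scaleR)
    then have "s ^ k *\<^sub>R \<Phi> s = radial s *\<^sub>R E' s + H (p + s *\<^sub>R w) (E s) + (30 * re5 s) *\<^sub>R E s"
      unfolding \<Phi>_def R(2) H_simps by (simp add: scaleR_add_right mult_ac)
    then show ?thesis by (simp add: eq)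
  qed
  then have "\<Phi> s = 0" if "s \<noteq> 0" for s using that by (metis power_not_zero scaleR_eq_0_iff)
  moreover have "polynomial_function \<Phi>"
  proof -
    have "polynomial_function \<gamma>"
      unfolding \<gamma>_def
      by (simp add: real_polynomial_function_eq[symmetric] real_polynomial_function.intros
        real_polynomial_function_diff real_polynomial_function_power)
    moreover have "polynomial_function (\<lambda>s. 30 * re5 s)"
      using polynomial_function_mult[OF polynomial_function_const polynomial_5(1), of 30] by simp
    ultimately show ?thesis
      unfolding \<Phi>_def
      by (intro polynomial_function_add polynomial_function_mult polynomial_function_const
        H_poly_compose polynomial_line R(1) R' polynomial_function_id polynomial_5)
  qed
  then have "isCont \<Phi> 0" by (rule continuous_polymonial_function)
  ultimately have "\<Phi> 0 = 0" by (rule isCont_zero_off_zero[rotated])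
  then have "H p (R 0) = (36 * real k - 30) *\<^sub>R R 0"
    unfolding \<Phi>_def \<gamma>_def re5_def by (simp add: algebra_simps)
  then have "(36 * real k - 30) * (R 0 \<bullet> R 0) \<le> 30 * (R 0 \<bullet> R 0)" using H_p_le[of "R 0"] by simp
  moreover have "R 0 \<bullet> R 0 > 0" using R(3) by simp
  ultimately have "36 * real k - 30 \<le> 30" by simp
  then show False using k by simp
qed

text \<open>The right side is six times the conjugate of \<open>(1 + \<i> s)^5\<close>, the gradient
  of \<open>Re z^6\<close> in the plane of \<open>p\<close> and \<open>w\<close>. The difference of
  the two sides solves the singular linear equation.\<close>

lemma G_normal:
  assumes w: "w \<in> N" "w \<bullet> w = 1"
  shows "G (p + s *\<^sub>R w) = 6 *\<^sub>R (re5 s *\<^sub>R p - im5 s *\<^sub>R w)"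
proof -
  define Z where "Z s = G (p + s *\<^sub>R w) - 6 *\<^sub>R (re5 s *\<^sub>R p - im5 s *\<^sub>R w)" for s
  define Z' where "Z' s = H (p + s *\<^sub>R w) w - 6 *\<^sub>R ((- 20 * s + 20 * s^3) *\<^sub>R p - (5 - 30 * s^2 + 5 * s^4) *\<^sub>R w)" for s
  have pw: "p \<bullet> w = 0" "w \<bullet> p = 0" using N_p[OF w(1)] by (simp_all add: inner_commute)
  have "Z s = 0"
  proof (rule singular_ode_unique[where E = Z and E' = Z' and w = w])
    show "polynomial_function Z"
    proof -
      have "polynomial_function (\<lambda>s. G (p + s *\<^sub>R w))"
        using polynomial_function_compose[OF polynomial_line G_poly] by (simp add: o_def)
      then show ?thesis unfolding Z_def
        by (intro polynomial_function_diff polynomial_function_mult polynomial_function_const polynomial_5)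
    qed
    show "(Z has_vector_derivative Z' s) (at s)" for s
    proof -
      have "((\<lambda>s. G (p + s *\<^sub>R w)) has_derivative (\<lambda>h. H (p + s *\<^sub>R w) (h *\<^sub>R w))) (at s)"
        by (rule has_derivative_compose[OF _ G_deriv]) (auto intro!: derivative_eq_intros)
      then have "((\<lambda>s. G (p + s *\<^sub>R w)) has_vector_derivative H (p + s *\<^sub>R w) w) (at s)"
        by (simp add: has_vector_derivative_def H_simps)
      then show ?thesis unfolding Z_def Z'_def
        by (auto intro!: derivative_eq_intros re5_deriv im5_deriv)
    qed
    show "Z 0 = 0" unfolding Z_def by (simp add: G_p re5_def im5_def)
    show "Z' 0 = 0" unfolding Z'_def by (simp add: H_N[OF w(1)])
    show "radial s *\<^sub>R Z' s = - H (p + s *\<^sub>R w) (Z s) - (30 * re5 s) *\<^sub>R Z s" for s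
    proof (rule inner_eqI)
      fix c
      define x where "x = p + s *\<^sub>R w"
      have xx: "x \<bullet> x = 1 + s\<^sup>2"
        unfolding x_def by (simp add: inner_add_left inner_add_right p_unit w(2) pw power2_eq_square)
      have T: "6 *\<^sub>R (re5 s *\<^sub>R p - im5 s *\<^sub>R w) = (6 * re5 s) *\<^sub>R x + radial s *\<^sub>R w"
        unfolding x_def radial_def by (rule inner_eqI) (simp add: inner_add_left inner_diff_left algebra_simps)
      \<comment> \<open>The decomposition \<open>G x = Z s + 6 re5 x + radial w\<close> is inserted
        into \<open>H_G\<close>, and \<open>H x x = 5 G x\<close> is used. The term
        \<open>radial H x w\<close> is the one that occurs in \<open>radial Z'\<close>.\<close>
      have HZ: "H x (Z s) \<bullet> c = 180 * (1 + s\<^sup>2)^4 * (x \<bullet> c) - 30 * re5 s * (G x \<bullet> c) - radial s * (H x w \<bullet> c)"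
        unfolding Z_def T x_def[symmetric]
        by (simp add: H_simps H_G xx Euler_G inner_add_left inner_diff_left)
      have Zc: "Z s \<bullet> c = G x \<bullet> c - 6 * (re5 s * (p \<bullet> c) - im5 s * (w \<bullet> c))"
        unfolding Z_def x_def by (simp add: inner_diff_left)
      have xc: "x \<bullet> c = p \<bullet> c + s * (w \<bullet> c)" unfolding x_def by (simp add: inner_add_left)
      have "(180 * (1 + s\<^sup>2)^4) * (x \<bullet> c)
        = (180 * (1 + s\<^sup>2)^4) * (p \<bullet> c) + (180 * (1 + s\<^sup>2)^4 * s) * (w \<bullet> c)"
        unfolding xc by (simp add: algebra_simps)
      also have "\<dots> = (180 * (re5 s)\<^sup>2 + 6 * radial s * (- 20 * s + 20 * s^3)) * (p \<bullet> c)
         + (- 180 * re5 s * im5 s - 6 * radial s * (5 - 30 * s^2 + 5 * s^4)) * (w \<bullet> c)"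
        using sextic_identities[of s] by presburger
      finally show "radial s *\<^sub>R Z' s \<bullet> c = (- H (p + s *\<^sub>R w) (Z s) - (30 * re5 s) *\<^sub>R Z s) \<bullet> c"
        unfolding x_def[symmetric] Z'_def
        by (simp add: inner_diff_left HZ Zc) (simp add: algebra_simps power2_eq_square)
    qed
  qed
  then show ?thesis unfolding Z_def by simp
qed

end

section \<open>Shape operators of the focal set\<close>

context muenzner_focal
begin

text \<open>Shape operator in direction \<open>w\<close>. Differentiating \<open>H = 6\<close> on
  tangent vectors and pairing with a normal, where \<open>H = -30\<close>, produces the factor 36;
  see \<open>B_N\<close>.\<close>

definition S where "S w y = (1/36) *\<^sub>R K p w y"

lemma S_linear: "linear (S w)"
  unfolding S_def using K_linear_right[of p w] linear_compose_scale_right by blast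

lemma S_scale: "S (c *\<^sub>R w) y = c *\<^sub>R S w y" and S_add: "S (w + w') y = S w y + S w' y"
  by (simp_all add: S_def K_simps scaleR_add_right)

lemma S_sym: "S w u \<bullet> v = S w v \<bullet> u"
  unfolding S_def using K_sym_inner[of p w u v] by simp

lemma line_deriv: "((\<lambda>s. p + s *\<^sub>R w) has_derivative (\<lambda>h. h *\<^sub>R w)) (at s)"
  by (auto intro!: derivative_eq_intros)

lemma H_line_deriv:
  assumes "(z has_vector_derivative z') (at s)"
  shows "((\<lambda>s. H (p + s *\<^sub>R w) (z s)) has_vector_derivative K (p + s *\<^sub>R w) w (z s) + H (p + s *\<^sub>R w) z') (at s)"
proof -
  have "((\<lambda>s. H (p + s *\<^sub>R w) (z s)) has_derivative
      (\<lambda>h. K (p + s *\<^sub>R w) (h *\<^sub>R w) (z s) + H (p + s *\<^sub>R w) (h *\<^sub>R z'))) (at s)"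
    by (rule H_deriv_compose[OF line_deriv]) (use assms in \<open>simp add: has_vector_derivative_def\<close>)
  then show ?thesis by (simp add: has_vector_derivative_def H_simps K_simps scaleR_add_right)
qed

lemma G_line_deriv: "((\<lambda>s. G (p + s *\<^sub>R w)) has_vector_derivative H (p + s *\<^sub>R w) w) (at s)"
  using has_derivative_compose[OF line_deriv G_deriv, of w s] by (simp add: has_vector_derivative_def H_simps)

lemma H_normal_normal:
  assumes w: "w \<in> N" "w \<bullet> w = 1"
  shows "H (p + s *\<^sub>R w) w = 6 *\<^sub>R ((- 20 * s + 20 * s^3) *\<^sub>R p - (5 - 30 * s^2 + 5 * s^4) *\<^sub>R w)"
proof -
  have "((\<lambda>s. 6 *\<^sub>R (re5 s *\<^sub>R p - im5 s *\<^sub>R w)) has_vector_derivative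
      6 *\<^sub>R ((- 20 * s + 20 * s^3) *\<^sub>R p - (5 - 30 * s^2 + 5 * s^4) *\<^sub>R w)) (at s)"
    by (auto intro!: derivative_eq_intros re5_deriv im5_deriv)
  then show ?thesis
    using vector_derivative_unique_at[OF G_line_deriv[of w s]] G_normal[OF w] by simp
qed

lemma K_normal_normal:
  assumes w: "w \<in> N" "w \<bullet> w = 1"
  shows "K p w w = - 120 *\<^sub>R p"
proof -
  have "((\<lambda>s. H (p + s *\<^sub>R w) w) has_vector_derivative K p w w) (at 0)"
    using H_line_deriv[where z = "\<lambda>_. w" and z' = 0 and s = 0 and w = w] by (simp add: H_simps)
  moreover have "((\<lambda>s. 6 *\<^sub>R ((- 20 * s + 20 * s^3) *\<^sub>R p - (5 - 30 * s^2 + 5 * s^4) *\<^sub>R w))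
     has_vector_derivative - 120 *\<^sub>R p) (at 0)"
    by (auto intro!: derivative_eq_intros)
  ultimately show ?thesis
    unfolding H_normal_normal[OF w] by (rule vector_derivative_unique_at)
qed

text \<open>On a normal line the gradient is \<open>6 re5 x + radial w\<close>, and Euler's relation
  turns the part along \<open>x\<close> into a multiple of the Hessian. So the Riccati equation
  becomes an equation in \<open>s\<close> alone.\<close>

lemma Riccati_normal:
  assumes w: "w \<in> N" "w \<bullet> w = 1" and \<eta>: "\<eta> \<in> T"
  shows "(24 * re5 s) *\<^sub>R H (p + s *\<^sub>R w) \<eta> + radial s *\<^sub>R K (p + s *\<^sub>R w) w \<eta>
    + H (p + s *\<^sub>R w) (H (p + s *\<^sub>R w) \<eta>) = (180 * (1 + s\<^sup>2)^4) *\<^sub>R \<eta>"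
proof -
  define x where "x = p + s *\<^sub>R w"
  have pw: "p \<bullet> w = 0" "w \<bullet> p = 0" using N_p[OF w(1)] by (simp_all add: inner_commute)
  have xx: "x \<bullet> x = 1 + s\<^sup>2"
    unfolding x_def by (simp add: inner_add_left inner_add_right p_unit w(2) pw power2_eq_square)
  have x\<eta>: "x \<bullet> \<eta> = 0"
    using T_p[OF \<eta>] T_N[OF \<eta> w(1)] unfolding x_def
    by (simp add: inner_add_left inner_commute[of p \<eta>] inner_commute[of w \<eta>])
  have G: "G x = (6 * re5 s) *\<^sub>R x + radial s *\<^sub>R w"
    unfolding x_def G_normal[OF w] radial_def
    by (rule inner_eqI) (simp add: inner_add_left inner_diff_left algebra_simps)
  have "K x \<eta> (G x) = (24 * re5 s) *\<^sub>R H x \<eta> + radial s *\<^sub>R K x w \<eta>"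
    unfolding G by (simp add: K_simps K_sym[of x \<eta>] Euler_H)
  then show ?thesis using Riccati[of x \<eta>] by (simp add: x\<eta> xx x_def[symmetric])
qed

text \<open>With \<open>k = K p w y\<close>, the derivative of \<open>Riccati_normal\<close> at
  \<open>s = 0\<close> is \<open>24 k - 36 k + 6 k + H p k = 0\<close>, using
  \<open>radial 0 = 0\<close> and the slope -36 of \<open>radial\<close>. So \<open>k\<close> lies
  in the eigenspace \<open>T\<close>.\<close>

lemma S_T_unit:
  assumes w: "w \<in> N" "w \<bullet> w = 1" and y: "y \<in> T"
  shows "S w y \<in> T"
proof -
  define k where "k = K p w y"
  have h1: "((\<lambda>s. H (p + s *\<^sub>R w) y) has_vector_derivative k) (at 0)"
    using H_line_deriv[where z = "\<lambda>_. y" and z' = 0 and s = 0 and w = w] by (simp add: H_simps k_def)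
  have "polynomial_function (\<lambda>s. K (p + s *\<^sub>R w) w y)"
    using polynomial_function_compose[OF polynomial_line K_poly] by (simp add: o_def)
  then obtain k' where h2: "\<And>s. ((\<lambda>s. K (p + s *\<^sub>R w) w y) has_vector_derivative k' s) (at s)"
    using has_vector_derivative_polynomial_function by metis
  have h3: "((\<lambda>s. H (p + s *\<^sub>R w) (H (p + s *\<^sub>R w) y)) has_vector_derivative K p w (H p y) + H p k) (at 0)"
    using H_line_deriv[OF h1, of w] by simp
  have r: "((\<lambda>s. 24 * re5 s) has_real_derivative 0) (at 0)"
    by (auto intro!: derivative_eq_intros re5_deriv)
  have rad: "(radial has_real_derivative - 36) (at 0)"
    unfolding radial_def by (auto intro!: derivative_eq_intros re5_deriv im5_deriv simp: re5_def)
  have "((\<lambda>s. (24 * re5 s) *\<^sub>R H (p + s *\<^sub>R w) y + radial s *\<^sub>R K (p + s *\<^sub>R w) w y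
      + H (p + s *\<^sub>R w) (H (p + s *\<^sub>R w) y)) has_vector_derivative
      ((24 * re5 0) *\<^sub>R k + 0 *\<^sub>R H (p + 0 *\<^sub>R w) y) + (radial 0 *\<^sub>R k' 0 + (- 36) *\<^sub>R K (p + 0 *\<^sub>R w) w y)
      + (K p w (H p y) + H p k)) (at 0)"
    by (intro has_vector_derivative_add has_vector_derivative_scaleR r rad h1 h2 h3)
  moreover have "((\<lambda>s. (180 * (1 + s\<^sup>2)^4) *\<^sub>R y) has_vector_derivative 0) (at 0)"
    by (auto intro!: derivative_eq_intros)
  ultimately have "((24 * re5 0) *\<^sub>R k + 0 *\<^sub>R H (p + 0 *\<^sub>R w) y) + (radial 0 *\<^sub>R k' 0 + (- 36) *\<^sub>R K (p + 0 *\<^sub>R w) w y)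
      + (K p w (H p y) + H p k) = 0"
    unfolding Riccati_normal[OF w y] by (rule vector_derivative_unique_at)
  then have "24 *\<^sub>R k - 36 *\<^sub>R k + 6 *\<^sub>R k + H p k = 0"
    by (simp add: re5_def radial_def im5_def H_T[OF y] K_simps k_def[symmetric] add.assoc)
  moreover have "24 *\<^sub>R k - 36 *\<^sub>R k + 6 *\<^sub>R k = - 6 *\<^sub>R k"
    by (rule inner_eqI) (simp add: inner_add_left inner_diff_left)
  ultimately have "H p k = 6 *\<^sub>R k" by simp
  then have "k \<in> T" unfolding T_def by simp
  then show ?thesis unfolding S_def k_def[symmetric] by (rule subspace_scale[OF subspace_T])
qed

lemma normal_scale:
  assumes "w \<in> N"
  obtains r u where "u \<in> N" "w = 0 \<or> u \<bullet> u = 1" "w = r *\<^sub>R u" "w \<bullet> w = r\<^sup>2"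
proof (cases "w = 0")
  case True
  then show ?thesis using that[of 0 0] assms by simp
next
  case False
  show ?thesis
    by (rule that[of "w /\<^sub>R norm w" "norm w"])
      (use False assms subspace_N in \<open>auto simp: subspace_scale dot_square_norm power2_eq_square\<close>)
qed

lemma S_T: "w \<in> N \<Longrightarrow> y \<in> T \<Longrightarrow> S w y \<in> T"
proof -
  assume w: "w \<in> N" and y: "y \<in> T"
  obtain r u where u: "u \<in> N" "w = 0 \<or> u \<bullet> u = 1" "w = r *\<^sub>R u"
    using normal_scale[OF w] by metis
  show "S w y \<in> T"
  proof (cases "w = 0")
    case True then show ?thesis using subspace_T S_scale[of 0 0 y] by (simp add: subspace_0)
  next
    case False
    then have "S u y \<in> T" using S_T_unit u y by blast
    then show ?thesis unfolding u(3) S_scale by (rule subspace_scale[OF subspace_T])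
  qed
qed

text \<open>The field \<open>y - s *\<^sub>R S w y\<close> is a Jacobi field along the normal geodesic, and the formula is the variation
  of the one for the gradient along the focal set. It is obtained from the same singular equation instead,
  because the focal set is not yet known to be a manifold.\<close>

lemma H_normal_tangent:
  assumes w: "w \<in> N" "w \<bullet> w = 1" and y: "y \<in> T"
  shows "H (p + s *\<^sub>R w) (y - s *\<^sub>R S w y) = 6 *\<^sub>R (re5 s *\<^sub>R y + im5 s *\<^sub>R S w y)"
proof -
  define z where "z = S w y"
  have z: "z \<in> T" unfolding z_def by (rule S_T[OF w(1) y])
  define \<eta> where "\<eta> s = y - s *\<^sub>R z" for s :: real
  have \<eta>: "\<eta> s \<in> T" for s
    unfolding \<eta>_def using y z subspace_T by (simp add: subspace_diff subspace_scale)
  have \<eta>': "(\<eta> has_vector_derivative - z) (at s)" for s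
    unfolding \<eta>_def by (auto intro!: derivative_eq_intros)
  define E where "E s = H (p + s *\<^sub>R w) (\<eta> s) - 6 *\<^sub>R (re5 s *\<^sub>R y + im5 s *\<^sub>R z)" for s
  define E' where "E' s = (K (p + s *\<^sub>R w) w (\<eta> s) + H (p + s *\<^sub>R w) (- z))
     - 6 *\<^sub>R ((- 20 * s + 20 * s^3) *\<^sub>R y + (5 - 30 * s^2 + 5 * s^4) *\<^sub>R z)" for s
  have "E s = 0"
  proof (rule singular_ode_unique[where E = E and E' = E' and w = w])
    show "polynomial_function E"
      unfolding E_def \<eta>_def
      by (intro polynomial_function_add polynomial_function_diff polynomial_function_mult polynomial_function_const
        H_poly_compose polynomial_line polynomial_function_id polynomial_5)
    show "(E has_vector_derivative E' s) (at s)" for s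
      unfolding E_def E'_def
      by (intro has_vector_derivative_diff H_line_deriv \<eta>') (auto intro!: derivative_eq_intros re5_deriv im5_deriv)
    show "E 0 = 0" unfolding E_def \<eta>_def by (simp add: H_T[OF y] re5_def im5_def)
    \<comment> \<open>The normalisation \<open>1/36\<close> in \<open>S\<close> is what makes the
      first derivative vanish at \<open>0\<close>.\<close>
    have "K p w y = 36 *\<^sub>R z" unfolding z_def S_def by simp
    then have "E' 0 = 36 *\<^sub>R z - 6 *\<^sub>R z - 30 *\<^sub>R z"
      unfolding E'_def \<eta>_def by (simp add: H_T[OF z] H_simps)
    also have "\<dots> = 0" by (rule inner_eqI) (simp add: inner_diff_left)
    finally show "E' 0 = 0" .
    show "radial s *\<^sub>R E' s = - H (p + s *\<^sub>R w) (E s) - (30 * re5 s) *\<^sub>R E s" for s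
    proof (rule inner_eqI)
      fix c
      define x where "x = p + s *\<^sub>R w"
      have Hy: "H x (\<eta> s) \<bullet> c = H x y \<bullet> c - s * (H x z \<bullet> c)"
        unfolding \<eta>_def by (simp add: H_simps inner_diff_left)
      \<comment> \<open>The right side of \<open>Riccati_normal\<close> is split into its
        \<open>y\<close> and \<open>z\<close> parts, so that each can be rewritten by one of the two
        sextic identities.\<close>
      have Ric: "24 * re5 s * (H x (\<eta> s) \<bullet> c) + radial s * (K x w (\<eta> s) \<bullet> c) + H x (H x (\<eta> s)) \<bullet> c
        = 180 * (1 + s\<^sup>2)^4 * (y \<bullet> c) - (180 * (1 + s\<^sup>2)^4 * s) * (z \<bullet> c)"
        using arg_cong[OF Riccati_normal[OF w \<eta>[of s], of s], of "\<lambda>v. v \<bullet> c"]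
        unfolding x_def[symmetric] inner_add_left inner_scaleR_left
        by (simp add: \<eta>_def inner_diff_left algebra_simps)
      have E: "E s \<bullet> c = H x (\<eta> s) \<bullet> c - 6 * (re5 s * (y \<bullet> c) + im5 s * (z \<bullet> c))"
        unfolding E_def x_def by (simp add: inner_add_left inner_diff_left)
      have HE: "H x (E s) \<bullet> c = H x (H x (\<eta> s)) \<bullet> c - 6 * (re5 s * (H x y \<bullet> c) + im5 s * (H x z \<bullet> c))"
        unfolding E_def x_def[symmetric] by (simp add: H_simps inner_add_left inner_diff_left)
      have E': "E' s \<bullet> c = K x w (\<eta> s) \<bullet> c - H x z \<bullet> c
        - 6 * ((- 20 * s + 20 * s^3) * (y \<bullet> c) + (5 - 30 * s^2 + 5 * s^4) * (z \<bullet> c))"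
        unfolding E'_def x_def[symmetric] by (simp add: H_simps inner_add_left inner_diff_left)
      have rad: "radial s * (H x z \<bullet> c) = - 6 * (s * re5 s + im5 s) * (H x z \<bullet> c)"
        unfolding radial_def ..
      show "radial s *\<^sub>R E' s \<bullet> c = (- H (p + s *\<^sub>R w) (E s) - (30 * re5 s) *\<^sub>R E s) \<bullet> c"
        unfolding x_def[symmetric] inner_scaleR_left inner_diff_left inner_minus_left E' HE E
        using Ric[unfolded sextic_identities(2), unfolded sextic_identities(1)] rad
        unfolding Hy by algebra
    qed
  qed
  then show ?thesis unfolding E_def \<eta>_def z_def by simp
qed

text \<open>At the focal distance \<open>s = 1 / \<mu>\<close> the Jacobi field
  \<open>y - s *\<^sub>R S w y\<close> vanishes, so \<open>H_normal_tangent\<close> leaves the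
  polynomial condition \<open>re5 s + im5 s * \<mu> = 0\<close>.\<close>

lemma shape_eigenvalue:
  assumes w: "w \<in> N" "w \<bullet> w = 1" and y: "y \<in> T" "y \<noteq> 0" and \<mu>: "S w y = \<mu> *\<^sub>R y"
  shows "\<mu> = 0 \<or> \<mu>\<^sup>2 = 3 \<or> \<mu>\<^sup>2 = 1/3"
proof (cases "\<mu> = 0")
  case False
  define s where "s = 1 / \<mu>"
  have s: "\<mu> * s = 1" "s \<noteq> 0" unfolding s_def using False by auto
  have "y - s *\<^sub>R S w y = 0" unfolding \<mu> using s by (simp add: mult.commute)
  then have "6 *\<^sub>R (re5 s *\<^sub>R y + im5 s *\<^sub>R S w y) = 0"
    using H_normal_tangent[OF w y(1), of s] by (simp add: H_simps)
  then have "(re5 s + im5 s * \<mu>) *\<^sub>R y = 0" unfolding \<mu> by (simp add: scaleR_left_distrib)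
  then have "re5 s + im5 s * \<mu> = 0" using y(2) by simp
  then have "(re5 s + im5 s * \<mu>) * \<mu>^4 = 0" by simp
  moreover have "(re5 s + im5 s * \<mu>) * \<mu>^4 = 2 * (3 * \<mu>^4 - 10 * \<mu>\<^sup>2 + 3)"
    using False unfolding re5_def im5_def s_def by (simp add: field_simps eval_nat_numeral)
  moreover have "3 * \<mu>^4 - 10 * \<mu>\<^sup>2 + 3 = 3 * (\<mu>\<^sup>2 - 3) * (\<mu>\<^sup>2 - 1/3)"
    by (simp add: algebra_simps eval_nat_numeral)
  ultimately show ?thesis by auto
qed simp

lemma shape_eigenbasis:
  assumes w: "w \<in> N" "w \<bullet> w = 1"
  obtains B k where "ONB T B" "\<And>b. b \<in> B \<Longrightarrow> S w b = k b *\<^sub>R b"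
    "\<And>b. b \<in> B \<Longrightarrow> k b = 0 \<or> (k b)\<^sup>2 = 3 \<or> (k b)\<^sup>2 = 1/3"
proof -
  obtain B k where B: "ONB T B" and k: "\<And>b. b \<in> B \<Longrightarrow> S w b = k b *\<^sub>R b"
    using symmetric_orthonormal_eigenbasis[OF S_linear subspace_T S_T[OF w(1)] S_sym] by metis
  have "k b = 0 \<or> (k b)\<^sup>2 = 3 \<or> (k b)\<^sup>2 = 1/3" if "b \<in> B" for b
    by (rule shape_eigenvalue[OF w ONB_mem[OF B that] _ k[OF that]])
      (use B that in \<open>auto simp: ONB_def\<close>)
  with B k show ?thesis using that by blast
qed

lemma shape_inner_le:
  assumes w: "w \<in> N" "w \<bullet> w = 1" and v: "v \<in> T"
  shows "S w v \<bullet> S w v \<le> 3 * (v \<bullet> v)"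
proof -
  obtain B k where B: "ONB T B" and k: "\<And>b. b \<in> B \<Longrightarrow> S w b = k b *\<^sub>R b"
    "\<And>b. b \<in> B \<Longrightarrow> k b = 0 \<or> (k b)\<^sup>2 = 3 \<or> (k b)\<^sup>2 = 1/3"
    using shape_eigenbasis[OF w] by blast
  have "S w v \<bullet> S w v = (\<Sum>b\<in>B. (S w v \<bullet> b)\<^sup>2)"
    by (rule ONB_Parseval[OF B S_T[OF w(1) v]])
  also have "\<dots> \<le> (\<Sum>b\<in>B. 3 * (v \<bullet> b)\<^sup>2)"
  proof (rule sum_mono)
    fix b assume b: "b \<in> B"
    have "S w v \<bullet> b = k b * (v \<bullet> b)" using S_sym[of w v b] k(1)[OF b] by (simp add: inner_commute)
    moreover have "(k b)\<^sup>2 \<le> 3" using k(2)[OF b] by auto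
    ultimately show "(S w v \<bullet> b)\<^sup>2 \<le> 3 * (v \<bullet> b)\<^sup>2"
      by (simp add: power_mult_distrib mult_right_mono)
  qed
  also have "\<dots> = 3 * (v \<bullet> v)"
    using ONB_Parseval[OF B v] by (simp add: sum_distrib_left)
  finally show ?thesis .
qed

text \<open>For unit normals the polynomial annihilates an eigenbasis; homogeneity of degree five in
  \<open>w\<close> extends it to all normals, which pencils require.\<close>

lemma shape_quintic:
  assumes w: "w \<in> N" and v: "v \<in> T"
  shows "3 *\<^sub>R S w (S w (S w (S w (S w v)))) - (10 * (w \<bullet> w)) *\<^sub>R S w (S w (S w v)) + (3 * (w \<bullet> w)\<^sup>2) *\<^sub>R S w v = 0"
proof (cases "w = 0")
  case True
  then show ?thesis using S_scale[of 0 0] by simp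
next
  case False
  then obtain r u where u: "u \<in> N" "u \<bullet> u = 1" "w = r *\<^sub>R u" "w \<bullet> w = r\<^sup>2"
    using normal_scale[OF w] by metis
  obtain B k where B: "ONB T B" and k: "\<And>b. b \<in> B \<Longrightarrow> S u b = k b *\<^sub>R b"
    "\<And>b. b \<in> B \<Longrightarrow> k b = 0 \<or> (k b)\<^sup>2 = 3 \<or> (k b)\<^sup>2 = 1/3"
    using shape_eigenbasis[OF u(1,2)] by blast
  note lin = linear_0[OF S_linear] linear_add[OF S_linear] linear_diff[OF S_linear] linear_cmul[OF S_linear]
  let ?q = "\<lambda>v. 3 *\<^sub>R S u (S u (S u (S u (S u v)))) - 10 *\<^sub>R S u (S u (S u v)) + 3 *\<^sub>R S u v"
  have "linear ?q" by (rule linearI) (simp_all add: lin algebra_simps)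
  moreover have "?q b = 0" if b: "b \<in> B" for b
  proof -
    have "?q b = (3 * k b^5 - 10 * k b^3 + 3 * k b) *\<^sub>R b"
      by (rule inner_eqI) (simp add: k(1)[OF b] lin inner_add_left inner_diff_left algebra_simps eval_nat_numeral)
    also have "3 * k b^5 - 10 * k b^3 + 3 * k b = 3 * k b * ((k b)\<^sup>2 - 3) * ((k b)\<^sup>2 - 1/3)"
      by (simp add: algebra_simps eval_nat_numeral)
    also have "\<dots> = 0" using k(2)[OF b] by auto
    finally show ?thesis by simp
  qed
  moreover have "v \<in> span B" using B v unfolding ONB_def by simp
  ultimately have "?q v = 0" using linear_eq_0_on_span by blast
  then have "r ^ 5 *\<^sub>R ?q v = 0" by simp
  moreover have "3 *\<^sub>R S w (S w (S w (S w (S w v)))) - (10 * (w \<bullet> w)) *\<^sub>R S w (S w (S w v)) + (3 * (w \<bullet> w)\<^sup>2) *\<^sub>R S w v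
    = r ^ 5 *\<^sub>R ?q v"
    unfolding u(4) unfolding u(3)
    by (rule inner_eqI) (simp add: S_scale lin inner_add_left inner_diff_left algebra_simps eval_nat_numeral)
  ultimately show ?thesis by simp
qed

section \<open>Dimensions and traces in a basis adapted to \<open>p\<close>, \<open>T\<close> and
  \<open>N\<close>\<close>

lemma adapted_basis:
  assumes B: "ONB T B" and C: "ONB N C"
  shows "ONB UNIV (insert p (B \<union> C))"
    and "(\<Sum>b\<in>insert p (B \<union> C). f b) = f p + (\<Sum>b\<in>B. f b) + (\<Sum>c\<in>C. f c :: real)"
    and "DIM('a) = 1 + dim T + dim N"
proof -
  have fin: "finite B" "finite C" using B C ONB_finite by blast+
  have BC: "ONB {v + w |v w. v \<in> T \<and> w \<in> N} (B \<union> C)" "B \<inter> C = {}"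
    by (rule ONB_Un[OF B C]; simp add: T_N)+
  have "norm p = 1" using p_unit by (simp add: norm_eq_1)
  note Un = ONB_Un[OF BC(1) ONB_singleton[OF this]]
  have orth: "v \<bullet> q = 0" if "v \<in> {v + w |v w. v \<in> T \<and> w \<in> N}" "q \<in> span {p}" for v q
    using that T_p N_p by (auto simp: span_singleton inner_add_left)
  have all: "{v + w |v w. v \<in> {v + w |v w. v \<in> T \<and> w \<in> N} \<and> w \<in> span {p}} = UNIV"
  proof -
    have "v \<in> {v + w |v w. v \<in> {v + w |v w. v \<in> T \<and> w \<in> N} \<and> w \<in> span {p}}" for v
    proof -
      have "v = (tan_part v + nor_part v) + (v \<bullet> p) *\<^sub>R p" using split[of v] by (simp add: algebra_simps)
      moreover have "(v \<bullet> p) *\<^sub>R p \<in> span {p}" by (simp add: span_mul span_base)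
      ultimately show ?thesis using tan_part_T[of v] nor_part_N[of v] by blast
    qed
    then show ?thesis by blast
  qed
  have un: "ONB UNIV (B \<union> C \<union> {p})" "(B \<union> C) \<inter> {p} = {}"
    using Un orth unfolding all by blast+
  show 1: "ONB UNIV (insert p (B \<union> C))" using un(1) by simp
  have p: "p \<notin> B \<union> C" using un(2) by simp
  show "(\<Sum>b\<in>insert p (B \<union> C). f b) = f p + (\<Sum>b\<in>B. f b) + (\<Sum>c\<in>C. f c :: real)"
    using p fin BC(2) by (simp add: sum.union_disjoint)
  have "DIM('a) = card (insert p (B \<union> C))" using ONB_card[OF 1] by simp
  then show "DIM('a) = 1 + dim T + dim N"
    using p fin BC(2) ONB_card[OF B] ONB_card[OF C] by (simp add: card_Un_disjoint)
qed

text \<open>Harmonicity at \<open>p\<close>: \<open>30 + 6 * dim T - 30 * dim N = 0\<close>.\<close>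

lemma dim_T: "dim T + 5 = 5 * dim N"
proof -
  obtain B C where BC: "ONB T B" "ONB N C"
    using ONB_exists subspace_T subspace_N by metis
  have "H p b \<bullet> b = 6" if "b \<in> B" for b
    using H_T[OF ONB_mem[OF BC(1) that]] ONB_inner[OF BC(1) that that] by simp
  moreover have "H p b \<bullet> b = - 30" if "b \<in> C" for b
    using H_N[OF ONB_mem[OF BC(2) that]] ONB_inner[OF BC(2) that that] by simp
  ultimately have "0 = 30 + 6 * real (card B) - 30 * real (card C)"
    using H_trace[OF adapted_basis(1)[OF BC], of p] unfolding adapted_basis(2)[OF BC]
    by (simp add: H_p p_unit)
  then show ?thesis
    using ONB_card[OF BC(1)] ONB_card[OF BC(2)] by linarith
qed

text \<open>The trace of \<open>K p w\<close> over the whole space vanishes by harmonicity. The part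
  along \<open>p\<close> vanishes by Euler's relation, the normal part because
  \<open>K p c c\<close> is a multiple of \<open>p\<close>.\<close>

lemma shape_trace:
  assumes w: "w \<in> N" and B: "ONB T B"
  shows "(\<Sum>b\<in>B. S w b \<bullet> b) = 0"
proof -
  obtain C where C: "ONB N C" using ONB_exists subspace_N by metis
  have "K p w p \<bullet> p = 0"
    using N_p[OF w] by (simp add: K_sym[of p w] Euler_H H_N[OF w])
  moreover have "K p w c \<bullet> c = 0" if "c \<in> C" for c
  proof -
    have c: "c \<in> N" "c \<bullet> c = 1"
      using ONB_mem[OF C that] ONB_inner[OF C that that] by auto
    have "K p w c \<bullet> c = K p c c \<bullet> w" by (subst K_sym) (rule K_sym_inner)
    then show ?thesis using N_p[OF w] by (simp add: K_normal_normal[OF c] inner_commute)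
  qed
  ultimately have "(\<Sum>b\<in>B. K p w b \<bullet> b) = 0"
    using K_trace[OF adapted_basis(1)[OF B C], of p w] unfolding adapted_basis(2)[OF B C] by simp
  then show ?thesis unfolding S_def by (simp add: sum_divide_distrib[symmetric])
qed

text \<open>Along the unit circle through \<open>w\<close> and \<open>w'\<close> the gradient at
  \<open>p + c t\<close> is \<open>- 24 p + 24 c t\<close>; its derivative at \<open>t = 0\<close>
  is the claim.\<close>

lemma H_normal_rotation:
  assumes w: "w \<in> N" "w \<bullet> w = 1" and w': "w' \<in> N" "w' \<bullet> w' = 1" and orth: "w \<bullet> w' = 0"
  shows "H (p + w) w' = 24 *\<^sub>R w'"
proof -
  define c where "c t = cos t *\<^sub>R w + sin t *\<^sub>R w'" for t :: real
  have c: "c t \<in> N" "c t \<bullet> c t = 1" for t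
    unfolding c_def using w w' orth subspace_N
    by (auto simp: subspace_add subspace_scale inner_add_left inner_add_right inner_commute[of w' w]
        sin_cos_squared_add3 add.commute)
  have G: "G (p + c t) = - 24 *\<^sub>R p + 24 *\<^sub>R c t" for t
    using G_normal[OF c(1)[of t] c(2)[of t], of 1] by (simp add: re5_def im5_def algebra_simps)
  have c': "(c has_vector_derivative w') (at 0)"
    unfolding c_def by (auto intro!: derivative_eq_intros)
  have "((\<lambda>t. p + c t) has_derivative (\<lambda>h. h *\<^sub>R w')) (at 0)"
    using c' by (auto intro!: derivative_eq_intros simp: has_vector_derivative_def)
  from has_derivative_compose[OF this G_deriv]
  have "((\<lambda>t. G (p + c t)) has_vector_derivative H (p + w) w') (at 0)"
    by (simp add: has_vector_derivative_def H_simps c_def)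
  moreover have "((\<lambda>t. - 24 *\<^sub>R p + 24 *\<^sub>R c t) has_vector_derivative 24 *\<^sub>R w') (at 0)"
    by (auto intro!: derivative_eq_intros c')
  ultimately show ?thesis unfolding G by (rule vector_derivative_unique_at)
qed

text \<open>At \<open>p + w\<close> the Hessian acts on an eigenvector of \<open>S w\<close> for \<open>k\<close> by \<open>- 24 * (1 + k) / (1 - k)\<close>. If no
  \<open>k\<^sup>2\<close> is \<open>3\<close>, these five numbers are at most \<open>- 6\<close>, while the other eigenvalues \<open>\<plusminus>120\<close> and \<open>24\<close> add up to
  \<open>24\<close>, contradicting harmonicity.\<close>

lemma maximal_shape_eigenvector:
  assumes N2: "dim N = 2"
  obtains w w' e where "ONB N {w, w'}" "w \<noteq> w'" "e \<in> T" "e \<bullet> e = 1" "S w e = sqrt 3 *\<^sub>R e"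
proof -
  obtain C where C: "ONB N C" using ONB_exists subspace_N by metis
  have "card C = 2" using ONB_card[OF C] N2 by simp
  then obtain w w' where ww: "C = {w, w'}" "w \<noteq> w'" by (meson card_2_iff)
  have w: "w \<in> N" "w \<bullet> w = 1" and w': "w' \<in> N" "w' \<bullet> w' = 1" and orth: "w \<bullet> w' = 0"
    using ONB_mem[OF C] ONB_inner[OF C] ww by auto
  obtain B k where B: "ONB T B" and k: "\<And>b. b \<in> B \<Longrightarrow> S w b = k b *\<^sub>R b"
    "\<And>b. b \<in> B \<Longrightarrow> k b = 0 \<or> (k b)\<^sup>2 = 3 \<or> (k b)\<^sup>2 = 1/3"
    using shape_eigenbasis[OF w] by blast
  have "\<exists>b\<in>B. (k b)\<^sup>2 = 3"
  proof (rule ccontr)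
    assume "\<not> ?thesis"
    then have small: "(k b)\<^sup>2 \<le> 1/3" if "b \<in> B" for b using k(2)[OF that] that by auto
    have le: "H (p + w) b \<bullet> b \<le> - 6" if b: "b \<in> B" for b
    proof -
      have bb: "b \<bullet> b = 1" using ONB_inner[OF B b b] by simp
      have "H (p + 1 *\<^sub>R w) (b - 1 *\<^sub>R S w b) = 6 *\<^sub>R (re5 1 *\<^sub>R b + im5 1 *\<^sub>R S w b)"
        by (rule H_normal_tangent[OF w ONB_mem[OF B b]])
      from arg_cong[OF this, of "\<lambda>v. v \<bullet> b"]
      have eq: "(1 - k b) * (H (p + w) b \<bullet> b) = - 24 * (1 + k b)"
        by (simp add: k(1)[OF b] H_simps re5_def im5_def inner_diff_left inner_add_left bb algebra_simps)
      \<comment> \<open>A rational bound above \<open>1/\<surd>3\<close>; \<open>k = - 6/10\<close>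
        is exactly where \<open>- 24 * (1 + k) / (1 - k)\<close> equals -6.\<close>
      have "\<bar>k b\<bar> \<le> 6/10"
        by (rule power2_le_imp_le) (use small[OF b] in \<open>auto simp: power2_eq_square\<close>)
      then have "1 - k b > 0" "- 24 * (1 + k b) \<le> (1 - k b) * (- 6)" by (auto simp: abs_le_iff)
      then show ?thesis using eq by (metis mult_le_cancel_left_pos)
    qed
    have Hw: "H (p + w) w = 120 *\<^sub>R w" using H_normal_normal[OF w, of 1] by simp
    have Gw: "G (p + w) = - 24 *\<^sub>R p + 24 *\<^sub>R w"
      using G_normal[OF w, of 1] by (simp add: re5_def im5_def algebra_simps)
    have "H (p + w) p = H (p + w) (p + w) - H (p + w) w" by (simp add: H_simps)
    also have "H (p + w) (p + w) = 120 *\<^sub>R w - 120 *\<^sub>R p"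
      unfolding Euler_G Gw by (simp add: algebra_simps)
    finally have Hp: "H (p + w) p = - 120 *\<^sub>R p" unfolding Hw by simp
    have "H (p + w) p \<bullet> p + (\<Sum>b\<in>B. H (p + w) b \<bullet> b) + (\<Sum>c\<in>C. H (p + w) c \<bullet> c) = 0"
      using H_trace[OF adapted_basis(1)[OF B C], of "p + w"] unfolding adapted_basis(2)[OF B C] .
    then have "(\<Sum>b\<in>B. H (p + w) b \<bullet> b) = - 24"
      using ww(2) unfolding ww(1)
      by (simp add: Hw Hp H_normal_rotation[OF w w' orth] w(2) w'(2) p_unit)
    \<comment> \<open>Five terms of at most -6 would add up to at most -30, not -24.\<close>
    moreover have "(\<Sum>b\<in>B. H (p + w) b \<bullet> b) \<le> (\<Sum>b\<in>B. - 6)" by (rule sum_mono) (rule le)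
    moreover have "card B = 5" using dim_T N2 ONB_card[OF B] by simp
    ultimately show False by simp
  qed
  then obtain e where e: "e \<in> B" "(k e)\<^sup>2 = 3" by blast
  have eT: "e \<in> T" "e \<bullet> e = 1"
    using ONB_mem[OF B e(1)] ONB_inner[OF B e(1) e(1)] by auto
  have "k e = sqrt 3 \<or> k e = - sqrt 3" using e(2) by (metis real_sqrt_abs abs_eq_iff' abs_ge_zero real_sqrt_pow2_iff power2_eq_iff real_sqrt_eq_iff)
  then show ?thesis
  proof
    assume "k e = sqrt 3"
    then show ?thesis using that[of w w' e] C ww eT k(1)[OF e(1)] by simp
  next
    \<comment> \<open>Reversing \<open>w\<close> changes the sign of its shape operator and keeps
      the span.\<close>
    assume ke: "k e = - sqrt 3"
    have "span {- w, w'} = span {w, w'}"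
    proof (rule span_eq[THEN iffD2], intro conjI)
      show "{- w, w'} \<subseteq> span {w, w'}" by (simp add: span_base span_neg)
      have "w \<in> span {- w, w'}" using span_neg[of "- w" "{- w, w'}"] by (simp add: span_base)
      then show "{w, w'} \<subseteq> span {- w, w'}" by (simp add: span_base)
    qed
    then have "ONB N {- w, w'}"
      using C orth unfolding ww(1) ONB_def pairwise_def orthogonal_def
      by (auto simp: inner_commute)
    moreover have "- w \<noteq> w'" using orth w(2) by auto
    moreover have "S (- w) e = sqrt 3 *\<^sub>R e"
      using S_scale[of "- 1" w e] k(1)[OF e(1)] ke by simp
    ultimately show ?thesis using that eT by blast
  qed
qed

lemma large_shape_square_sum:
  assumes N2: "dim N = 2"
  obtains C v where "ONB N C" "v \<in> T" "(\<Sum>c\<in>C. S c v \<bullet> S c v) > 4 * (v \<bullet> v)"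
proof -
  obtain w w' e where C: "ONB N {w, w'}" "w \<noteq> w'" and e: "e \<in> T" "e \<bullet> e = 1" "S w e = sqrt 3 *\<^sub>R e"
    using maximal_shape_eigenvector[OF N2] by blast
  have w: "w \<in> N" "w \<bullet> w = 1" and w': "w' \<in> N" "w' \<bullet> w' = 1" and orth: "w \<bullet> w' = 0"
    using ONB_mem[OF C(1)] ONB_inner[OF C(1)] C(2) by auto
  \<comment> \<open>\<open>w + t w'\<close> is a normal of squared length
    \<open>1 + t\<^sup>2\<close>, and \<open>S\<close> is linear in the normal.\<close>
  interpret isospectral_pencil T "S w" "S w'"
  proof (rule isospectral_pencil.intro)
    fix v L t assume v: "v \<in> T" and L: "L = (\<lambda>v. S w v + t *\<^sub>R S w' v)"
    have "w + t *\<^sub>R w' \<in> N" using w w' subspace_N by (simp add: subspace_add subspace_scale)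
    moreover have "L = S (w + t *\<^sub>R w')" unfolding L by (auto simp: S_add S_scale)
    moreover have "(w + t *\<^sub>R w') \<bullet> (w + t *\<^sub>R w') = 1 + t\<^sup>2"
      using w w' orth by (simp add: inner_add_left inner_add_right inner_commute[of w' w] power2_eq_square)
    ultimately show "3 *\<^sub>R L (L (L (L (L v)))) - (10 * (1 + t\<^sup>2)) *\<^sub>R L (L (L v)) + (3 * (1 + t\<^sup>2)\<^sup>2) *\<^sub>R L v = 0"
      using shape_quintic[OF _ v] by metis
  qed (use w w' in \<open>auto intro: subspace_T S_linear S_T S_sym\<close>)
  show ?thesis
    using exists_large_square_sum[of "sqrt 3" e] e that[OF C(1)] C(2) by auto
qed

end

section \<open>The Gauss equation of an immersion\<close>

text \<open>The derivative is \<open>f u *\<^sub>R g'\<close>: near \<open>u\<close> the factor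
  \<open>g\<close> is of first order, so continuity of \<open>f\<close> absorbs the error.\<close>

lemma differentiable_scaleR_vanishing:
  fixes f :: "'a::real_normed_vector \<Rightarrow> real" and g :: "'a \<Rightarrow> 'b::real_normed_vector"
  assumes f: "isCont f u" and g: "g differentiable at u" "g u = 0"
  shows "(\<lambda>v. f v *\<^sub>R g v) differentiable at u"
proof -
  obtain g' where g': "(g has_derivative g') (at u)" using g(1) unfolding differentiable_def by blast
  have bl: "bounded_linear g'" by (rule has_derivative_bounded_linear[OF g'])
  then obtain C where C: "C > 0" "\<And>h. norm (g' h) \<le> norm h * C" using bounded_linear.pos_bounded by blast
  have "((\<lambda>v. f v *\<^sub>R g v) has_derivative (\<lambda>h. f u *\<^sub>R g' h)) (at u)"
    unfolding has_derivative_at2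
  proof
    show "bounded_linear (\<lambda>h. f u *\<^sub>R g' h)" by (rule bounded_linear_const_scaleR[OF bl])
    have lim: "((\<lambda>y. \<bar>f y\<bar> * norm ((1 / norm (y - u)) *\<^sub>R (g y - (g u + g' (y - u)))) + \<bar>f y - f u\<bar> * C) \<longlongrightarrow> 0) (at u)"
    proof -
      have 1: "((\<lambda>y. norm ((1 / norm (y - u)) *\<^sub>R (g y - (g u + g' (y - u))))) \<longlongrightarrow> 0) (at u)"
        using g' unfolding has_derivative_at2 by (intro tendsto_norm_zero) simp
      have 2: "(f \<longlongrightarrow> f u) (at u)" using f by (simp add: isCont_def)
      have "((\<lambda>y. \<bar>f y\<bar> * norm ((1 / norm (y - u)) *\<^sub>R (g y - (g u + g' (y - u)))) + \<bar>f y - f u\<bar> * C)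
        \<longlongrightarrow> \<bar>f u\<bar> * 0 + \<bar>f u - f u\<bar> * C) (at u)"
        by (intro tendsto_intros 1 2)
      then show ?thesis by simp
    qed
    show "((\<lambda>y. (1 / norm (y - u)) *\<^sub>R (f y *\<^sub>R g y - (f u *\<^sub>R g u + f u *\<^sub>R g' (y - u)))) \<longlongrightarrow> 0) (at u)"
    proof (rule Lim_null_comparison[OF _ lim], rule always_eventually, rule allI)
      fix y
      show "norm ((1 / norm (y - u)) *\<^sub>R (f y *\<^sub>R g y - (f u *\<^sub>R g u + f u *\<^sub>R g' (y - u))))
        \<le> \<bar>f y\<bar> * norm ((1 / norm (y - u)) *\<^sub>R (g y - (g u + g' (y - u)))) + \<bar>f y - f u\<bar> * C"
      proof (cases "y = u")
        case False
        have "f y *\<^sub>R g y - (f u *\<^sub>R g u + f u *\<^sub>R g' (y - u))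
          = f y *\<^sub>R (g y - (g u + g' (y - u))) + (f y - f u) *\<^sub>R g' (y - u)"
          using g(2) by (simp add: algebra_simps)
        then have "(1 / norm (y - u)) *\<^sub>R (f y *\<^sub>R g y - (f u *\<^sub>R g u + f u *\<^sub>R g' (y - u)))
          = f y *\<^sub>R ((1 / norm (y - u)) *\<^sub>R (g y - (g u + g' (y - u)))) + (f y - f u) *\<^sub>R ((1 / norm (y - u)) *\<^sub>R g' (y - u))"
          by (simp add: scaleR_add_right mult.commute)
        moreover have "norm ((f y - f u) *\<^sub>R ((1 / norm (y - u)) *\<^sub>R g' (y - u))) \<le> \<bar>f y - f u\<bar> * C"
        proof -
          have "norm (g' (y - u)) / norm (y - u) \<le> C" using C(2)[of "y - u"] False by (simp add: field_simps)
          then have "\<bar>f y - f u\<bar> * (norm (g' (y - u)) / norm (y - u)) \<le> \<bar>f y - f u\<bar> * C"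
            by (rule mult_left_mono) simp
          then show ?thesis by simp
        qed
        ultimately show ?thesis
          by (metis (no_types, lifting) norm_triangle_mono norm_scaleR order_refl)
      qed (use C in simp)
    qed
  qed
  then show ?thesis unfolding differentiable_def by blast
qed

text \<open>Bootstrapping: \<open>w\<close> is bounded near \<open>u\<close>, then continuous at
  \<open>u\<close>. With a left inverse \<open>L\<close> of \<open>A u\<close>, the solution is
  \<open>w u + L (b v - b u - r v)\<close>, where \<open>r v = A v (w v) - A u (w v)\<close> is a
  sum of continuous factors times differentiable ones vanishing at \<open>u\<close>.\<close>

lemma linear_solution_differentiable:
  fixes A :: "'d::euclidean_space \<Rightarrow> 'e::euclidean_space \<Rightarrow> 'e"
  assumes U: "open U" "u \<in> U" and lin: "\<And>v. v \<in> U \<Longrightarrow> linear (A v)"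
    and A: "\<And>e. (\<lambda>v. A v e) differentiable at u" and inj: "inj (A u)"
    and b: "b differentiable at u" and eq: "\<And>v. v \<in> U \<Longrightarrow> A v (w v) = b v"
  shows "w differentiable at u"
proof -
  obtain c where c: "c > 0" "\<And>z. c * norm z \<le> norm (A u z)"
    using linear_inj_bounded_below_pos[OF lin[OF U(2)] inj] by metis
  obtain L where L: "linear L" "\<And>z. L (A u z) = z"
    using linear_injective_left_inverse[OF lin[OF U(2)] inj] by (metis comp_apply id_apply)
  define \<epsilon> where "\<epsilon> v = (\<Sum>i\<in>Basis. norm (A v i - A u i))" for v
  have expand: "A v z - A u z = (\<Sum>i\<in>Basis. (z \<bullet> i) *\<^sub>R (A v i - A u i))" if "v \<in> U" for v z
    using linear_Basis_expansion[OF lin[OF that], of z] linear_Basis_expansion[OF lin[OF U(2)], of z]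
    by (simp add: sum_subtractf scaleR_diff_right)
  have le: "norm (A v z - A u z) \<le> \<epsilon> v * norm z" if "v \<in> U" for v z
  proof -
    have "norm (A v z - A u z) \<le> (\<Sum>i\<in>Basis. norm ((z \<bullet> i) *\<^sub>R (A v i - A u i)))"
      by (subst expand[OF that]) (rule norm_sum)
    also have "\<dots> \<le> (\<Sum>i\<in>Basis. norm (A v i - A u i) * norm z)"
      by (rule sum_mono) (simp add: mult.commute[of "norm (_ - _)"] mult_right_mono Basis_le_norm)
    finally show ?thesis unfolding \<epsilon>_def by (simp add: sum_distrib_right)
  qed
  have Acont: "isCont (\<lambda>v. A v e) u" for e by (rule differentiable_imp_continuous_within[OF A])
  have "isCont \<epsilon> u" unfolding \<epsilon>_def by (intro continuous_intros Acont)
  moreover have "\<epsilon> u = 0" unfolding \<epsilon>_def by simp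
  ultimately have eps: "(\<epsilon> \<longlongrightarrow> 0) (at u)" by (simp add: isCont_def)
  have bcont: "(b \<longlongrightarrow> b u) (at u)"
    using differentiable_imp_continuous_within[OF b] by (simp add: isCont_def)
  have inU: "\<forall>\<^sub>F v in at u. v \<in> U" using U by (simp add: eventually_at_in_open' )
  have "\<forall>\<^sub>F v in at u. \<epsilon> v < c / 2"
    by (rule order_tendstoD(2)[OF eps]) (use c(1) in simp)
  moreover have "\<forall>\<^sub>F v in at u. norm (b v) < norm (b u) + 1"
    by (rule order_tendstoD(2)[OF tendsto_norm[OF bcont]]) simp
  ultimately have bound: "\<forall>\<^sub>F v in at u. norm (w v) \<le> 2 / c * (norm (b u) + 1)"
    using inU
  proof eventually_elim
    case (elim v)
    have "c * norm (w v) \<le> norm (A u (w v))" by (rule c)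
    also have "\<dots> \<le> norm (A v (w v)) + norm (A v (w v) - A u (w v))"
      by (metis norm_minus_commute norm_triangle_sub add.commute)
    also have "\<dots> \<le> norm (b v) + \<epsilon> v * norm (w v)" using le[OF elim(3), of "w v"] eq[OF elim(3)] by simp
    also have "\<dots> \<le> norm (b u) + 1 + c / 2 * norm (w v)"
      using elim by (intro add_mono mult_right_mono) auto
    finally show ?case using c(1) by (simp add: field_simps)
  qed
  define K where "K = 2 / c * (norm (b u) + 1)"
  have "((\<lambda>v. w v - w u) \<longlongrightarrow> 0) (at u)"
  proof (rule Lim_null_comparison)
    show "((\<lambda>v. (norm (b v - b u) + \<epsilon> v * K) / c) \<longlongrightarrow> 0) (at u)"
    proof -
      have "((\<lambda>v. (norm (b v - b u) + \<epsilon> v * K) / c) \<longlongrightarrow> (norm (b u - b u) + 0 * K) / c) (at u)"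
        by (intro tendsto_intros bcont eps) (use c(1) in simp)
      then show ?thesis by simp
    qed
    show "\<forall>\<^sub>F v in at u. norm (w v - w u) \<le> (norm (b v - b u) + \<epsilon> v * K) / c"
      using bound inU
    proof eventually_elim
      case (elim v)
      have "c * norm (w v - w u) \<le> norm (A u (w v - w u))" by (rule c)
      also have "A u (w v - w u) = (b v - b u) - (A v (w v) - A u (w v))"
        using eq[OF elim(2)] eq[OF U(2)] by (simp add: linear_diff[OF lin[OF U(2)]])
      also have "norm \<dots> \<le> norm (b v - b u) + norm (A v (w v) - A u (w v))" by (rule norm_triangle_ineq4)
      also have "\<dots> \<le> norm (b v - b u) + \<epsilon> v * norm (w v)" using le[OF elim(2)] by simp
      also have "\<dots> \<le> norm (b v - b u) + \<epsilon> v * K"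
      proof -
        have "\<epsilon> v \<ge> 0" unfolding \<epsilon>_def by (simp add: sum_nonneg)
        with elim(1) show ?thesis unfolding K_def[symmetric] by (simp add: mult_left_mono)
      qed
      finally show ?case using c(1) by (simp add: field_simps)
    qed
  qed
  then have wcont: "isCont w u" unfolding isCont_def by (rule LIM_zero_cancel)
  define r where "r v = (\<Sum>i\<in>Basis. (w v \<bullet> i) *\<^sub>R (A v i - A u i))" for v
  have "r differentiable at u"
    unfolding r_def
    by (intro differentiable_sum ballI differentiable_scaleR_vanishing continuous_intros wcont)
      (auto intro!: differentiable_diff A)
  then have "(\<lambda>v. b v - b u - r v) differentiable at u"
    by (intro differentiable_diff b) auto
  moreover have "bounded_linear L" using L(1) linear_conv_bounded_linear by blast
  ultimately have "(\<lambda>v. w u + L (b v - b u - r v)) differentiable at u"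
    by (intro differentiable_add differentiable_const)
      (auto simp: differentiable_def intro: bounded_linear.has_derivative)
  moreover have "w u + L (b v - b u - r v) = w v" if "v \<in> U" for v
  proof -
    have "b v - b u - r v = A u (w v) - A u (w u)"
      unfolding r_def expand[OF that, symmetric] using eq[OF that] eq[OF U(2)] by simp
    then show ?thesis by (simp add: linear_diff[OF L(1)] L(2))
  qed
  ultimately show ?thesis
    using U unfolding differentiable_def by (metis (no_types, lifting) has_derivative_transform_within_open)
qed

section \<open>Christoffel symbols and curvature of an immersion\<close>

lemma Ck_on_Suc_has_derivative:
  assumes "open U" "Ck_on (Suc k) f U" "u \<in> U"
  shows "(f has_derivative frechet_derivative f (at u)) (at u)"
proof -
  have "f differentiable at u"
    using assms unfolding Ck_on.simps differentiable_on_def by (metis at_within_open)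
  then show ?thesis by (simp add: frechet_derivative_works)
qed

locale smooth_immersion =
  fixes \<phi> :: "'d::euclidean_space \<Rightarrow> 'a::euclidean_space" and U :: "'d set"
  assumes smooth: "smooth_on U \<phi>" and immersion: "u \<in> U \<Longrightarrow> inj (frechet_derivative \<phi> (at u))"
begin

definition J where "J u x = frechet_derivative \<phi> (at u) x"
definition D2 where "D2 u x y = frechet_derivative (\<lambda>v. J v y) (at u) x"
definition D3 where "D3 u x y z = frechet_derivative (\<lambda>v. D2 v y z) (at u) x"

lemma open_U: "open U" using smooth unfolding smooth_on_def by simp

lemma Ck_J: "Ck_on k (\<lambda>v. J v y) U"
  using smooth Ck_on.simps(2)[of k \<phi> U] unfolding J_def smooth_on_def by blast

lemma Ck_D2: "Ck_on k (\<lambda>v. D2 v x y) U"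
  using Ck_J[of "Suc k" y] unfolding D2_def by simp

lemma Ck_D3: "Ck_on k (\<lambda>v. D3 v x y z) U"
  using Ck_D2[of "Suc k" y z] unfolding D3_def by simp

lemma \<phi>_deriv: "u \<in> U \<Longrightarrow> (\<phi> has_derivative J u) (at u)"
  using Ck_on_Suc_has_derivative[OF open_U, of 0 \<phi>] smooth
  unfolding smooth_on_def J_def[abs_def] by blast

lemma J_deriv: "u \<in> U \<Longrightarrow> ((\<lambda>v. J v y) has_derivative (\<lambda>x. D2 u x y)) (at u)"
  unfolding D2_def[abs_def] by (rule Ck_on_Suc_has_derivative[OF open_U Ck_J])

lemma D2_deriv: "u \<in> U \<Longrightarrow> ((\<lambda>v. D2 v y z) has_derivative (\<lambda>x. D3 u x y z)) (at u)"
  unfolding D3_def[abs_def] by (rule Ck_on_Suc_has_derivative[OF open_U Ck_D2])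

lemma isCont_D2: "u \<in> U \<Longrightarrow> isCont (\<lambda>v. D2 v x y) u"
  using Ck_D2[of 0 x y] open_U by (simp add: continuous_on_eq_continuous_at)

lemma isCont_D3: "u \<in> U \<Longrightarrow> isCont (\<lambda>v. D3 v x y z) u"
  using Ck_D3[of 0 x y z] open_U by (simp add: continuous_on_eq_continuous_at)

lemma D2_sym: "u \<in> U \<Longrightarrow> D2 u x y = D2 u y x"
  by (rule second_derivative_commute[OF open_U, where f = \<phi> and f' = J and x = y and y = x
      and fx = "\<lambda>v h. D2 v h y" and fy = "\<lambda>v h. D2 v h x"])
    (auto intro: \<phi>_deriv J_deriv isCont_D2)

lemma D3_sym: "u \<in> U \<Longrightarrow> D3 u x y z = D3 u y x z"
  by (rule second_derivative_commute[OF open_U, where f = "\<lambda>v. J v z" and f' = "\<lambda>v h. D2 v h z"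
      and x = y and y = x and fx = "\<lambda>v h. D3 v h y z" and fy = "\<lambda>v h. D3 v h x z"])
    (auto intro: J_deriv D2_deriv isCont_D3)

lemma J_linear: "u \<in> U \<Longrightarrow> linear (J u)" by (rule has_derivative_linear[OF \<phi>_deriv])

lemma D2_linear: "u \<in> U \<Longrightarrow> linear (\<lambda>x. D2 u x y)" by (rule has_derivative_linear[OF J_deriv])

lemma J_inj: "u \<in> U \<Longrightarrow> inj (J u)" using immersion unfolding J_def[abs_def] .

lemma J_eq_0: "u \<in> U \<Longrightarrow> J u x = 0 \<Longrightarrow> x = 0"
  using J_inj J_linear linear_injective_0 by blast

abbreviation g where "g \<equiv> induced_metric \<phi>"

lemma metric: "g u x y = J u x \<bullet> J u y"
  unfolding induced_metric_def J_def ..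

lemma metric_deriv: "u \<in> U \<Longrightarrow> metric_deriv g u w x y = D2 u w x \<bullet> J u y + J u x \<bullet> D2 u w y"
proof -
  assume "u \<in> U"
  then have "((\<lambda>v. J v x \<bullet> J v y) has_derivative (\<lambda>h. J u x \<bullet> D2 u h y + D2 u h x \<bullet> J u y)) (at u)"
    by (intro has_derivative_inner J_deriv)
  then show ?thesis
    unfolding metric_deriv_def metric by (simp add: frechet_derivative_eqI add.commute)
qed

text \<open>Orthogonal projection of \<open>c\<close> to the tangent space, pulled back by the
  injective \<open>J u\<close>. It makes the definite description in \<open>christoffel\<close>
  meaningful.\<close>

lemma tangential_representative:
  assumes "u \<in> U"
  shows "\<exists>!w. \<forall>z. J u w \<bullet> J u z = c \<bullet> J u z"
proof (rule ex_ex1I)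
  have "subspace (range (J u))" using linear_subspace_image[OF J_linear[OF assms] subspace_UNIV] .
  then obtain E where E: "ONB (range (J u)) E" using ONB_exists by metis
  have "(\<Sum>e\<in>E. (c \<bullet> e) *\<^sub>R e) \<in> range (J u)"
    using \<open>subspace (range (J u))\<close> ONB_mem[OF E]
    by (intro subspace_sum) (auto intro: subspace_scale)
  then obtain w where w: "J u w = (\<Sum>e\<in>E. (c \<bullet> e) *\<^sub>R e)" by auto
  have "J u w \<bullet> J u z = c \<bullet> J u z" for z
  proof -
    have "c \<bullet> J u z = (\<Sum>e\<in>E. (J u z \<bullet> e) * (e \<bullet> c))"
      using ONB_inner_expansion[OF E, of "J u z" c] by (simp add: inner_commute)
    also have "\<dots> = (\<Sum>e\<in>E. (c \<bullet> e) * (e \<bullet> J u z))"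
      by (rule sum.cong) (simp_all add: inner_commute mult.commute)
    finally show ?thesis unfolding w by (simp add: inner_sum_left)
  qed
  then show "\<exists>w. \<forall>z. J u w \<bullet> J u z = c \<bullet> J u z" by blast
next
  fix w w' assume "\<forall>z. J u w \<bullet> J u z = c \<bullet> J u z" "\<forall>z. J u w' \<bullet> J u z = c \<bullet> J u z"
  then have "J u (w - w') \<bullet> J u z = 0" for z
    by (simp add: linear_diff[OF J_linear[OF assms]] inner_diff_left)
  from this[of "w - w'"] have "J u (w - w') = 0" by simp
  then show "w = w'" using J_eq_0[OF assms] by fastforce
qed

abbreviation \<Gamma> where "\<Gamma> \<equiv> christoffel g"

text \<open>By symmetry of \<open>D2\<close> the Koszul expression collapses, so the Levi-Civita
  derivative is the tangential part of the second derivative.\<close>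

lemma christoffel: "u \<in> U \<Longrightarrow> J u (\<Gamma> u x y) \<bullet> J u z = D2 u x y \<bullet> J u z"
proof -
  assume u: "u \<in> U"
  have eq: "(metric_deriv g u x y z + metric_deriv g u y x z - metric_deriv g u z x y) / 2 = D2 u x y \<bullet> J u z" for z
    unfolding metric_deriv[OF u] D2_sym[OF u, of y x] D2_sym[OF u, of z x] D2_sym[OF u, of z y]
    by (simp add: inner_commute)
  have "\<Gamma> u x y = (THE w. \<forall>z. J u w \<bullet> J u z = D2 u x y \<bullet> J u z)"
    unfolding christoffel_def eq unfolding metric ..
  then show ?thesis using theI'[OF tangential_representative[OF u, of "D2 u x y"]] by simp
qed

text \<open>\<open>riemann\<close> uses the total operator \<open>frechet_derivative\<close>, so
  differentiability must be proved. The symbols solve a linear system with the Gram matrix of the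
  metric.\<close>

lemma christoffel_deriv:
  assumes u: "u \<in> U"
  shows "((\<lambda>v. \<Gamma> v x y) has_derivative frechet_derivative (\<lambda>v. \<Gamma> v x y) (at u)) (at u)"
proof -
  define A where "A v w = (\<Sum>i\<in>Basis. (J v w \<bullet> J v i) *\<^sub>R i)" for v and w :: 'd
  define b where "b v = (\<Sum>i\<in>Basis. (D2 v x y \<bullet> J v i) *\<^sub>R i)" for v
  have "(\<lambda>v. \<Gamma> v x y) differentiable at u"
  proof (rule linear_solution_differentiable[OF open_U u, where A = A and b = b])
    show "linear (A v)" if "v \<in> U" for v
      unfolding A_def
      by (rule linearI) (simp_all add: linear_add[OF J_linear[OF that]] linear_cmul[OF J_linear[OF that]]
          inner_add_left scaleR_add_left sum.distrib scaleR_sum_right)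
    have "((\<lambda>v. A v e) has_derivative (\<lambda>h. \<Sum>i\<in>Basis. (J u e \<bullet> D2 u h i + D2 u h e \<bullet> J u i) *\<^sub>R i)) (at u)" for e
      unfolding A_def
      by (intro has_derivative_sum has_derivative_scaleR_left has_derivative_inner J_deriv u)
    then show "(\<lambda>v. A v e) differentiable at u" for e unfolding differentiable_def by blast
    have "(b has_derivative (\<lambda>h. \<Sum>i\<in>Basis. (D2 u x y \<bullet> D2 u h i + D3 u h x y \<bullet> J u i) *\<^sub>R i)) (at u)"
      unfolding b_def
      by (intro has_derivative_sum has_derivative_scaleR_left has_derivative_inner J_deriv D2_deriv u)
    then show "b differentiable at u" unfolding differentiable_def by blast
    show "A v (\<Gamma> v x y) = b v" if "v \<in> U" for v
      unfolding A_def b_def christoffel[OF that] ..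
    show "inj (A u)"
    proof (rule linear_injective_0[THEN iffD2, OF \<open>\<And>v. v \<in> U \<Longrightarrow> linear (A v)\<close>[OF u]], intro allI impI)
      fix w assume "A u w = 0"
      then have "A u w \<bullet> w = 0" by simp
      moreover have "A u w \<bullet> w = J u w \<bullet> J u (\<Sum>i\<in>Basis. (w \<bullet> i) *\<^sub>R i)"
        unfolding A_def
        by (simp add: linear_sum[OF J_linear[OF u]] linear_cmul[OF J_linear[OF u]] inner_sum_left
            inner_sum_right inner_commute[of w] mult.commute)
      ultimately have "J u w \<bullet> J u w = 0" by (simp add: euclidean_representation)
      then show "w = 0" using J_eq_0[OF u] by simp
    qed
  qed
  then show ?thesis by (simp add: frechet_derivative_works)
qed

text \<open>Normal part of the second derivative: the second fundamental form in the ambient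
  Euclidean space.\<close>

definition B where "B u x y = D2 u x y - J u (\<Gamma> u x y)"

lemma B_tangent: "u \<in> U \<Longrightarrow> B u x y \<bullet> J u z = 0"
  unfolding B_def using christoffel by (simp add: inner_diff_left)

text \<open>The third derivatives cancel by \<open>D3_sym\<close>. On the right, \<open>x\<close>
  occurs only in \<open>D2\<close>, whose linearity in that slot is what the trace computation
  uses.\<close>

lemma Gauss_equation:
  assumes u: "u \<in> U"
  shows "J u (riemann g u x y z) \<bullet> J u a = B u y z \<bullet> D2 u x a - D2 u x z \<bullet> B u y a"
proof -
  define D\<Gamma> where "D\<Gamma> y z = frechet_derivative (\<lambda>v. \<Gamma> v y z) (at u)" for y z
  have D\<Gamma>: "((\<lambda>v. \<Gamma> v y z) has_derivative D\<Gamma> y z) (at u)" for y z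
    unfolding D\<Gamma>_def by (rule christoffel_deriv[OF u])
  have J\<Gamma>: "((\<lambda>v. J v (\<Gamma> v y z)) has_derivative (\<lambda>x. D2 u x (\<Gamma> u y z) + J u (D\<Gamma> y z x))) (at u)" for y z
  proof -
    have D2lin: "linear (D2 u x)" for x
      using D2_linear[OF u, of x] D2_sym[OF u, of x] by (metis (no_types, lifting) ext)
    have "((\<lambda>v. \<Sum>i\<in>Basis. (\<Gamma> v y z \<bullet> i) *\<^sub>R J v i) has_derivative
       (\<lambda>x. \<Sum>i\<in>Basis. (\<Gamma> u y z \<bullet> i) *\<^sub>R D2 u x i + (D\<Gamma> y z x \<bullet> i) *\<^sub>R J u i)) (at u)"
      by (intro has_derivative_sum has_derivative_scaleR has_derivative_inner_left D\<Gamma> J_deriv u)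
    then have "((\<lambda>v. \<Sum>i\<in>Basis. (\<Gamma> v y z \<bullet> i) *\<^sub>R J v i) has_derivative
       (\<lambda>x. D2 u x (\<Gamma> u y z) + J u (D\<Gamma> y z x))) (at u)"
      unfolding sum.distrib linear_Basis_expansion[OF D2lin, symmetric]
        linear_Basis_expansion[OF J_linear[OF u], symmetric] .
    then show ?thesis
      by (rule has_derivative_transform_within_open[OF _ open_U u]) (metis linear_Basis_expansion J_linear)
  qed
  \<comment> \<open>Both sides of the identity \<open>christoffel\<close> are differentiated in
    direction \<open>x\<close>.\<close>
  have key: "D2 u x (\<Gamma> u y z) \<bullet> J u a + J u (D\<Gamma> y z x) \<bullet> J u a
      = D3 u x y z \<bullet> J u a + B u y z \<bullet> D2 u x a" for x y z
  proof -
    have "((\<lambda>v. J v (\<Gamma> v y z) \<bullet> J v a) has_derivative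
       (\<lambda>x. J u (\<Gamma> u y z) \<bullet> D2 u x a + (D2 u x (\<Gamma> u y z) + J u (D\<Gamma> y z x)) \<bullet> J u a)) (at u)"
      by (intro has_derivative_inner J\<Gamma> J_deriv u)
    moreover have "((\<lambda>v. D2 v y z \<bullet> J v a) has_derivative (\<lambda>x. D2 u y z \<bullet> D2 u x a + D3 u x y z \<bullet> J u a)) (at u)"
      by (intro has_derivative_inner D2_deriv J_deriv u)
    then have "((\<lambda>v. J v (\<Gamma> v y z) \<bullet> J v a) has_derivative (\<lambda>x. D2 u y z \<bullet> D2 u x a + D3 u x y z \<bullet> J u a)) (at u)"
      by (rule has_derivative_transform_within_open[OF _ open_U u]) (simp add: christoffel)
    ultimately have "J u (\<Gamma> u y z) \<bullet> D2 u x a + (D2 u x (\<Gamma> u y z) + J u (D\<Gamma> y z x)) \<bullet> J u a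
       = D2 u y z \<bullet> D2 u x a + D3 u x y z \<bullet> J u a" by (rule has_derivative_unique_apply)
    then show ?thesis by (simp add: B_def inner_diff_left inner_add_left)
  qed
  have B_sym: "B u x z \<bullet> D2 u y a = D2 u x z \<bullet> B u y a"
  proof -
    have "B u x z \<bullet> D2 u y a = B u x z \<bullet> B u y a"
      using B_tangent[OF u] unfolding B_def[of u y a] by (simp add: inner_diff_right)
    also have "J u w \<bullet> B u y a = 0" for w using B_tangent[OF u, of y a w] by (simp add: inner_commute)
    then have "B u x z \<bullet> B u y a = D2 u x z \<bullet> B u y a"
      unfolding B_def[of u x z] by (simp add: inner_diff_left)
    finally show ?thesis .
  qed
  have "J u (riemann g u x y z) \<bullet> J u a = J u (D\<Gamma> y z x) \<bullet> J u a - J u (D\<Gamma> x z y) \<bullet> J u a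
     + D2 u x (\<Gamma> u y z) \<bullet> J u a - D2 u y (\<Gamma> u x z) \<bullet> J u a"
    unfolding riemann_def D\<Gamma>_def[symmetric]
    by (simp add: linear_add[OF J_linear[OF u]] linear_diff[OF J_linear[OF u]] inner_add_left inner_diff_left
        christoffel[OF u])
  also have "\<dots> = B u y z \<bullet> D2 u x a - B u x z \<bullet> D2 u y a"
    using key[of x y z] key[of y x z] D3_sym[OF u, of x y z] by simp
  finally show ?thesis unfolding B_sym .
qed

text \<open>Passage from the trace over the standard basis of the model space to an orthonormal
  basis of the tangent space. Summing over the standard basis inside \<open>D2\<close> recombines
  the coordinates of \<open>a e\<close>.\<close>

lemma ricci_trace:
  assumes u: "u \<in> U" and E: "ONB (range (J u)) E" and a: "\<And>e. e \<in> E \<Longrightarrow> J u (a e) = e"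
  shows "ricci g u y z = (\<Sum>e\<in>E. B u y z \<bullet> B u (a e) (a e) - B u (a e) z \<bullet> B u y (a e))"
proof -
  note lin = J_linear[OF u]
  let ?R = "\<lambda>x. riemann g u x y z"
  have R: "?R x = (\<Sum>e\<in>E. (J u (?R x) \<bullet> e) *\<^sub>R a e)" for x
  proof -
    have "J u (?R x) = (\<Sum>e\<in>E. (J u (?R x) \<bullet> e) *\<^sub>R e)" by (rule ONB_expansion[OF E]) simp
    also have "\<dots> = J u (\<Sum>e\<in>E. (J u (?R x) \<bullet> e) *\<^sub>R a e)"
      by (simp add: linear_sum[OF lin] linear_cmul[OF lin] a cong: sum.cong)
    finally show ?thesis using J_inj[OF u] by (simp add: inj_def)
  qed
  have "ricci g u y z = (\<Sum>i\<in>Basis. \<Sum>e\<in>E. (J u (?R i) \<bullet> e) * (a e \<bullet> i))"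
    unfolding ricci_def by (subst R) (simp add: inner_sum_left)
  also have "\<dots> = (\<Sum>e\<in>E. \<Sum>i\<in>Basis. (a e \<bullet> i) * (B u y z \<bullet> D2 u i (a e) - D2 u i z \<bullet> B u y (a e)))"
  proof (subst sum.swap, intro sum.cong refl)
    fix e i assume "e \<in> E"
    then show "(J u (?R i) \<bullet> e) * (a e \<bullet> i) = (a e \<bullet> i) * (B u y z \<bullet> D2 u i (a e) - D2 u i z \<bullet> B u y (a e))"
      using Gauss_equation[OF u, of i y z "a e"] a[of e] by (simp add: mult.commute)
  qed
  also have "\<dots> = (\<Sum>e\<in>E. B u y z \<bullet> B u (a e) (a e) - B u (a e) z \<bullet> B u y (a e))"
  proof (rule sum.cong[OF refl])
    fix e assume "e \<in> E"
    note D2a = linear_Basis_expansion[OF D2_linear[OF u], of "a e"]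
    have "(\<Sum>i\<in>Basis. (a e \<bullet> i) * (B u y z \<bullet> D2 u i (a e) - D2 u i z \<bullet> B u y (a e)))
      = B u y z \<bullet> D2 u (a e) (a e) - D2 u (a e) z \<bullet> B u y (a e)"
      unfolding D2a by (simp add: inner_sum_right inner_sum_left right_diff_distrib sum_subtractf)
    also have "\<dots> = B u y z \<bullet> B u (a e) (a e) - B u (a e) z \<bullet> B u y (a e)"
      using B_tangent[OF u, of y z] B_tangent[OF u, of y "a e"]
      unfolding B_def[of u "a e" "a e"] B_def[of u "a e" z]
      by (simp add: inner_diff_right inner_diff_left inner_commute[of "J u _"])
    finally show "(\<Sum>i\<in>Basis. (a e \<bullet> i) * (B u y z \<bullet> D2 u i (a e) - D2 u i z \<bullet> B u y (a e)))
      = B u y z \<bullet> B u (a e) (a e) - B u (a e) z \<bullet> B u y (a e)" .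
  qed
  finally show ?thesis .
qed

end

section \<open>Ricci curvature of the focal set\<close>

lemma (in muenzner_sextic) muenzner_focal_focal_plus:
  "q \<in> focal_plus F \<Longrightarrow> muenzner_focal F q"
  by unfold_locales (auto simp: focal_plus_def sphere_level_def norm_eq_1)

locale focal_chart = muenzner_focal F p + smooth_immersion \<phi> U
  for F :: "'a::euclidean_space \<Rightarrow> real" and p and \<phi> :: "'d::euclidean_space \<Rightarrow> 'a" and U +
  fixes u :: 'd
  assumes chart: "v \<in> U \<Longrightarrow> \<phi> v \<in> focal_plus F" and u: "u \<in> U" "\<phi> u = p" and dim_d: "DIM('d) = dim T"
begin

lemma G_chart: "v \<in> U \<Longrightarrow> G (\<phi> v) = 6 *\<^sub>R \<phi> v"
  using muenzner_focal.G_p[OF muenzner_focal_focal_plus[OF chart]] .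

lemma H_chart:
  assumes "v \<in> U"
  shows "H (\<phi> v) (J v x) = 6 *\<^sub>R J v x"
proof -
  have "((\<lambda>v. G (\<phi> v)) has_derivative (\<lambda>x. H (\<phi> v) (J v x))) (at v)"
    by (rule has_derivative_compose[OF \<phi>_deriv[OF assms] G_deriv])
  moreover have "((\<lambda>v. 6 *\<^sub>R \<phi> v) has_derivative (\<lambda>x. 6 *\<^sub>R J v x)) (at v)"
    by (rule has_derivative_scaleR_right[OF \<phi>_deriv[OF assms]])
  then have "((\<lambda>v. G (\<phi> v)) has_derivative (\<lambda>x. 6 *\<^sub>R J v x)) (at v)"
    by (rule has_derivative_transform_within_open[OF _ open_U assms]) (simp add: G_chart)
  ultimately show ?thesis by (rule has_derivative_unique_apply)
qed

text \<open>Tangent vectors of the chart have Hessian eigenvalue 6; injectivity and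
  \<open>dim_d\<close> give equality.\<close>

lemma range_J: "range (J u) = T"
proof (rule subspace_dim_equal)
  show "subspace (range (J u))" by (rule linear_subspace_image[OF J_linear[OF u(1)] subspace_UNIV])
  show "range (J u) \<subseteq> T" unfolding T_def using H_chart[OF u(1)] u(2) by auto
  have "dim (range (J u)) = dim (UNIV :: 'd set)"
    by (rule dim_image_eq[OF J_linear[OF u(1)]]) (use J_inj[OF u(1)] in simp)
  then show "dim T \<le> dim (range (J u))" using dim_d by simp
qed (rule subspace_T)

lemma J_T: "J u x \<in> T" using range_J by blast

text \<open>Derivative of the eigenvalue equation \<open>H_chart\<close> along the chart. Pairing it
  with \<open>p\<close> and with normals yields all components of the second fundamental
  form.\<close>

lemma D2_normal: "K p (J u x) (J u y) + H p (D2 u x y) = 6 *\<^sub>R D2 u x y"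
proof -
  have "((\<lambda>v. H (\<phi> v) (J v y)) has_derivative (\<lambda>x. K (\<phi> u) (J u x) (J u y) + H (\<phi> u) (D2 u x y))) (at u)"
    by (rule H_deriv_compose[OF \<phi>_deriv J_deriv]) (rule u)+
  moreover have "((\<lambda>v. 6 *\<^sub>R J v y) has_derivative (\<lambda>x. 6 *\<^sub>R D2 u x y)) (at u)"
    by (rule has_derivative_scaleR_right[OF J_deriv[OF u(1)]])
  then have "((\<lambda>v. H (\<phi> v) (J v y)) has_derivative (\<lambda>x. 6 *\<^sub>R D2 u x y)) (at u)"
    by (rule has_derivative_transform_within_open[OF _ open_U u(1)]) (simp add: H_chart)
  ultimately show ?thesis unfolding u(2) by (rule has_derivative_unique_apply)
qed

text \<open>The contribution of the unit sphere; in the Ricci formula it supplies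
  \<open>dim T - 1\<close>.\<close>

lemma B_p: "B u x y \<bullet> p = - (J u x \<bullet> J u y)"
proof -
  have "K p (J u x) (J u y) \<bullet> p + H p (D2 u x y) \<bullet> p = 6 * (D2 u x y \<bullet> p)"
    using arg_cong[OF D2_normal, of "\<lambda>v. v \<bullet> p" x y] by (simp add: inner_add_left)
  moreover have "K p (J u x) (J u y) \<bullet> p = 24 * (J u x \<bullet> J u y)"
    unfolding K_sym_inner[of p "J u x" "J u y"] K_sym[of p "J u x" p] Euler_H by (simp add: H_T[OF J_T])
  moreover have "H p (D2 u x y) \<bullet> p = 30 * (D2 u x y \<bullet> p)"
    unfolding H_sym[of p "D2 u x y"] H_p by (simp add: inner_commute)
  ultimately have "D2 u x y \<bullet> p = - (J u x \<bullet> J u y)" by simp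
  then show ?thesis unfolding B_def using T_p[OF J_T] by (simp add: inner_diff_left)
qed

lemma B_N:
  assumes w: "w \<in> N"
  shows "B u x y \<bullet> w = S w (J u x) \<bullet> J u y"
proof -
  have "K p (J u x) (J u y) \<bullet> w + H p (D2 u x y) \<bullet> w = 6 * (D2 u x y \<bullet> w)"
    using arg_cong[OF D2_normal, of "\<lambda>v. v \<bullet> w" x y] by (simp add: inner_add_left)
  moreover have "K p (J u x) (J u y) \<bullet> w = 36 * (S w (J u x) \<bullet> J u y)"
    unfolding K_sym_inner[of p "J u x" "J u y"] K_sym[of p "J u x" w] S_def by simp
  moreover have "H p (D2 u x y) \<bullet> w = - 30 * (D2 u x y \<bullet> w)"
    unfolding H_sym[of p "D2 u x y"] H_N[OF w] by (simp add: inner_commute)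
  ultimately have "D2 u x y \<bullet> w = S w (J u x) \<bullet> J u y" by simp
  then show ?thesis unfolding B_def using T_N[OF J_T w] by (simp add: inner_diff_left)
qed

lemma B_inner:
  assumes C: "ONB N C"
  shows "B u x y \<bullet> B u x' y' = (J u x \<bullet> J u y) * (J u x' \<bullet> J u y')
    + (\<Sum>c\<in>C. (S c (J u x) \<bullet> J u y) * (S c (J u x') \<bullet> J u y'))"
proof -
  obtain E where E: "ONB T E" using ONB_exists[OF subspace_T] .
  have "B u x y \<bullet> e = 0" if e: "e \<in> E" for e
  proof -
    have "e \<in> range (J u)" using ONB_mem[OF E e] range_J by simp
    then show ?thesis using B_tangent[OF u(1)] by auto
  qed
  moreover have "(\<Sum>c\<in>C. (B u x y \<bullet> c) * (c \<bullet> B u x' y')) = (\<Sum>c\<in>C. (S c (J u x) \<bullet> J u y) * (S c (J u x') \<bullet> J u y'))"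
    by (rule sum.cong) (simp_all add: B_N ONB_mem[OF C] inner_commute[of _ "B u x' y'"])
  ultimately show ?thesis
    using ONB_inner_expansion[OF adapted_basis(1)[OF E C], of "B u x y" "B u x' y'"]
    unfolding adapted_basis(2)[OF E C] by (simp add: B_p inner_commute[of p])
qed

theorem ricci_focal:
  assumes C: "ONB N C"
  shows "ricci g u y y = (real (dim T) - 1) * (J u y \<bullet> J u y) - (\<Sum>c\<in>C. S c (J u y) \<bullet> S c (J u y))"
proof -
  define Y where "Y = J u y"
  have YT: "Y \<in> T" unfolding Y_def by (rule J_T)
  obtain E where E: "ONB T E" using ONB_exists[OF subspace_T] .
  have "\<forall>e\<in>E. \<exists>y. J u y = e"
    using ONB_mem[OF E] unfolding range_J[symmetric] by (metis imageE)
  then obtain a where a: "\<And>e. e \<in> E \<Longrightarrow> J u (a e) = e" by metis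
  have "ricci g u y y = (\<Sum>e\<in>E. B u y y \<bullet> B u (a e) (a e) - B u (a e) y \<bullet> B u y (a e))"
    by (rule ricci_trace[OF u(1)]) (use E range_J a in auto)
  also have "\<dots> = (\<Sum>e\<in>E. (Y \<bullet> Y) + (\<Sum>c\<in>C. (S c Y \<bullet> Y) * (S c e \<bullet> e)) - (Y \<bullet> e)\<^sup>2 - (\<Sum>c\<in>C. (S c Y \<bullet> e)\<^sup>2))"
  proof (rule sum.cong[OF refl])
    fix e assume e: "e \<in> E"
    have "S c e \<bullet> Y = S c Y \<bullet> e" for c by (rule S_sym)
    then show "B u y y \<bullet> B u (a e) (a e) - B u (a e) y \<bullet> B u y (a e)
      = (Y \<bullet> Y) + (\<Sum>c\<in>C. (S c Y \<bullet> Y) * (S c e \<bullet> e)) - (Y \<bullet> e)\<^sup>2 - (\<Sum>c\<in>C. (S c Y \<bullet> e)\<^sup>2)"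
      unfolding B_inner[OF C] a[OF e] Y_def[symmetric]
      using ONB_inner[OF E e e] by (simp add: power2_eq_square inner_commute[of e Y])
  qed
  also have "\<dots> = card E * (Y \<bullet> Y) + (\<Sum>c\<in>C. (S c Y \<bullet> Y) * (\<Sum>e\<in>E. S c e \<bullet> e)) - (\<Sum>e\<in>E. (Y \<bullet> e)\<^sup>2)
    - (\<Sum>c\<in>C. \<Sum>e\<in>E. (S c Y \<bullet> e)\<^sup>2)"
    by (simp add: sum.distrib sum_subtractf sum_distrib_left sum.swap[of _ C E])
  \<comment> \<open>Minimality of the focal set: the mean curvature term of the Gauss equation drops
    out.\<close>
  also have "(\<Sum>c\<in>C. (S c Y \<bullet> Y) * (\<Sum>e\<in>E. S c e \<bullet> e)) = 0"
    using shape_trace[OF _ E] ONB_mem[OF C] by simp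
  also have "(\<Sum>e\<in>E. (Y \<bullet> e)\<^sup>2) = Y \<bullet> Y"
    using ONB_Parseval[OF E YT] ..
  also have "(\<Sum>c\<in>C. \<Sum>e\<in>E. (S c Y \<bullet> e)\<^sup>2) = (\<Sum>c\<in>C. S c Y \<bullet> S c Y)"
    by (rule sum.cong) (use ONB_Parseval[OF E S_T[OF _ YT]] ONB_mem[OF C] in auto)
  finally show ?thesis
    unfolding Y_def[symmetric] using ONB_card[OF E] by (simp add: algebra_simps)
qed

end

section \<open>Smooth inverse charts of polynomial maps\<close>

lemma frechet_derivative_cong_open:
  assumes "open U" "u \<in> U" "\<And>v. v \<in> U \<Longrightarrow> f v = g v"
  shows "frechet_derivative f (at u) = frechet_derivative g (at u)"
proof -
  have "(f has_derivative D) (at u) \<longleftrightarrow> (g has_derivative D) (at u)" for D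
    using has_derivative_transform_within_open[OF _ assms(1,2)] assms(3) by metis
  then show ?thesis unfolding frechet_derivative_def by simp
qed

lemma Ck_on_cong:
  assumes "open U" "\<And>v. v \<in> U \<Longrightarrow> f v = g v"
  shows "Ck_on k f U \<longleftrightarrow> Ck_on k g U"
  using assms(2)
proof (induction k arbitrary: f g)
  case 0
  then show ?case by (simp cong: continuous_on_cong)
next
  case (Suc k)
  have "f differentiable_on U \<longleftrightarrow> g differentiable_on U"
    using Suc.prems differentiable_transform_within[of _ _ U 1]
    unfolding differentiable_on_def by (metis zero_less_one)
  moreover have "Ck_on k (\<lambda>x. frechet_derivative f (at x) v) U \<longleftrightarrow> Ck_on k (\<lambda>x. frechet_derivative g (at x) v) U" for v
    by (rule Suc.IH) (use frechet_derivative_cong_open[OF assms(1)] Suc.prems in metis)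
  ultimately show ?case by simp
qed

lemma Ck_on_componentwise:
  fixes f :: "'d::euclidean_space \<Rightarrow> 'a::euclidean_space"
  assumes "open U" "\<And>b. b \<in> Basis \<Longrightarrow> Ck_on k (\<lambda>x. f x \<bullet> b) U"
  shows "Ck_on k f U"
  using assms(2)
proof (induction k arbitrary: f)
  case 0
  then show ?case by (simp add: continuous_on_componentwise[of U f])
next
  case (Suc k)
  have diff: "f differentiable_on U"
    using Suc.prems by (simp add: differentiable_on_def differentiable_componentwise_within[of f])
  moreover have "Ck_on k (\<lambda>x. frechet_derivative f (at x) v) U" for v
  proof (rule Suc.IH)
    fix b :: 'a assume b: "b \<in> Basis"
    have "frechet_derivative (\<lambda>x. f x \<bullet> b) (at x) v = frechet_derivative f (at x) v \<bullet> b" if "x \<in> U" for x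
    proof (rule frechet_derivative_eqI)
      have "f differentiable at x" using diff that assms(1) by (simp add: differentiable_on_eq_differentiable_at)
      then show "((\<lambda>x. f x \<bullet> b) has_derivative (\<lambda>v. frechet_derivative f (at x) v \<bullet> b)) (at x)"
        by (intro has_derivative_inner_left) (simp add: frechet_derivative_works)
    qed
    moreover have "Ck_on k (\<lambda>x. frechet_derivative (\<lambda>x. f x \<bullet> b) (at x) v) U"
      using Suc.prems[OF b] by simp
    ultimately show "Ck_on k (\<lambda>x. frechet_derivative f (at x) v \<bullet> b) U"
      using Ck_on_cong[OF assms(1), where f = "\<lambda>x. frechet_derivative (\<lambda>x. f x \<bullet> b) (at x) v"
        and g = "\<lambda>x. frechet_derivative f (at x) v \<bullet> b"] by blast
  qed
  ultimately show ?case by simp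
qed

text \<open>Induction on \<open>k\<close>: a class of differentiable functions that contains all its
  directional derivatives consists of smooth functions.\<close>

lemma Ck_on_closed_family:
  assumes "open U"
    and closed: "\<And>f. P f \<Longrightarrow> \<exists>D. (\<forall>u\<in>U. (f has_derivative D u) (at u)) \<and> (\<forall>v. P (\<lambda>u. D u v))"
    and "P f"
  shows "Ck_on k f U"
  using assms(3)
proof (induction k arbitrary: f)
  case 0
  then obtain D where "\<forall>u\<in>U. (f has_derivative D u) (at u)" using closed by blast
  then show ?case
    by (auto intro!: continuous_at_imp_continuous_on has_derivative_continuous)
next
  case (Suc k)
  then obtain D where D: "\<forall>u\<in>U. (f has_derivative D u) (at u)" "\<forall>v. P (\<lambda>u. D u v)" using closed by blast
  have "f differentiable_on U"
    using D(1) assms(1) by (auto simp: differentiable_on_eq_differentiable_at differentiable_def)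
  moreover have "Ck_on k (\<lambda>x. frechet_derivative f (at x) v) U" for v
    using Suc.IH[of "\<lambda>u. D u v"] D(2) Ck_on_cong[OF assms(1), of "\<lambda>x. frechet_derivative f (at x) v" "\<lambda>u. D u v"]
      frechet_derivative_eqI D(1) by metis
  ultimately show ?case by simp
qed

text \<open>Differentiating \<open>A (\<phi> u) (M u a) = a\<close>, where \<open>M u\<close> is the inverse of \<open>A (\<phi> u)\<close>, shows that this algebra
  of functions is closed under partial derivatives.\<close>

inductive chart_algebra ::
    "('d \<Rightarrow> 'a::euclidean_space) \<Rightarrow> ('d \<Rightarrow> 'a \<Rightarrow> 'a) \<Rightarrow> ('d \<Rightarrow> real) \<Rightarrow> bool" for \<phi> M where
  poly: "real_polynomial_function P \<Longrightarrow> chart_algebra \<phi> M (\<lambda>u. P (\<phi> u))"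
| entry: "chart_algebra \<phi> M (\<lambda>u. M u a \<bullet> b)"
| plus: "chart_algebra \<phi> M f \<Longrightarrow> chart_algebra \<phi> M h \<Longrightarrow> chart_algebra \<phi> M (\<lambda>u. f u + h u)"
| times: "chart_algebra \<phi> M f \<Longrightarrow> chart_algebra \<phi> M h \<Longrightarrow> chart_algebra \<phi> M (\<lambda>u. f u * h u)"

lemma chart_algebra_const: "chart_algebra \<phi> M (\<lambda>u. c)"
  using chart_algebra.poly[of "\<lambda>_. c"] by (simp add: real_polynomial_function.intros)

lemma chart_algebra_minus: "chart_algebra \<phi> M f \<Longrightarrow> chart_algebra \<phi> M (\<lambda>u. - f u)"
  using chart_algebra.times[OF chart_algebra_const[of _ _ "- 1"]] by fastforce

lemma chart_algebra_sum:
  "finite I \<Longrightarrow> (\<And>i. i \<in> I \<Longrightarrow> chart_algebra \<phi> M (f i)) \<Longrightarrow> chart_algebra \<phi> M (\<lambda>u. \<Sum>i\<in>I. f i u)"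
  by (induction I rule: finite_induct) (auto intro: chart_algebra_const chart_algebra.plus)

text \<open>Meant for a local inverse of \<open>\<Psi>\<close> composed with a linear map
  \<open>L\<close>; the last assumption is the chain rule for that composition.\<close>

locale polynomial_inverse_chart =
  fixes \<Psi> :: "'a::euclidean_space \<Rightarrow> 'a" and \<phi> :: "'d::euclidean_space \<Rightarrow> 'a" and L :: "'d \<Rightarrow> 'a" and U
  assumes \<Psi>: "polynomial_function \<Psi>" and U: "open U"
    and bij: "u \<in> U \<Longrightarrow> bij (frechet_derivative \<Psi> (at (\<phi> u)))"
    and \<phi>: "u \<in> U \<Longrightarrow> (\<phi> has_derivative (\<lambda>v. inv (frechet_derivative \<Psi> (at (\<phi> u))) (L v))) (at u)"
begin

definition A where "A x = frechet_derivative \<Psi> (at x)"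
definition dA where "dA x h j = frechet_derivative (\<lambda>x. A x j) (at x) h"
definition M where "M u = inv (A (\<phi> u))"

lemma A_linear: "linear (A x)"
  unfolding A_def by (rule has_derivative_linear[OF polynomial_function_has_frechet_derivative[OF \<Psi>]])

lemma A_poly: "polynomial_function (\<lambda>x. A x j)"
  unfolding A_def by (rule polynomial_function_frechet_derivative[OF \<Psi>])

lemma A_deriv: "((\<lambda>x. A x j) has_derivative (\<lambda>h. dA x h j)) (at x)"
  unfolding dA_def by (rule polynomial_function_has_frechet_derivative[OF A_poly])

lemma dA_poly: "polynomial_function (\<lambda>x. dA x h j)"
  unfolding dA_def by (rule polynomial_function_frechet_derivative[OF A_poly])

lemma dA_linear: "linear (\<lambda>h. dA x h j)" by (rule has_derivative_linear[OF A_deriv])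

lemma A_M: "u \<in> U \<Longrightarrow> A (\<phi> u) (M u a) = a"
  unfolding M_def using bij A_def by (metis bij_inv_eq_iff)

lemma M_A: "u \<in> U \<Longrightarrow> M u (A (\<phi> u) a) = a"
  unfolding M_def using bij A_def by (metis bij_inv_eq_iff)

lemma M_linear: "u \<in> U \<Longrightarrow> linear (M u)"
  by (rule linearI) (metis A_M M_A linear_add[OF A_linear], metis A_M M_A linear_cmul[OF A_linear])

lemma \<phi>_deriv: "u \<in> U \<Longrightarrow> (\<phi> has_derivative (\<lambda>v. M u (L v))) (at u)"
  using \<phi> unfolding M_def A_def .

lemma chart_algebra_poly_inner:
  fixes p :: "'a \<Rightarrow> 'b::euclidean_space"
  shows "polynomial_function p \<Longrightarrow> chart_algebra \<phi> M (\<lambda>u. p (\<phi> u) \<bullet> b)"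
  using chart_algebra.poly[of "\<lambda>x. p x \<bullet> b"] polynomial_function_inner[of p b]
  by (simp add: real_polynomial_function_eq)

text \<open>This is \<open>- M u (dA (\<phi> u) (M u (L v)) (M u a)) \<bullet> b\<close> in
  coordinates, a form in which membership in \<open>chart_algebra\<close> is visible.\<close>

definition entry_derivative where
  "entry_derivative a b u v = - (\<Sum>i\<in>Basis. \<Sum>j\<in>Basis. \<Sum>l\<in>Basis.
    (M u a \<bullet> j) * (M u (L v) \<bullet> l) * (dA (\<phi> u) l j \<bullet> i) * (M u i \<bullet> b))"

lemma entry_deriv:
  assumes u: "u \<in> U"
  shows "((\<lambda>u. M u a \<bullet> b) has_derivative (\<lambda>v. entry_derivative a b u v)) (at u)"
proof -
  define w where "w u = M u a" for u
  have A\<phi>: "((\<lambda>v. A (\<phi> v) j) has_derivative (\<lambda>v. dA (\<phi> u) (M u (L v)) j)) (at u)" for j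
    by (rule has_derivative_compose[OF \<phi>_deriv[OF u] A_deriv])
  have "w differentiable at u"
  proof (rule linear_solution_differentiable[OF U u, where A = "\<lambda>v. A (\<phi> v)" and b = "\<lambda>_. a"])
    show "(\<lambda>v. A (\<phi> v) e) differentiable at u" for e using A\<phi> unfolding differentiable_def by blast
    show "inj (A (\<phi> u))" using bij[OF u] unfolding A_def by (simp add: bij_is_inj)
  qed (auto simp: w_def A_M A_linear)
  then obtain w' where w': "(w has_derivative w') (at u)" unfolding differentiable_def by blast
  have "((\<lambda>z. \<Sum>j\<in>Basis. (w z \<bullet> j) *\<^sub>R A (\<phi> z) j) has_derivative
      (\<lambda>v. \<Sum>j\<in>Basis. (w u \<bullet> j) *\<^sub>R dA (\<phi> u) (M u (L v)) j + (w' v \<bullet> j) *\<^sub>R A (\<phi> u) j)) (at u)"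
    by (intro has_derivative_sum has_derivative_scaleR has_derivative_inner_left w' A\<phi>)
  then have "((\<lambda>z. a) has_derivative
      (\<lambda>v. \<Sum>j\<in>Basis. (w u \<bullet> j) *\<^sub>R dA (\<phi> u) (M u (L v)) j + (w' v \<bullet> j) *\<^sub>R A (\<phi> u) j)) (at u)"
    by (rule has_derivative_transform_within_open[OF _ U u])
      (simp add: linear_Basis_expansion[OF A_linear, symmetric] w_def A_M)
  from has_derivative_unique_apply[OF this has_derivative_const]
  have 0: "(\<Sum>j\<in>Basis. (w u \<bullet> j) *\<^sub>R dA (\<phi> u) (M u (L v)) j) + A (\<phi> u) (w' v) = 0" for v
    by (simp add: sum.distrib linear_Basis_expansion[OF A_linear, symmetric])
  have "w' v \<bullet> b = entry_derivative a b u v" for v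
  proof -
    define c where "c = (\<Sum>j\<in>Basis. (w u \<bullet> j) *\<^sub>R dA (\<phi> u) (M u (L v)) j)"
    have "A (\<phi> u) (w' v) = - c" using 0[of v] unfolding c_def by (simp add: eq_neg_iff_add_eq_0 add.commute)
    then have "w' v = M u (- c)" using M_A[OF u] by metis
    then have *: "w' v \<bullet> b = - (\<Sum>i\<in>Basis. (c \<bullet> i) * (M u i \<bullet> b))"
      using linear_Basis_expansion[OF M_linear[OF u], of c]
      by (simp add: linear_neg[OF M_linear[OF u]] inner_sum_left)
    have "c \<bullet> i = (\<Sum>j\<in>Basis. \<Sum>l\<in>Basis. (M u a \<bullet> j) * (M u (L v) \<bullet> l) * (dA (\<phi> u) l j \<bullet> i))" for i
      unfolding c_def w_def
      by (subst linear_Basis_expansion[OF dA_linear])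
        (simp add: inner_sum_left sum_distrib_left mult.assoc)
    then show ?thesis unfolding * entry_derivative_def by (simp add: sum_distrib_right)
  qed
  moreover have "((\<lambda>u. w u \<bullet> b) has_derivative (\<lambda>v. w' v \<bullet> b)) (at u)" by (rule has_derivative_inner_left[OF w'])
  ultimately show ?thesis unfolding w_def by simp
qed

lemma chart_algebra_deriv:
  "chart_algebra \<phi> M f \<Longrightarrow> \<exists>D. (\<forall>u\<in>U. (f has_derivative D u) (at u)) \<and> (\<forall>v. chart_algebra \<phi> M (\<lambda>u. D u v))"
proof (induction rule: chart_algebra.induct)
  case (poly P)
  have P: "(P has_derivative frechet_derivative P (at x)) (at x)" for x
    using differentiable_at_real_polynomial_function[OF poly] frechet_derivative_works by blast
  have "((\<lambda>u. P (\<phi> u)) has_derivative (\<lambda>v. frechet_derivative P (at (\<phi> u)) (M u (L v)))) (at u)" if "u \<in> U" for u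
    by (rule has_derivative_compose[OF \<phi>_deriv[OF that] P])
  moreover have "chart_algebra \<phi> M (\<lambda>u. frechet_derivative P (at (\<phi> u)) (M u (L v)))" for v
  proof -
    have "frechet_derivative P (at (\<phi> u)) (M u (L v))
      = (\<Sum>b\<in>Basis. (M u (L v) \<bullet> b) * frechet_derivative P (at (\<phi> u)) b)" for u
      by (rule linear_Basis_expansion[OF has_derivative_linear[OF P], THEN trans]) simp
    then show ?thesis
      by (simp only:) (intro chart_algebra_sum finite_Basis chart_algebra.times chart_algebra.entry chart_algebra.poly
        real_polynomial_function_frechet_derivative poly)
  qed
  ultimately show ?case
    by (intro exI[of _ "\<lambda>u v. frechet_derivative P (at (\<phi> u)) (M u (L v))"] conjI ballI allI)
next
  case (entry a b)
  have "chart_algebra \<phi> M (\<lambda>u. entry_derivative a b u v)" for v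
    unfolding entry_derivative_def
    by (intro chart_algebra_minus chart_algebra_sum finite_Basis chart_algebra.times chart_algebra.entry
      chart_algebra_poly_inner dA_poly)
  then show ?case
    by (intro exI[of _ "\<lambda>u v. entry_derivative a b u v"] conjI ballI allI entry_deriv)
next
  case (plus f h)
  then obtain D D' where D: "\<forall>u\<in>U. (f has_derivative D u) (at u)" "\<forall>v. chart_algebra \<phi> M (\<lambda>u. D u v)"
    "\<forall>u\<in>U. (h has_derivative D' u) (at u)" "\<forall>v. chart_algebra \<phi> M (\<lambda>u. D' u v)" by blast
  show ?case
    by (rule exI[of _ "\<lambda>u v. D u v + D' u v"])
      (use D in \<open>auto intro!: has_derivative_add chart_algebra.plus\<close>)
next
  case (times f h)
  then obtain D D' where D: "\<forall>u\<in>U. (f has_derivative D u) (at u)" "\<forall>v. chart_algebra \<phi> M (\<lambda>u. D u v)"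
    "\<forall>u\<in>U. (h has_derivative D' u) (at u)" "\<forall>v. chart_algebra \<phi> M (\<lambda>u. D' u v)" by blast
  show ?case
    by (rule exI[of _ "\<lambda>u v. f u * D' u v + D u v * h u"])
      (use D times in \<open>auto intro!: has_derivative_mult chart_algebra.plus chart_algebra.times\<close>)
qed

theorem smooth_chart: "smooth_on U \<phi>"
  unfolding smooth_on_def
proof (intro conjI allI)
  fix k
  have "Ck_on k (\<lambda>u. \<phi> u \<bullet> b) U" for b
    by (rule Ck_on_closed_family[OF U, where P = "chart_algebra \<phi> M"])
      (use chart_algebra_deriv chart_algebra_poly_inner[OF polynomial_function_id] in auto)
  then show "Ck_on k \<phi> U" by (rule Ck_on_componentwise[OF U])
qed (rule U)

end

section \<open>Local parametrizations of the focal set\<close>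

context muenzner_focal
begin

lemma tan_part_linear: "linear tan_part"
  unfolding tan_part_def by (rule linearI) (simp_all add: H_simps inner_add_left algebra_simps)

lemma nor_part_linear: "linear nor_part"
  unfolding nor_part_def by (rule linearI) (simp_all add: H_simps inner_add_left algebra_simps)

lemma nor_part_p: "nor_part p = 0"
  unfolding nor_part_def by (simp add: p_unit H_simps)

lemma nor_part_N_eq: "n \<in> N \<Longrightarrow> nor_part n = n"
  unfolding nor_part_def by (rule inner_eqI) (simp add: N_p H_N inner_diff_left inner_add_left)

lemma H_p_split: "H p v = (30 * (v \<bullet> p)) *\<^sub>R p + 6 *\<^sub>R tan_part v - 30 *\<^sub>R nor_part v"
  by (subst split) (simp add: H_simps H_p H_T[OF tan_part_T] H_N[OF nor_part_N])

lemma p_part: "tan_part v \<bullet> p = 0" "nor_part v \<bullet> p = 0" "p \<bullet> tan_part v = 0" "p \<bullet> nor_part v = 0"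
    "tan_part v \<bullet> nor_part w = 0" "nor_part w \<bullet> tan_part v = 0"
  using T_p[OF tan_part_T[of v]] N_p[OF nor_part_N[of v]] T_N[OF tan_part_T[of v] nor_part_N[of w]]
  by (simp_all add: inner_commute)

text \<open>Its three parts are a tangential coordinate, the normal part of the focal equation
  \<open>G x = 6 x\<close>, and the sphere equation along \<open>p\<close>. Near \<open>p\<close>
  the focal set is the preimage of \<open>T\<close>.\<close>

definition straighten where
  "straighten x = tan_part x + nor_part (G x - 6 *\<^sub>R x) + ((x \<bullet> x - 1) / 2) *\<^sub>R p"

definition A where "A x h = tan_part h + nor_part (H x h - 6 *\<^sub>R h) + (x \<bullet> h) *\<^sub>R p"

lemma straighten_deriv: "(straighten has_derivative A x) (at x)"
proof -
  have "(tan_part has_derivative tan_part) (at x)"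
    by (rule bounded_linear_imp_has_derivative) (use tan_part_linear linear_conv_bounded_linear in blast)
  moreover have "((\<lambda>x. nor_part (G x - 6 *\<^sub>R x)) has_derivative (\<lambda>h. nor_part (H x h - 6 *\<^sub>R h))) (at x)"
    by (rule bounded_linear.has_derivative)
      (use nor_part_linear linear_conv_bounded_linear in \<open>auto intro!: derivative_eq_intros G_deriv\<close>)
  moreover have "((\<lambda>x. ((x \<bullet> x - 1) / 2) *\<^sub>R p) has_derivative (\<lambda>h. (x \<bullet> h) *\<^sub>R p)) (at x)"
    by (auto intro!: derivative_eq_intros simp: inner_commute)
  ultimately have "((\<lambda>x. tan_part x + nor_part (G x - 6 *\<^sub>R x) + ((x \<bullet> x - 1) / 2) *\<^sub>R p) has_derivative
      (\<lambda>h. tan_part h + nor_part (H x h - 6 *\<^sub>R h) + (x \<bullet> h) *\<^sub>R p)) (at x)"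
    by (intro has_derivative_add)
  then show ?thesis unfolding straighten_def[abs_def] A_def[abs_def] .
qed

lemma straighten_poly: "polynomial_function straighten"
proof -
  have "polynomial_function tan_part"
    by (rule polynomial_function_bounded_linear) (use tan_part_linear linear_conv_bounded_linear in blast)
  moreover have nor: "polynomial_function nor_part"
    by (rule polynomial_function_bounded_linear) (use nor_part_linear linear_conv_bounded_linear in blast)
  have "polynomial_function (nor_part \<circ> (\<lambda>x. G x - 6 *\<^sub>R x))"
    by (rule polynomial_function_compose[OF _ nor])
      (intro polynomial_function_diff G_poly polynomial_function_cmul polynomial_function_id)
  moreover have "polynomial_function (\<lambda>x::'a. x \<bullet> x)"
  proof -
    have "polynomial_function (\<lambda>x::'a. (x \<bullet> b) * (x \<bullet> b))" for b
      using polynomial_function_mult[of "\<lambda>x. x \<bullet> b" "\<lambda>x. x \<bullet> b"]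
        polynomial_function_inner[OF polynomial_function_id, of b] by simp
    then have "polynomial_function (\<lambda>x::'a. \<Sum>b\<in>Basis. (x \<bullet> b) * (x \<bullet> b))"
      by (intro polynomial_function_sum) auto
    then show ?thesis by (simp add: euclidean_inner[symmetric])
  qed
  then have "polynomial_function (\<lambda>x::'a. x \<bullet> x - 1)"
    by (rule polynomial_function_diff) (rule polynomial_function_const)
  then have "polynomial_function (\<lambda>x::'a. (1/2) * (x \<bullet> x - 1))"
    using polynomial_function_mult[OF polynomial_function_const, of "\<lambda>x. x \<bullet> x - 1" "1/2"] by simp
  then have "polynomial_function (\<lambda>x::'a. ((x \<bullet> x - 1) / 2) *\<^sub>R p)"
    by (intro polynomial_function_mult polynomial_function_const) simp
  ultimately show ?thesis
    unfolding straighten_def[abs_def] o_def by (intro polynomial_function_add)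
qed

lemma A_eq: "A x = frechet_derivative straighten (at x)"
  by (rule frechet_derivative_at[OF straighten_deriv])

lemma A_linear: "linear (A x)" by (rule has_derivative_linear[OF straighten_deriv])

text \<open>The derivative at \<open>p\<close> is the identity on \<open>T\<close> and on the line
  of \<open>p\<close>, and multiplication by -36 on \<open>N\<close>.\<close>

lemma A_p_inj: "inj (A p)"
proof (rule linear_injective_0[THEN iffD2, OF A_linear], intro allI impI)
  fix h assume 0: "A p h = 0"
  have "H p h - 6 *\<^sub>R h = (24 * (h \<bullet> p)) *\<^sub>R p - 36 *\<^sub>R nor_part h"
    unfolding H_p_split by (subst (3) split[of h], rule inner_eqI) (simp add: inner_add_left inner_diff_left)
  then have "nor_part (H p h - 6 *\<^sub>R h) = - 36 *\<^sub>R nor_part h"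
    by (simp add: linear_diff[OF nor_part_linear] linear_cmul[OF nor_part_linear] nor_part_p nor_part_N_eq[OF nor_part_N])
  then have eq: "tan_part h - 36 *\<^sub>R nor_part h + (h \<bullet> p) *\<^sub>R p = 0"
    using 0 unfolding A_def by (simp add: inner_commute)
  have "tan_part h \<bullet> tan_part h = 0" "nor_part h \<bullet> nor_part h = 0" "h \<bullet> p = 0"
    using arg_cong[OF eq, of "\<lambda>v. v \<bullet> tan_part h"] arg_cong[OF eq, of "\<lambda>v. v \<bullet> nor_part h"]
      arg_cong[OF eq, of "\<lambda>v. v \<bullet> p"]
    by (simp_all add: inner_add_left inner_diff_left p_part p_unit)
  then show "h = 0" using split[of h] by simp
qed

lemma straighten_focal: "x \<in> focal_plus F \<Longrightarrow> straighten x \<in> T"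
  using muenzner_focal.G_p[OF muenzner_focal_focal_plus, of x]
  by (simp add: straighten_def focal_plus_def sphere_level_def norm_eq_1 tan_part_T linear_0[OF nor_part_linear])

text \<open>On the unit sphere \<open>q = G x - 6 *\<^sub>R x\<close> is an eigenvector of \<open>H x - 6\<close> for the eigenvalue \<open>-36\<close>, whereas
  \<open>H p - 6\<close> is non-negative on the complement of the normal space; so \<open>q\<close> vanishes near \<open>p\<close>.\<close>

lemma focal_if_straighten:
  assumes x: "straighten x \<in> T" and near: "(\<Sum>b\<in>Basis. norm (H x b - H p b)) < 36"
  shows "x \<in> focal_plus F"
proof -
  define q where "q = G x - 6 *\<^sub>R x"
  define z where "z = nor_part q + ((x \<bullet> x - 1) / 2) *\<^sub>R p"
  have "z = straighten x - tan_part x" unfolding z_def q_def straighten_def by simp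
  \<comment> \<open>\<open>z\<close> lies in \<open>T\<close> and is built from \<open>N\<close> and
    \<open>p\<close>, so it vanishes; this splits into the sphere equation and
    \<open>nor_part q = 0\<close>.\<close>
  then have zT: "z \<in> T" using x tan_part_T subspace_T by (simp add: subspace_diff)
  have "z \<bullet> z = 0"
    using T_N[OF zT nor_part_N[of q]] T_p[OF zT] by (subst (2) z_def) (simp add: inner_add_right)
  then have z: "nor_part q + ((x \<bullet> x - 1) / 2) *\<^sub>R p = 0" unfolding z_def by simp
  have xx: "x \<bullet> x = 1" using arg_cong[OF z, of "\<lambda>v. v \<bullet> p"] by (simp add: inner_add_left p_part p_unit)
  then have nor: "nor_part q = 0" using z by simp
  have Hq: "H x q = 180 *\<^sub>R x - 30 *\<^sub>R G x"
    unfolding q_def by (simp add: H_simps H_G xx Euler_G)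
  have "H x q - 6 *\<^sub>R q = - 36 *\<^sub>R q"
    unfolding Hq by (rule inner_eqI) (simp add: q_def inner_diff_left)
  then have "(H x q - 6 *\<^sub>R q) \<bullet> q = - 36 * (q \<bullet> q)" by simp
  moreover have "(H p q - 6 *\<^sub>R q) \<bullet> q = 24 * (q \<bullet> p)\<^sup>2"
  proof -
    have "H p q - 6 *\<^sub>R q = (24 * (q \<bullet> p)) *\<^sub>R p"
    proof (rule inner_eqI)
      fix c
      have "q = (q \<bullet> p) *\<^sub>R p + tan_part q" using split[of q] nor by simp
      from arg_cong[OF this, of "\<lambda>v. v \<bullet> c"]
      show "(H p q - 6 *\<^sub>R q) \<bullet> c = (24 * (q \<bullet> p)) *\<^sub>R p \<bullet> c"
        by (simp add: H_p_split nor inner_add_left inner_diff_left)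
    qed
    then show ?thesis by (simp add: inner_commute[of p] power2_eq_square)
  qed
  ultimately have eq: "- 36 * (q \<bullet> q) = 24 * (q \<bullet> p)\<^sup>2 + (H x q - H p q) \<bullet> q"
    by (simp add: inner_diff_left)
  define \<epsilon> where "\<epsilon> = (\<Sum>b\<in>Basis. norm (H x b - H p b))"
  have "norm (H x q - H p q) \<le> \<epsilon> * norm q"
  proof -
    have "H x q - H p q = (\<Sum>b\<in>Basis. (q \<bullet> b) *\<^sub>R (H x b - H p b))"
      using H_expand[of x q] H_expand[of p q] by (simp add: scaleR_diff_right sum_subtractf)
    also have "norm \<dots> \<le> (\<Sum>b\<in>Basis. norm ((q \<bullet> b) *\<^sub>R (H x b - H p b)))" by (rule norm_sum)
    also have "\<dots> \<le> (\<Sum>b\<in>Basis. norm (H x b - H p b) * norm q)"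
      by (rule sum_mono) (simp add: mult.commute[of "norm (_ - _)"] mult_right_mono Basis_le_norm)
    finally show ?thesis unfolding \<epsilon>_def by (simp add: sum_distrib_right)
  qed
  then have "norm (H x q - H p q) * norm q \<le> \<epsilon> * norm q * norm q" by (rule mult_right_mono) simp
  moreover have "- ((H x q - H p q) \<bullet> q) \<le> norm (H x q - H p q) * norm q"
    using norm_cauchy_schwarz[of "- (H x q - H p q)" q] by (simp only: norm_minus_cancel inner_minus_left)
  moreover have "norm q * norm q = q \<bullet> q" by (simp add: dot_square_norm power2_eq_square)
  ultimately have "36 * (q \<bullet> q) \<le> \<epsilon> * (q \<bullet> q)"
    using eq by (simp add: mult.assoc) (smt (verit) zero_le_power2)
  then have "(36 - \<epsilon>) * (q \<bullet> q) \<le> 0" by (simp add: algebra_simps)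
  moreover have "36 - \<epsilon> > 0" using near unfolding \<epsilon>_def by simp
  ultimately have "q \<bullet> q \<le> 0" by (simp add: mult_le_0_iff)
  then have "G x = 6 *\<^sub>R x" unfolding q_def by (metis inner_eq_zero_iff inner_ge_zero order_antisym eq_iff_diff_eq_0)
  then have "F x = 1" using Euler_F[of x] xx by simp
  then show ?thesis using xx by (simp add: focal_plus_def sphere_level_def norm_eq_1)
qed

text \<open>The chart is \<open>d \<mapsto> h (L d)\<close>, with \<open>h\<close> the local inverse
  of \<open>straighten\<close> and \<open>L\<close> an isomorphism onto \<open>T\<close>; its
  inverse is \<open>L' (straighten x)\<close>.\<close>

theorem focal_parametrization:
  assumes dim: "DIM('d::euclidean_space) = dim T"
  shows "\<exists>(\<phi> :: 'd \<Rightarrow> 'a) U. local_parametrization \<phi> U (focal_plus F) \<and> p \<in> \<phi> ` U"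
proof -
  have bl: "bounded_linear (A x)" for x using A_linear linear_conv_bounded_linear by blast
  obtain B where B: "linear B" "\<And>h. B (A p h) = h"
    using linear_injective_left_inverse[OF A_linear A_p_inj] by (metis comp_apply id_apply)
  have Bbl: "bounded_linear B" using B(1) linear_conv_bounded_linear by blast
  obtain U' V h h' where U': "open U'" "p \<in> U'" and V: "open V" "straighten p \<in> V"
    and hom: "homeomorphism U' V straighten h"
    and h': "\<And>y. y \<in> V \<Longrightarrow> (h has_derivative (h' y)) (at y)"
      "\<And>y. y \<in> V \<Longrightarrow> h' y = inv (A (h y))" "\<And>y. y \<in> V \<Longrightarrow> bij (A (h y))"
  proof (rule inverse_function_theorem[of UNIV straighten "\<lambda>x. Blinfun (A x)" p "Blinfun B"])
    show "(straighten has_derivative blinfun_apply (Blinfun (A x))) (at x)" for x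
      using straighten_deriv bl by (simp add: bounded_linear_Blinfun_apply)
    show "continuous_on UNIV (\<lambda>x. Blinfun (A x))"
    proof (rule continuous_on_blinfun_componentwise)
      fix i :: 'a
      have "continuous_on UNIV (\<lambda>x. A x i)"
        unfolding A_eq by (rule continuous_on_polymonial_function[OF polynomial_function_frechet_derivative[OF straighten_poly]])
      then show "continuous_on UNIV (\<lambda>x. blinfun_apply (Blinfun (A x)) i)"
        using bl by (simp add: bounded_linear_Blinfun_apply)
    qed
    show "Blinfun B o\<^sub>L Blinfun (A p) = id_blinfun"
      by (rule blinfun_eqI) (use bl Bbl B(2) in \<open>simp add: bounded_linear_Blinfun_apply\<close>)
  qed (auto simp: bl bounded_linear_Blinfun_apply)
  obtain L :: "'d \<Rightarrow> 'a" where L: "linear L" "range L = T" "inj L"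
    using subspace_isomorphism[OF subspace_UNIV subspace_T, where 'a = 'd] dim by auto
  obtain L' where L': "linear L'" "\<And>d. L' (L d) = d"
    using linear_injective_left_inverse[OF L(1,3)] by (metis comp_apply id_apply)
  \<comment> \<open>The neighbourhood on which \<open>focal_if_straighten\<close> applies.\<close>
  define W where "W = {x. (\<Sum>b\<in>Basis. norm (H x b - H p b)) < 36}"
  have W: "open W"
    unfolding W_def
    by (intro open_Collect_less continuous_intros continuous_on_polymonial_function[OF H_poly])
  define U where "U = L -` (V \<inter> h -` W)"
  define \<phi> where "\<phi> d = h (L d)" for d
  have contL: "continuous_on UNIV L" using L(1) linear_continuous_on linear_conv_bounded_linear by blast
  have openU: "open U"
    unfolding U_def
    by (intro open_vimage contL continuous_open_preimage[OF homeomorphism_cont2[OF hom] V(1) W])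
  have UV: "L d \<in> V" "h (L d) \<in> W" "h (L d) \<in> U'" "straighten (h (L d)) = L d" if "d \<in> U" for d
    using that hom unfolding U_def homeomorphism_def by auto
  have image: "\<phi> ` U = focal_plus F \<inter> (U' \<inter> W)"
  proof (intro equalityI subsetI)
    fix x assume "x \<in> \<phi> ` U"
    then obtain d where d: "d \<in> U" "x = h (L d)" unfolding \<phi>_def by blast
    have "straighten x \<in> T" using UV(4)[OF d(1)] d(2) L(2) by auto
    then have "x \<in> focal_plus F"
      using focal_if_straighten UV(2)[OF d(1)] d(2) unfolding W_def by blast
    then show "x \<in> focal_plus F \<inter> (U' \<inter> W)" using UV[OF d(1)] d(2) by blast
  next
    fix x assume x: "x \<in> focal_plus F \<inter> (U' \<inter> W)"
    then obtain d where d: "straighten x = L d" using straighten_focal L(2) by blast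
    have "h (L d) = x" "L d \<in> V" using x hom unfolding d[symmetric] homeomorphism_def by auto
    then have "d \<in> U" "\<phi> d = x" using x unfolding U_def \<phi>_def by auto
    then show "x \<in> \<phi> ` U" by blast
  qed
  have pW: "p \<in> W" unfolding W_def by simp
  have pM: "p \<in> focal_plus F" using p_unit F_p by (simp add: focal_plus_def sphere_level_def norm_eq_1)
  have deriv: "(\<phi> has_derivative (\<lambda>v. inv (A (\<phi> d)) (L v))) (at d)" if "d \<in> U" for d
  proof -
    have "(L has_derivative L) (at d)"
      by (rule bounded_linear_imp_has_derivative) (use L(1) linear_conv_bounded_linear in blast)
    from has_derivative_compose[OF this h'(1)[OF UV(1)[OF that]]] show ?thesis
      unfolding \<phi>_def h'(2)[OF UV(1)[OF that]] .
  qed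
  interpret inverse_chart: polynomial_inverse_chart straighten \<phi> L U
    by unfold_locales
      (use straighten_poly openU h'(3) UV(1) deriv in \<open>auto simp: A_eq[symmetric] \<phi>_def\<close>)
  have "local_parametrization \<phi> U (focal_plus F)"
    unfolding local_parametrization_def
  proof (intro conjI ballI)
    show "smooth_on U \<phi>" by (rule inverse_chart.smooth_chart)
    show "openin (top_of_set (focal_plus F)) (\<phi> ` U)"
      unfolding image using U'(1) W by (auto simp: openin_open)
    show "inj (frechet_derivative \<phi> (at d))" if "d \<in> U" for d
    proof -
      have "inj (\<lambda>v. inv (A (\<phi> d)) (L v))"
        using h'(3)[OF UV(1)[OF that]] L(3) unfolding \<phi>_def
        by (metis (no_types, lifting) bij_imp_bij_inv bij_is_inj inj_def)
      then show ?thesis using frechet_derivative_at[OF deriv[OF that]] by simp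
    qed
    show "\<exists>\<psi>. homeomorphism U (\<phi> ` U) \<phi> \<psi>"
    proof (rule exI[of _ "\<lambda>x. L' (straighten x)"], rule homeomorphismI)
      show "continuous_on U \<phi>"
        using deriv by (auto intro!: continuous_at_imp_continuous_on has_derivative_continuous)
      show "continuous_on (\<phi> ` U) (\<lambda>x. L' (straighten x))"
        by (rule continuous_on_compose2[OF _ continuous_on_polymonial_function[OF straighten_poly], of UNIV])
          (use L'(1) linear_continuous_on linear_conv_bounded_linear in auto)
    qed (auto simp: \<phi>_def UV(4) L'(2))
  qed
  then show ?thesis using image pM pW U'(2) by blast
qed

end

section \<open>Multiplicities and the main theorem\<close>

lemma local_parametrization_immersion:
  "local_parametrization \<phi> U S \<Longrightarrow> smooth_immersion \<phi> U"
  unfolding local_parametrization_def smooth_immersion_def by blast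

lemma local_parametrization_mem: "local_parametrization \<phi> U S \<Longrightarrow> u \<in> U \<Longrightarrow> \<phi> u \<in> S"
  unfolding local_parametrization_def by (meson image_subset_iff openin_imp_subset)

lemma range_derivative_subset_tangent_space:
  assumes "local_parametrization \<phi> U S" "u \<in> U"
  shows "range (frechet_derivative \<phi> (at u)) \<subseteq> tangent_space S (\<phi> u)"
proof
  interpret smooth_immersion \<phi> U by (rule local_parametrization_immersion[OF assms(1)])
  fix v assume "v \<in> range (frechet_derivative \<phi> (at u))"
  then obtain x where x: "v = J u x" unfolding J_def by blast
  have line: "((\<lambda>s. u + s *\<^sub>R x) has_derivative (\<lambda>h. h *\<^sub>R x)) (at (0::real))"
    by (auto intro!: derivative_eq_intros)
  have "((\<lambda>s. \<phi> (u + s *\<^sub>R x)) has_vector_derivative v) (at 0)"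
    using has_derivative_compose[OF line, of \<phi> "J u"] \<phi>_deriv[OF assms(2)]
    by (simp add: has_vector_derivative_def x linear_cmul[OF J_linear[OF assms(2)]])
  moreover have "((\<lambda>s. u + s *\<^sub>R x) \<longlongrightarrow> u) (nhds (0::real))"
  proof -
    have "((\<lambda>s. u + s *\<^sub>R x) \<longlongrightarrow> u + 0 *\<^sub>R x) (nhds (0::real))"
      by (intro tendsto_intros filterlim_ident)
    then show ?thesis by simp
  qed
  then have "eventually (\<lambda>s. u + s *\<^sub>R x \<in> U) (nhds (0::real))"
    using topological_tendstoD[OF _ open_U assms(2)] by blast
  then have "eventually (\<lambda>s. \<phi> (u + s *\<^sub>R x) \<in> S) (nhds (0::real))"
    by eventually_elim (rule local_parametrization_mem[OF assms(1)])
  ultimately show "v \<in> tangent_space S (\<phi> u)"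
    unfolding tangent_space_def by (auto intro!: exI[of _ "\<lambda>s. \<phi> (u + s *\<^sub>R x)"])
qed

context muenzner_sextic
begin

lemma muenzner_sextic_uminus: "muenzner_sextic (\<lambda>x. - F x)"
proof
  have grad: "frechet_derivative (\<lambda>x. - F x) (at x) = (\<lambda>v. - G x \<bullet> v)" for x
    using frechet_derivative_at[OF has_derivative_minus[OF F_deriv]] by simp
  have "gradient (\<lambda>x. - F x) x = - G x" for x
  proof (rule euclidean_eqI)
    fix b :: 'a assume "b \<in> Basis"
    then show "gradient (\<lambda>x. - F x) x \<bullet> b = - G x \<bullet> b"
      unfolding gradient_def grad by (rule inner_sum_left_Basis)
  qed
  then show "(norm (gradient (\<lambda>x. - F x) x))\<^sup>2 = 36 * norm x ^ 10" for x
    using gradient_norm[of x] by (simp add: G_def)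
  have "frechet_derivative (\<lambda>y. - G y \<bullet> b) (at x) b = - (H x b \<bullet> b)" for x b
    using frechet_derivative_eqI[OF has_derivative_minus[OF has_derivative_inner_left[OF G_deriv]], of b x b] by simp
  then show "laplacian (\<lambda>x. - F x) x = 0" for x
    unfolding laplacian_def grad using H_trace[OF ONB_Basis, of x] by (simp add: sum_negf)
  show "- F (c *\<^sub>R x) = c ^ 6 * - F x" for c x by (simp add: F_scale)
qed (rule real_polynomial_function_minus[OF F_poly])

text \<open>\<open>tangent_space\<close> is only a set of velocities. It lies between the range of
  the chart derivative and the orthogonal complement of \<open>q\<close> and \<open>\<nu>\<close>,
  and a dimension count makes all three equal. The normalisation of \<open>\<nu>\<close> comes from
  \<open>\<bar>G q - 6 t q\<bar>^2 = 36 * (1 - t\<^sup>2)\<close>.\<close>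

lemma tangent_space_level:
  fixes \<phi> :: "'e::euclidean_space \<Rightarrow> 'a"
  assumes t: "-1 < t" "t < 1" and \<phi>: "local_parametrization \<phi> U (sphere_level F t)" and u: "u \<in> U"
    and dim: "DIM('a) = DIM('e) + 2"
  defines "q \<equiv> \<phi> u"
  defines "\<nu> \<equiv> (1 / (6 * sqrt (1 - t\<^sup>2))) *\<^sub>R (G q - (6 * t) *\<^sub>R q)"
  shows "tangent_space (sphere_level F t) q = {v. v \<bullet> q = 0 \<and> v \<bullet> \<nu> = 0}"
    and "dim {v. v \<bullet> q = 0 \<and> v \<bullet> \<nu> = 0} = DIM('e)" and "norm \<nu> = 1" and "\<nu> \<bullet> q = 0"
proof -
  let ?W = "{v. v \<bullet> q = 0 \<and> v \<bullet> \<nu> = 0}"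
  have "q \<in> sphere_level F t" unfolding q_def by (rule local_parametrization_mem[OF \<phi> u])
  then have q: "q \<bullet> q = 1" "F q = t" unfolding sphere_level_def by (auto simp: norm_eq_1)
  have t2: "1 - t\<^sup>2 > 0" using t by (simp add: power2_eq_square abs_square_less_1[unfolded power2_eq_square])
  have Gq: "G q \<bullet> q = 6 * t" using Euler_F[of q] q by simp
  show \<nu>q: "\<nu> \<bullet> q = 0" unfolding \<nu>_def using Gq q by (simp add: inner_diff_left)
  have "(G q - (6 * t) *\<^sub>R q) \<bullet> (G q - (6 * t) *\<^sub>R q) = 36 * (1 - t\<^sup>2)"
    using Gq G_norm[of q] q
    by (simp add: inner_diff_left inner_diff_right inner_commute[of q "G q"] power2_eq_square)
  then have "\<nu> \<bullet> \<nu> = 1"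
    unfolding \<nu>_def using t2 by (simp add: power2_eq_square[symmetric])
  then show "norm \<nu> = 1" by (simp add: norm_eq_1)
  have W: "subspace ?W" unfolding subspace_def by (auto simp: inner_add_left)
  obtain Q where Q: "ONB ?W Q" using ONB_exists[OF W] .
  have QW: "b \<bullet> q = 0" "b \<bullet> \<nu> = 0" "norm b = 1" if "b \<in> Q" for b
    using ONB_mem[OF Q that] Q that unfolding ONB_def by auto
  \<comment> \<open>Adjoining \<open>q\<close> and \<open>\<nu>\<close> keeps the basis independent,
    which bounds the dimension of \<open>?W\<close> from above by \<open>DIM('e)\<close>.\<close>
  have "pairwise orthogonal (insert q (insert \<nu> Q))"
    using Q \<nu>q QW unfolding ONB_def pairwise_insert by (auto simp: orthogonal_def inner_commute)
  moreover have nz: "q \<noteq> 0" "\<nu> \<noteq> 0" using q(1) \<open>\<nu> \<bullet> \<nu> = 1\<close> by auto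
  then have "0 \<notin> insert q (insert \<nu> Q)" using QW(3) by force
  ultimately have "independent (insert q (insert \<nu> Q))" using pairwise_orthogonal_independent by blast
  then have "card (insert q (insert \<nu> Q)) \<le> DIM('a)" using independent_card_le by blast
  moreover have "q \<notin> insert \<nu> Q" "\<nu> \<notin> Q" using \<nu>q QW q(1) \<open>\<nu> \<bullet> \<nu> = 1\<close> by auto
  ultimately have dimW: "dim ?W \<le> DIM('e)"
    using dim ONB_card[OF Q] ONB_finite[OF Q] by simp
  have sub: "tangent_space (sphere_level F t) q \<subseteq> ?W"
  proof
    fix v assume "v \<in> tangent_space (sphere_level F t) q"
    then obtain \<gamma> where \<gamma>: "\<gamma> (0::real) = q" "(\<gamma> has_vector_derivative v) (at 0)"
      "eventually (\<lambda>s. \<gamma> s \<in> sphere_level F t) (nhds 0)"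
      unfolding tangent_space_def by blast
    have \<gamma>': "(\<gamma> has_derivative (\<lambda>h. h *\<^sub>R v)) (at 0)" using \<gamma>(2) by (simp add: has_vector_derivative_def)
    have on: "\<forall>\<^sub>F s in at 0. \<gamma> s \<in> sphere_level F t" "\<gamma> 0 \<in> sphere_level F t"
      using \<gamma>(3) eventually_nhds_x_imp_x by (auto simp: eventually_at_filter elim: eventually_mono)
    have "((\<lambda>s. \<gamma> s \<bullet> \<gamma> s) has_derivative (\<lambda>h. \<gamma> 0 \<bullet> (h *\<^sub>R v) + (h *\<^sub>R v) \<bullet> \<gamma> 0)) (at 0)"
      by (rule has_derivative_inner[OF \<gamma>' \<gamma>'])
    then have "((\<lambda>s. 1) has_derivative (\<lambda>h. \<gamma> 0 \<bullet> (h *\<^sub>R v) + (h *\<^sub>R v) \<bullet> \<gamma> 0)) (at 0)"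
      by (rule has_derivative_transform_eventually)
        (use on in \<open>auto simp: sphere_level_def norm_eq_1 elim: eventually_mono\<close>)
    from has_derivative_unique_apply[OF this has_derivative_const, of 1]
    have vq: "v \<bullet> q = 0" by (simp add: \<gamma>(1) inner_commute)
    have "((\<lambda>s. F (\<gamma> s)) has_derivative (\<lambda>h. G (\<gamma> 0) \<bullet> (h *\<^sub>R v))) (at 0)"
      by (rule has_derivative_compose[OF \<gamma>' F_deriv])
    then have "((\<lambda>s. t) has_derivative (\<lambda>h. G (\<gamma> 0) \<bullet> (h *\<^sub>R v))) (at 0)"
      by (rule has_derivative_transform_eventually)
        (use on in \<open>auto simp: sphere_level_def elim: eventually_mono\<close>)
    from has_derivative_unique_apply[OF this has_derivative_const, of 1]
    have "G q \<bullet> v = 0" by (simp add: \<gamma>(1))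
    then show "v \<in> ?W" using vq unfolding \<nu>_def by (simp add: inner_diff_right inner_commute)
  qed
  interpret smooth_immersion \<phi> U by (rule local_parametrization_immersion[OF \<phi>])
  have J: "frechet_derivative \<phi> (at u) = J u" unfolding J_def[abs_def] ..
  have sub': "range (J u) \<subseteq> tangent_space (sphere_level F t) q"
    using range_derivative_subset_tangent_space[OF \<phi> u] unfolding q_def J .
  have "dim (range (J u)) = dim (UNIV :: 'e set)"
    by (rule dim_image_eq[OF J_linear[OF u]]) (use J_inj[OF u] in simp)
  then have dJ: "dim (range (J u)) = DIM('e)" by simp
  have "range (J u) = ?W"
    by (rule subspace_dim_equal[OF linear_subspace_image[OF J_linear[OF u] subspace_UNIV] W])
      (use sub sub' dimW dJ in auto)
  then show "tangent_space (sphere_level F t) q = ?W" "dim ?W = DIM('e)"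
    using sub sub' dJ by auto
qed

text \<open>Up to a sign that is locally constant along curves in the level set, the given normal field is the
  normalized spherical gradient of \<open>F\<close>. So its shape operator is symmetric, and the multiplicities of the
  principal curvatures add up to the dimension.\<close>

lemma sum_multiplicities:
  fixes \<phi> :: "'e::euclidean_space \<Rightarrow> 'a"
  assumes iso: "closed_connected_isoparametric TYPE('e) M \<xi>" and M: "M = sphere_level F t"
    and t: "-1 < t" "t < 1" and q: "q \<in> M"
  shows "(\<Sum>k\<in>principal_curvatures M \<xi> q. multiplicity_of M \<xi> q k) = DIM('e)"
proof -
  have dim: "DIM('a) = DIM('e) + 2" using iso unfolding closed_connected_isoparametric_def by simp
  define c where "c = 1 / (6 * sqrt (1 - t\<^sup>2))"
  define \<nu> where "\<nu> x = c *\<^sub>R (G x - (6 * t) *\<^sub>R x)" for x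
  define W where "W x = {v. v \<bullet> x = 0 \<and> v \<bullet> \<nu> x = 0}" for x
  have chart: "\<exists>(\<phi> :: 'e \<Rightarrow> 'a) U u. local_parametrization \<phi> U M \<and> u \<in> U \<and> x = \<phi> u" if "x \<in> M" for x
    using iso that unfolding closed_connected_isoparametric_def smooth_submanifold_def by blast
  have geom: "tangent_space M x = W x \<and> dim (W x) = DIM('e) \<and> norm (\<nu> x) = 1 \<and> \<nu> x \<bullet> x = 0" if x: "x \<in> M" for x
  proof -
    obtain \<phi> :: "'e \<Rightarrow> 'a" and U u where \<phi>: "local_parametrization \<phi> U M" "u \<in> U" "x = \<phi> u"
      using chart[OF x] by blast
    show ?thesis
      using tangent_space_level[OF t \<phi>(1)[unfolded M] \<phi>(2) dim] unfolding M W_def \<nu>_def c_def \<phi>(3) by blast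
  qed
  obtain V where V: "M \<subseteq> V" "smooth_on V \<xi>"
    and \<xi>: "\<And>x. x \<in> M \<Longrightarrow> norm (\<xi> x) = 1 \<and> \<xi> x \<bullet> x = 0 \<and> (\<forall>v\<in>W x. \<xi> x \<bullet> v = 0)"
    using iso geom unfolding closed_connected_isoparametric_def unit_normal_field_def by force
  have \<xi>_deriv: "(\<xi> has_derivative frechet_derivative \<xi> (at q)) (at q)"
    using V q Ck_on_Suc_has_derivative[of V 0 \<xi> q] unfolding smooth_on_def by blast
  have sign: "\<xi> x = (\<xi> x \<bullet> \<nu> x) *\<^sub>R \<nu> x \<and> (\<xi> x \<bullet> \<nu> x = 1 \<or> \<xi> x \<bullet> \<nu> x = - 1)" if x: "x \<in> M" for x
  proof -
    note g = geom[OF x] and X = \<xi>[OF x]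
    have \<nu>\<nu>: "\<nu> x \<bullet> \<nu> x = 1" using g by (simp add: norm_eq_1)
    define z where "z = \<xi> x - (\<xi> x \<bullet> \<nu> x) *\<^sub>R \<nu> x"
    have zW: "z \<in> W x" unfolding z_def W_def using g X \<nu>\<nu> by (simp add: inner_diff_left)
    have "\<xi> x \<bullet> z = 0" "\<nu> x \<bullet> z = 0" using X zW by (auto simp: W_def inner_commute)
    then have "z \<bullet> z = 0" by (subst z_def) (simp add: inner_diff_left)
    then have eq: "\<xi> x = (\<xi> x \<bullet> \<nu> x) *\<^sub>R \<nu> x" unfolding z_def by simp
    have "\<bar>\<xi> x \<bullet> \<nu> x\<bar> = 1" using arg_cong[OF eq, of norm] X g by simp
    then show ?thesis using eq by (auto simp: abs_if split: if_splits)
  qed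
  define \<epsilon> where "\<epsilon> = \<xi> q \<bullet> \<nu> q"
  have \<nu>_deriv: "(\<nu> has_derivative (\<lambda>v. c *\<^sub>R (H x v - (6 * t) *\<^sub>R v))) (at x)" for x
    unfolding \<nu>_def by (auto intro!: derivative_eq_intros G_deriv)
  have shape: "shape_operator \<xi> q v = (- \<epsilon> * c) *\<^sub>R (H q v - (6 * t) *\<^sub>R v)" if v: "v \<in> W q" for v
  proof -
    have "v \<in> tangent_space M q" using v geom[OF q] by simp
    then obtain \<gamma> where \<gamma>: "\<gamma> (0::real) = q" "(\<gamma> has_vector_derivative v) (at 0)"
      "eventually (\<lambda>s. \<gamma> s \<in> M) (nhds 0)"
      unfolding tangent_space_def by blast
    have \<gamma>': "(\<gamma> has_derivative (\<lambda>h. h *\<^sub>R v)) (at 0)" using \<gamma>(2) by (simp add: has_vector_derivative_def)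
    have d1: "((\<lambda>s. \<xi> (\<gamma> s)) has_derivative (\<lambda>h. frechet_derivative \<xi> (at q) (h *\<^sub>R v))) (at 0)"
      by (rule has_derivative_compose[OF \<gamma>']) (use \<xi>_deriv \<gamma>(1) in simp)
    have d2: "((\<lambda>s. \<nu> (\<gamma> s)) has_derivative (\<lambda>h. c *\<^sub>R (H q (h *\<^sub>R v) - (6 * t) *\<^sub>R (h *\<^sub>R v)))) (at 0)"
      by (rule has_derivative_compose[OF \<gamma>']) (use \<nu>_deriv \<gamma>(1) in simp)
    have on: "\<forall>\<^sub>F s in at 0. \<gamma> s \<in> M"
      using \<gamma>(3) by (auto simp: eventually_at_filter elim: eventually_mono)
    have "isCont (\<lambda>s. \<xi> (\<gamma> s) \<bullet> \<nu> (\<gamma> s)) 0"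
      by (intro continuous_intros has_derivative_continuous[OF d1] has_derivative_continuous[OF d2])
    then have "((\<lambda>s. \<xi> (\<gamma> s) \<bullet> \<nu> (\<gamma> s)) \<longlongrightarrow> \<epsilon>) (at 0)"
      unfolding isCont_def \<gamma>(1) \<epsilon>_def .
    \<comment> \<open>Two values in \<open>{1, -1}\<close> at distance less than 1 coincide.\<close>
    then have "\<forall>\<^sub>F s in at 0. dist (\<xi> (\<gamma> s) \<bullet> \<nu> (\<gamma> s)) \<epsilon> < 1" by (rule tendstoD) simp
    then have "\<forall>\<^sub>F s in at 0. \<xi> (\<gamma> s) = \<epsilon> *\<^sub>R \<nu> (\<gamma> s)"
      using on
    proof eventually_elim
      case (elim s)
      have "\<xi> (\<gamma> s) \<bullet> \<nu> (\<gamma> s) = \<epsilon>"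
        using elim(1) sign[OF elim(2)] sign[OF q] unfolding \<epsilon>_def[symmetric] dist_real_def by auto
      then show ?case using sign[OF elim(2)] by simp
    qed
    moreover have "\<xi> (\<gamma> 0) = \<epsilon> *\<^sub>R \<nu> (\<gamma> 0)" unfolding \<gamma>(1) \<epsilon>_def using sign[OF q] by blast
    ultimately have "((\<lambda>s. \<epsilon> *\<^sub>R \<nu> (\<gamma> s)) has_derivative (\<lambda>h. frechet_derivative \<xi> (at q) (h *\<^sub>R v))) (at 0)"
      using d1 by (intro has_derivative_transform_eventually[OF d1]) auto
    moreover have "((\<lambda>s. \<epsilon> *\<^sub>R \<nu> (\<gamma> s)) has_derivative
       (\<lambda>h. \<epsilon> *\<^sub>R (c *\<^sub>R (H q (h *\<^sub>R v) - (6 * t) *\<^sub>R (h *\<^sub>R v))))) (at 0)"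
      by (rule has_derivative_scaleR_right[OF d2])
    ultimately have "frechet_derivative \<xi> (at q) (1 *\<^sub>R v) = \<epsilon> *\<^sub>R (c *\<^sub>R (H q (1 *\<^sub>R v) - (6 * t) *\<^sub>R (1 *\<^sub>R v)))"
      by (rule has_derivative_unique_apply)
    then show ?thesis unfolding shape_operator_def by simp
  qed
  define A where "A v = (- \<epsilon> * c) *\<^sub>R (H q v - (6 * t) *\<^sub>R v)" for v
  have A: "linear A" unfolding A_def by (rule linearI) (simp_all add: H_simps algebra_simps)
  have W: "subspace (W q)" unfolding W_def subspace_def by (auto simp: inner_add_left)
  have qq: "q \<bullet> q = 1" using q unfolding M sphere_level_def by (simp add: norm_eq_1)
  have c: "c \<noteq> 0" using geom[OF q] unfolding \<nu>_def by auto
  \<comment> \<open>\<open>H q\<close> sends \<open>q\<close> to \<open>5 G q\<close> and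
    \<open>G q\<close> to \<open>180 q\<close>; being symmetric, it preserves the orthogonal
    complement \<open>W q\<close> of their span.\<close>
  have A_W: "A v \<in> W q" if v: "v \<in> W q" for v
  proof -
    have vq: "v \<bullet> q = 0" and vG: "v \<bullet> G q = 0"
      using v c unfolding W_def \<nu>_def by (auto simp: inner_diff_right)
    have "H q v \<bullet> q = 0" unfolding H_sym[of q v] Euler_G using vG by (simp add: inner_commute)
    moreover have "H q v \<bullet> G q = 0" unfolding H_sym[of q v] H_G using vq by (simp add: inner_commute)
    ultimately show ?thesis
      using vq vG unfolding W_def A_def \<nu>_def by (simp add: inner_diff_left inner_diff_right)
  qed
  have sym: "A v \<bullet> w = A w \<bullet> v" for v w
    unfolding A_def using H_sym[of q v w] by (simp add: inner_diff_left inner_commute[of w v])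
  have E: "principal_space M \<xi> q k = {v \<in> W q. A v = k *\<^sub>R v}" for k
    unfolding principal_space_def A_def using geom[OF q] shape by auto
  show ?thesis
    using sum_dim_eigenspaces[OF A W A_W sym] geom[OF q]
    unfolding multiplicity_of_def principal_curvatures_def E by simp
qed

section \<open>Dimensions and Ricci curvature of the focal sets\<close>

lemma focal_dims:
  assumes "DIM('a) = 6 * m + 2" "p \<in> focal_plus F"
  shows "dim (muenzner_focal.T F p) = 5 * m" "dim (muenzner_focal.N F p) = m + 1"
proof -
  interpret muenzner_focal F p by (rule muenzner_focal_focal_plus[OF assms(2)])
  obtain B C where "ONB T B" "ONB N C"
    using ONB_exists subspace_T subspace_N by metis
  then have "DIM('a) = 1 + dim T + dim N" by (rule adapted_basis(3))
  \<comment> \<open>Solves \<open>1 + dim T + dim N = 6 * m + 2\<close> together with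
    \<open>dim T + 5 = 5 * dim N\<close>.\<close>
  then show "dim T = 5 * m" "dim N = m + 1" using assms(1) dim_T by auto
qed

lemma focal_chart_local_parametrization:
  fixes \<phi> :: "'d::euclidean_space \<Rightarrow> 'a"
  assumes "DIM('a) = 6 * m + 2" "DIM('d) = 5 * m" "local_parametrization \<phi> U (focal_plus F)" "u \<in> U"
  shows "focal_chart F (\<phi> u) \<phi> U u"
proof -
  have p: "\<phi> u \<in> focal_plus F" using local_parametrization_mem assms by blast
  show ?thesis
    unfolding focal_chart_def focal_chart_axioms_def
    using muenzner_focal_focal_plus[OF p] local_parametrization_immersion[OF assms(3)]
      local_parametrization_mem[OF assms(3)] focal_dims(1)[OF assms(1) p] assms(2,4) by simp
qed

lemma smooth_submanifold_focal_plus: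
  assumes "DIM('a) = 6 * m + 2" "DIM('d::euclidean_space) = 5 * m"
  shows "smooth_submanifold TYPE('d) (focal_plus F)"
  unfolding smooth_submanifold_def
proof
  fix p assume p: "p \<in> focal_plus F"
  show "\<exists>(\<phi> :: 'd \<Rightarrow> 'a) U. local_parametrization \<phi> U (focal_plus F) \<and> p \<in> \<phi> ` U"
    by (rule muenzner_focal.focal_parametrization[OF muenzner_focal_focal_plus[OF p]])
      (simp add: assms focal_dims[OF assms(1) p])
qed

lemma not_ricci_nonnegative_focal_plus:
  assumes dims: "DIM('a) = 6 * 1 + 2" "DIM('d::euclidean_space) = 5 * 1" and p: "p \<in> focal_plus F"
  shows "\<not> ricci_nonnegative TYPE('d) (focal_plus F)"
proof
  assume nonneg: "ricci_nonnegative TYPE('d) (focal_plus F)"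
  obtain \<phi> :: "'d \<Rightarrow> 'a" and U u where \<phi>: "local_parametrization \<phi> U (focal_plus F)" "u \<in> U" "p = \<phi> u"
    using smooth_submanifold_focal_plus[OF dims] p unfolding smooth_submanifold_def by blast
  interpret focal_chart F p \<phi> U u
    unfolding \<phi>(3) by (rule focal_chart_local_parametrization[OF dims \<phi>(1,2)])
  obtain C v where C: "ONB N C" "v \<in> T" "(\<Sum>c\<in>C. S c v \<bullet> S c v) > 4 * (v \<bullet> v)"
    using large_shape_square_sum focal_dims(2)[OF dims(1) p] by auto
  obtain y where y: "v = J u y" using C(2) range_J by blast
  have "ricci (induced_metric \<phi>) u y y < 0"
    unfolding ricci_focal[OF C(1)] using C(3) focal_dims(1)[OF dims(1) p] y by simp
  moreover have "ricci (induced_metric \<phi>) u y y \<ge> 0"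
    using nonneg \<phi>(1,2) unfolding ricci_nonnegative_def by blast
  ultimately show False by simp
qed

text \<open>With \<open>dim T = 10\<close> and \<open>dim N = 3\<close>, the coefficient
  \<open>dim T - 1 = 9\<close> balances the largest possible sum \<open>3 * 3\<close>.\<close>

lemma ricci_nonnegative_focal_plus:
  assumes dims: "DIM('a) = 6 * 2 + 2" "DIM('d::euclidean_space) = 5 * 2"
  shows "ricci_nonnegative TYPE('d) (focal_plus F)"
  unfolding ricci_nonnegative_def
proof (intro allI impI ballI)
  fix \<phi> :: "'d \<Rightarrow> 'a" and U u y
  assume \<phi>: "local_parametrization \<phi> U (focal_plus F)" and u: "u \<in> U"
  have p: "\<phi> u \<in> focal_plus F" using local_parametrization_mem \<phi> u by blast
  interpret focal_chart F "\<phi> u" \<phi> U u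
    by (rule focal_chart_local_parametrization[OF dims \<phi> u])
  obtain C where C: "ONB N C" using ONB_exists[OF subspace_N] .
  have "(\<Sum>c\<in>C. S c (J u y) \<bullet> S c (J u y)) \<le> (\<Sum>c\<in>C. 3 * (J u y \<bullet> J u y))"
    by (rule sum_mono)
      (use ONB_mem[OF C] ONB_inner[OF C] J_T in \<open>auto intro: shape_inner_le\<close>)
  then show "ricci (induced_metric \<phi>) u y y \<ge> 0"
    unfolding ricci_focal[OF C]
    using focal_dims[OF dims(1) p] ONB_card[OF C] by simp
qed

end

theorem proposition3p2:
  fixes M :: "'a::euclidean_space set"
    and \<xi> :: "'a \<Rightarrow> 'a"
    and F :: "'a \<Rightarrow> real"
    and t :: real
    and m n :: nat
  assumes ambient: "DIM('a) = n + 2"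
    and hypersurface_dim: "DIM('e::euclidean_space) = n"
    and m: "m \<in> {1, 2}"
    and isoparametric: "closed_connected_isoparametric TYPE('e) M \<xi>"
    and six_curvatures: "\<forall>p\<in>M. card (principal_curvatures M \<xi> p) = 6"
    and multiplicities: "\<forall>p\<in>M. \<forall>k\<in>principal_curvatures M \<xi> p. multiplicity_of M \<xi> p k = m"
    and polynomial: "cartan_muenzner_polynomial 6 m m F"
    and image: "F ` sphere 0 1 = {-1..1}"
    and t: "-1 < t" "t < 1"
    and level: "M = sphere_level F t"
    and focal_dim: "DIM('d::euclidean_space) = 5 * m"
  shows "smooth_submanifold TYPE('d) (focal_plus F) \<and> smooth_submanifold TYPE('d) (focal_minus F) \<and>
    (m = 1 \<longrightarrow> \<not> ricci_nonnegative TYPE('d) (focal_plus F) \<and>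
               \<not> ricci_nonnegative TYPE('d) (focal_minus F)) \<and>
    (m = 2 \<longrightarrow> ricci_nonnegative TYPE('d) (focal_plus F) \<and>
               ricci_nonnegative TYPE('d) (focal_minus F))"
proof -
  interpret plus: muenzner_sextic F
    using polynomial unfolding cartan_muenzner_polynomial_def homogeneous_polynomial_def
    by unfold_locales auto
  interpret minus: muenzner_sextic "\<lambda>x. - F x" by (rule plus.muenzner_sextic_uminus)
  have minus: "focal_minus F = focal_plus (\<lambda>x. - F x)"
    unfolding focal_minus_def focal_plus_def sphere_level_def by auto
  obtain q where q: "q \<in> M" using isoparametric unfolding closed_connected_isoparametric_def by blast
  have "(\<Sum>k\<in>principal_curvatures M \<xi> q. multiplicity_of M \<xi> q k) = n"
    using plus.sum_multiplicities[OF isoparametric level t q] hypersurface_dim by simp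
  moreover have "(\<Sum>k\<in>principal_curvatures M \<xi> q. multiplicity_of M \<xi> q k) = 6 * m"
    using multiplicities six_curvatures q by simp
  \<comment> \<open>The multiplicities of the six principal curvatures fix the ambient dimension,
    and thereby the dimensions of both focal sets.\<close>
  ultimately have dim: "DIM('a) = 6 * m + 2" using ambient by simp
  \<comment> \<open>The image of \<open>F\<close> supplies a point on each focal set, at which a
    negative direction is exhibited when \<open>m = 1\<close>.\<close>
  have "1 \<in> F ` sphere 0 1" "-1 \<in> F ` sphere 0 1" unfolding image by auto
  then obtain p p' where p: "p \<in> focal_plus F" "p' \<in> focal_plus (\<lambda>x. - F x)"
    unfolding focal_plus_def sphere_level_def by force
  have "\<not> ricci_nonnegative TYPE('d) (focal_plus F) \<and> \<not> ricci_nonnegative TYPE('d) (focal_plus (\<lambda>x. - F x))"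
    if "m = 1"
    using plus.not_ricci_nonnegative_focal_plus[OF dim[unfolded that] focal_dim[unfolded that] p(1)]
      minus.not_ricci_nonnegative_focal_plus[OF dim[unfolded that] focal_dim[unfolded that] p(2)] by blast
  moreover have "ricci_nonnegative TYPE('d) (focal_plus F) \<and> ricci_nonnegative TYPE('d) (focal_plus (\<lambda>x. - F x))"
    if "m = 2"
    using plus.ricci_nonnegative_focal_plus[OF dim[unfolded that] focal_dim[unfolded that]]
      minus.ricci_nonnegative_focal_plus[OF dim[unfolded that] focal_dim[unfolded that]] by blast
  ultimately show ?thesis
    unfolding minus
    using plus.smooth_submanifold_focal_plus[OF dim focal_dim] minus.smooth_submanifold_focal_plus[OF dim focal_dim]
    by blast
qed

end
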